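(* Let $\mu^n_t$ be the law of the environment process $\xi^n_t$ at time $t$, and let $H_n(t)=H(\mu^n_t\,|\,\nu_\rho)$ be its relative entropy with respect to $\nu_\rho$. There exists a constant $C$, depending only on $\rho$, $\{r_z;z\in R\}$ and $\epsilon_0$ (in particular not on $n$), such that $H_n'(t)\le C$ for every $t\ge0$. In particular, $H_n(t)\le Ct$ for every $t\ge0$.
   Context: Configurations: $\Omega=\{0,1\}^{\mathbb Z}$. For $x\in\mathbb Z$ the shift $\tau_x:\Omega\to\Omega$ is $(\tau_x\eta)(y)=\eta(x+y)$. A function on $\Omega$ is local if it depends only on finitely many coordinates. $\eta^{x,x+1}$ is the configuration obtained from $\eta$ by exchanging the values at $x$ and $x+1$. Interaction rate: $c:\Omega\to[0,\infty)$ satisfies (i) $c$ is local; (ii) there is $\epsilon_0>0$ with $c(\eta)\ge\epsilon_0$ for all $\eta\in\Omega$; (iii) $c(\eta)=c(\xi)$ whenever $\eta(x)=\xi(x)$ for all $x\ne 0,1$. Put $c_x(\eta)=c(\tau_x\eta)$. The lattice gas is the Markov process $(\eta_t)_{t\ge0}$ on $\Omega$ generated by $L_bf(\eta)=\sum_{x\in\mathbb Z}c_x(\eta)[f(\eta^{x,x+1})-f(\eta)]$ ($f$ local). Fix $\rho\in(0,1)$; $\nu_\rho$ is the product measure on $\Omega$ under which each $\eta(x)$ is Bernoulli with parameter $\rho$. The lattice gas starts from $\nu_\rho$. Set $\eta^n_t=\eta_{tn^2}$, $n\in\mathbb N$. Random walk: $R\subseteq\mathbb Z\setminus\{0\}$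 is a finite set and for each $z\in R$, $r_z:\Omega\to[0,\infty)$ is a local function. The walk $(x^n_t)_{t\ge0}$ on $\mathbb Z$ starts at $x_0^n=0$ and jumps from $x$ to $x+z$ ($z\in R$) with instantaneous rate $n\,r_z(\tau_x\eta^n_t)$. Environment process: $\xi^n_t(x)=\eta^n_t(x+x^n_t)$, $x\in\mathbb Z$. It is the Markov process on $\Omega$, started from $\nu_\rho$, with generator $L_n=n^2L_b+nL^{rw}$, where $L^{rw}f(\xi)=\sum_{z\in R}r_z(\xi)(f(\tau_z\xi)-f(\xi))$. Relative entropy: $H(\mu|\nu)=\int f\log f\,d\nu$ with $f=d\mu/d\nu$. *)

theory Defs
  imports "HOL-Probability.Probability"
begin

(* The value True at a site means that the site is occupied. *)
type_synonym config = "int \<Rightarrow> bool"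

definition shift :: "int \<Rightarrow> config \<Rightarrow> config" where
  "shift x \<eta> = (\<lambda>y. \<eta> (x + y))"

definition exchange :: "int \<Rightarrow> config \<Rightarrow> config" where
  "exchange x \<eta> = \<eta>(x := \<eta> (x + 1), x + 1 := \<eta> x)"

definition local_functions :: "(config \<Rightarrow> real) set" where
  "local_functions =
     {f. \<exists>A. finite A \<and> (\<forall>\<eta> \<xi>. (\<forall>y\<in>A. \<eta> y = \<xi> y) \<longrightarrow> f \<eta> = f \<xi>)}"

definition interaction_rate :: "real \<Rightarrow> (config \<Rightarrow> real) \<Rightarrow> bool" where
  "interaction_rate \<epsilon>0 c \<longleftrightarrow>
     c \<in> local_functions \<and>
     (\<forall>\<eta>. \<epsilon>0 \<le> c \<eta>) \<and>
     (\<forall>\<eta> \<xi>. (\<forall>x. x \<noteq> 0 \<and> x \<noteq> 1 \<longrightarrow> \<eta> x = \<xi> x) \<longrightarrow> c \<eta> = c \<xi>)"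

definition bernoulli_product :: "real \<Rightarrow> config measure" where
  "bernoulli_product \<rho> = (\<Pi>\<^sub>M x\<in>UNIV. measure_pmf (bernoulli_pmf \<rho>))"

(* For a local f only finitely many summands are nonzero. *)
definition gas_generator :: "(config \<Rightarrow> real) \<Rightarrow> (config \<Rightarrow> real) \<Rightarrow> config \<Rightarrow> real" where
  "gas_generator c f \<eta> = (\<Sum>\<^sub>\<infinity>x. c (shift x \<eta>) * (f (exchange x \<eta>) - f \<eta>))"

(* A state (\<eta>, x) consists of the gas configuration and the position of the walk. *)
definition joint_local_functions :: "(config \<times> int \<Rightarrow> real) set" where
  "joint_local_functions =
     {f. (\<forall>x. (\<lambda>\<eta>. f (\<eta>, x)) \<in> local_functions) \<and> finite {x. \<exists>\<eta>. f (\<eta>, x) \<noteq> 0}}"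

(* The gas runs at speed n^2; the walk at x jumps to x + z at rate n * r z (shift x \<eta>). *)
definition joint_generator ::
  "(config \<Rightarrow> real) \<Rightarrow> int set \<Rightarrow> (int \<Rightarrow> config \<Rightarrow> real) \<Rightarrow> nat \<Rightarrow>
     (config \<times> int \<Rightarrow> real) \<Rightarrow> config \<times> int \<Rightarrow> real" where
  "joint_generator c R r n f = (\<lambda>(\<eta>, x).
     (real n)\<^sup>2 * gas_generator c (\<lambda>\<zeta>. f (\<zeta>, x)) \<eta> +
     real n * (\<Sum>z\<in>R. r z (shift x \<eta>) * (f (\<eta>, x + z) - f (\<eta>, x))))"

(* Continuous functions vanishing at infinity; on the compact space config these are
   all continuous functions. *)
definition C0 :: "('a::topological_space \<Rightarrow> real) set" where
  "C0 = {f. continuous_on UNIV f \<and>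
            (\<forall>e>0. \<exists>K. compact K \<and> (\<forall>x. x \<notin> K \<longrightarrow> \<bar>f x\<bar> < e))}"

(* Only the values S t f with t \<ge> 0 and f in C0 are meaningful. *)
definition feller_semigroup ::
  "(real \<Rightarrow> ('a::topological_space \<Rightarrow> real) \<Rightarrow> 'a \<Rightarrow> real) \<Rightarrow> bool" where
  "feller_semigroup S \<longleftrightarrow>
     (\<forall>t\<ge>0. \<forall>f\<in>C0. S t f \<in> C0) \<and>
     (\<forall>t\<ge>0. \<forall>f\<in>C0. \<forall>g\<in>C0. \<forall>a b.
        S t (\<lambda>x. a * f x + b * g x) = (\<lambda>x. a * S t f x + b * S t g x)) \<and>
     (\<forall>t\<ge>0. \<forall>f\<in>C0. (\<forall>x. 0 \<le> f x \<and> f x \<le> 1) \<longrightarrow> (\<forall>x. 0 \<le> S t f x \<and> S t f x \<le> 1)) \<and>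
     (\<forall>f\<in>C0. S 0 f = f) \<and>
     (\<forall>s\<ge>0. \<forall>t\<ge>0. \<forall>f\<in>C0. S (s + t) f = S s (S t f)) \<and>
     (\<forall>f\<in>C0. uniform_limit UNIV (\<lambda>t. S t f) f (at_right 0))"

definition generator_graph ::
  "(real \<Rightarrow> ('a::topological_space \<Rightarrow> real) \<Rightarrow> 'a \<Rightarrow> real) \<Rightarrow>
     (('a \<Rightarrow> real) \<times> ('a \<Rightarrow> real)) set" where
  "generator_graph S =
     {(f, g). f \<in> C0 \<and> g \<in> C0 \<and> uniform_limit UNIV (\<lambda>t x. (S t f x - f x) / t) g (at_right 0)}"

definition graph_closure ::
  "('a \<Rightarrow> real) set \<Rightarrow> (('a \<Rightarrow> real) \<Rightarrow> 'a \<Rightarrow> real) \<Rightarrow>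
     (('a \<Rightarrow> real) \<times> ('a \<Rightarrow> real)) set" where
  "graph_closure D A =
     {(f, g). \<exists>u :: nat \<Rightarrow> 'a \<Rightarrow> real. (\<forall>k. u k \<in> D) \<and>
        uniform_limit UNIV u f sequentially \<and>
        uniform_limit UNIV (\<lambda>k. A (u k)) g sequentially}"

definition past :: "'w measure \<Rightarrow> (real \<Rightarrow> 'w \<Rightarrow> 'a::topological_space) \<Rightarrow> real \<Rightarrow> 'w measure" where
  "past M X s = sigma (space M) {X u -` B \<inter> space M | u B. 0 \<le> u \<and> u \<le> s \<and> B \<in> sets borel}"

(* X is a Markov process on the probability space M whose transition semigroup is the Feller
   semigroup generated by the closure of A, given on the core D. *)
definition markov_process_generated_by ::
  "'w measure \<Rightarrow> (real \<Rightarrow> 'w \<Rightarrow> 'a::topological_space) \<Rightarrow>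
     ('a \<Rightarrow> real) set \<Rightarrow> (('a \<Rightarrow> real) \<Rightarrow> 'a \<Rightarrow> real) \<Rightarrow> bool" where
  "markov_process_generated_by M X D A \<longleftrightarrow>
     prob_space M \<and>
     (\<forall>t\<ge>0. X t \<in> borel_measurable M) \<and>
     (\<exists>S. feller_semigroup S \<and> generator_graph S = graph_closure D A \<and>
        (\<forall>s\<ge>0. \<forall>t\<ge>0. \<forall>f\<in>C0. AE \<omega> in M.
           real_cond_exp M (past M X s) (\<lambda>\<omega>. f (X (s + t) \<omega>)) \<omega> = S t f (X s \<omega>)))"

definition lattice_gas ::
  "real \<Rightarrow> (config \<Rightarrow> real) \<Rightarrow> 'w measure \<Rightarrow> (real \<Rightarrow> 'w \<Rightarrow> config) \<Rightarrow> bool" where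
  "lattice_gas \<rho> c M \<eta> \<longleftrightarrow>
     markov_process_generated_by M \<eta> local_functions (gas_generator c) \<and>
     distr M borel (\<eta> 0) = bernoulli_product \<rho>"

definition accelerated :: "nat \<Rightarrow> (real \<Rightarrow> 'w \<Rightarrow> config) \<Rightarrow> real \<Rightarrow> 'w \<Rightarrow> config" where
  "accelerated n \<eta> t = \<eta> (t * (real n)\<^sup>2)"

(* The jump rates of the walk given the gas are expressed by the generator of the pair. *)
definition walk_on_gas ::
  "(config \<Rightarrow> real) \<Rightarrow> int set \<Rightarrow> (int \<Rightarrow> config \<Rightarrow> real) \<Rightarrow> nat \<Rightarrow>
     'w measure \<Rightarrow> (real \<Rightarrow> 'w \<Rightarrow> config) \<Rightarrow> (real \<Rightarrow> 'w \<Rightarrow> int) \<Rightarrow> bool" where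
  "walk_on_gas c R r n M \<eta> x \<longleftrightarrow>
     (AE \<omega> in M. x 0 \<omega> = 0) \<and>
     markov_process_generated_by M (\<lambda>t \<omega>. (accelerated n \<eta> t \<omega>, x t \<omega>))
       joint_local_functions (joint_generator c R r n)"

definition environment ::
  "nat \<Rightarrow> (real \<Rightarrow> 'w \<Rightarrow> config) \<Rightarrow> (real \<Rightarrow> 'w \<Rightarrow> int) \<Rightarrow> real \<Rightarrow> 'w \<Rightarrow> config" where
  "environment n \<eta> x t \<omega> = shift (x t \<omega>) (accelerated n \<eta> t \<omega>)"

(* H(\<mu> | \<nu>) is finite: the density f = d\<mu>/d\<nu> exists and f log f is \<nu>-integrable,
   i.e. log f is \<mu>-integrable.  Without this, the integral below has no meaning. *)
definition finite_relative_entropy :: "'a measure \<Rightarrow> 'a measure \<Rightarrow> bool" where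
  "finite_relative_entropy \<mu> \<nu> \<longleftrightarrow>
     sets \<mu> = sets \<nu> \<and> absolutely_continuous \<nu> \<mu> \<and>
     integrable \<mu> (entropy_density (exp 1) \<nu> \<mu>)"

(* KL_divergence takes the reference measure first and integrates log f against \<mu> = f \<nu>,
   which is the integral of f log f against \<nu>. *)
definition relative_entropy :: "'a measure \<Rightarrow> 'a measure \<Rightarrow> real" where
  "relative_entropy \<mu> \<nu> = KL_divergence (exp 1) \<nu> \<mu>"

lemma relative_entropy_eq:
  assumes "prob_space \<mu>" "prob_space \<nu>" "sets \<mu> = sets \<nu>" "absolutely_continuous \<nu> \<mu>"
  defines "f \<equiv> (\<lambda>x. enn2real (RN_deriv \<nu> \<mu> x))"
  shows "relative_entropy \<mu> \<nu> = (LINT x|\<nu>. f x * ln (f x))"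
proof -
  interpret \<mu>: prob_space \<mu> by fact
  interpret \<nu>: prob_space \<nu> by fact
  have [measurable]: "f \<in> borel_measurable \<nu>" unfolding f_def by measurable
  have dens: "density \<nu> (RN_deriv \<nu> \<mu>) = \<mu>"
    using assms(3,4) by (intro \<nu>.density_RN_deriv) auto
  have "sigma_finite_measure \<mu>" by unfold_locales
  then have "AE x in \<nu>. RN_deriv \<nu> \<mu> x \<noteq> \<infinity>"
    using assms(3,4) by (intro \<nu>.RN_deriv_finite) auto
  then have "AE x in \<nu>. RN_deriv \<nu> \<mu> x = ennreal (f x)"
    by eventually_elim (simp add: f_def less_top)
  then have "\<mu> = density \<nu> (\<lambda>x. ennreal (f x))"
    by (subst dens[symmetric], intro density_cong) auto
  moreover have "KL_divergence (exp 1) \<nu> (density \<nu> (\<lambda>x. ennreal (f x))) =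
      (LINT x|\<nu>. f x * log (exp 1) (f x))"
    by (rule \<nu>.KL_density) (auto simp: f_def)
  ultimately show ?thesis
    unfolding relative_entropy_def by (simp add: log_def)
qed

instance bool :: second_countable_topology
proof
  have "open = generate_topology (UNIV :: bool set set)"
    by (auto simp: fun_eq_iff discrete_topology_class.open_discrete intro: generate_topology.Basis)
  then show "\<exists>B :: bool set set. countable B \<and> open = generate_topology B"
    by (intro exI[of _ UNIV]) auto
qed

instance int :: second_countable_topology
proof
  have "generate_topology (range (\<lambda>i::int. {i})) A" for A
  proof -
    have "A = \<Union>((\<lambda>i. {i}) ` A)" by auto
    also have "generate_topology (range (\<lambda>i::int. {i})) \<dots>"
      by (rule generate_topology.UN) (auto intro: generate_topology.Basis)
    finally show ?thesis .
  qed
  then have "open = generate_topology (range (\<lambda>i::int. {i}))"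
    by (auto simp: fun_eq_iff discrete_topology_class.open_discrete)
  then show "\<exists>B :: int set set. countable B \<and> open = generate_topology B"
    by (intro exI[of _ "range (\<lambda>i. {i})"]) auto
qed

lemma sets_bernoulli_product: "sets (bernoulli_product \<rho>) = sets borel"
proof -
  have "sets (borel :: bool measure) = UNIV"
    by (auto intro!: borel_open discrete_topology_class.open_discrete)
  then have "sets (bernoulli_product \<rho>) = sets (\<Pi>\<^sub>M x\<in>(UNIV::int set). (borel :: bool measure))"
    unfolding bernoulli_product_def by (intro sets_PiM_cong) auto
  then show ?thesis by (simp add: sets_PiM_equal_borel)
qed

end

theory Submission imports Defs begin

text \<open>The generator of the environment process is \<open>n\<^sup>2 L\<^sub>b + n L\<^sup>r\<^sup>w\<close>, where \<open>L\<^sub>b\<close> is reversible for the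
  product measure and the walk part is a bounded operator. Its adjoint \<open>n\<^sup>2 L\<^sub>b + n (L\<^sup>r\<^sup>w)\<^sup>*\<close> has the same
  form, hence is a bounded perturbation of a Feller generator on the continuous functions, and
  the law at time \<open>t\<close> has a density \<open>f t\<close> which is continuous, bounded away from 0, and continuously
  differentiable in \<open>t\<close> for the supremum norm. So the entropy can be differentiated directly:
  \<open>H' = \<integral> (n\<^sup>2 L\<^sub>b f + n (L\<^sup>r\<^sup>w)\<^sup>* f) ln f\<close>. By \<open>a (ln b - ln a) \<le> b - a\<close> the walk part is at most
  \<open>n \<integral> h f\<close> with \<open>h = (L\<^sup>r\<^sup>w)\<^sup>* 1\<close>, and \<open>h\<close> is a sum of differences of local functions and their
  translates, each of which telescopes into finitely many exchanges of neighbours. Cauchy-Schwarz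
  bounds this by a Dirichlet form of \<open>sqrt f\<close>, which the gas part absorbs since \<open>c \<ge> \<epsilon>0\<close>, plus a
  constant. In the proofs time is rescaled by \<open>n\<^sup>2\<close>, so that the generator becomes
  \<open>L\<^sub>b + \<beta> L\<^sup>r\<^sup>w\<close> with \<open>\<beta> = 1 / n\<close>; for \<open>n = 0\<close> the convention \<open>1 / 0 = 0\<close> is the right one.\<close>

text \<open>The hypotheses speak of the pair of gas and walk, not of the environment alone, so its
  law is identified by duality. For local \<open>u\<close> the backward solution started from
  \<open>u\<close> gives the expectation of \<open>u\<close> at time t as an integral against the
  initial product measure; pairing it with the forward solution started from 1 turns this into the
  integral of \<open>u\<close> against the forward density. Both solutions have to be differentiable
  curves inside the domain of the closed generator, which is why each is built through its
  derivative. The gas generator is known only as a closure from local functions, and the density is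
  not local. The entropy inequality is therefore proved for positive local functions and carried to
  the closure; the lower bound on the density makes the logarithms of the approximants converge
  uniformly. The constant is uniform by a balance of orders: the walk enters with \<beta> = 1 / n,
  Young's inequality against the gas leaves \<beta> squared, and undoing the time change multiplies
  by n squared.\<close>

instance bcontfun :: (topological_space, complete_space) complete_space
proof
  fix f :: "nat \<Rightarrow> ('a, 'b) bcontfun"
  assume "Cauchy f"
  then have "\<forall>e>0. \<exists>N. \<forall>m n x. N \<le> m \<and> N \<le> n \<and> True \<longrightarrow> dist (f m x) (f n x) < e"
    unfolding Cauchy_def by (metis dist_fun_lt_imp_dist_val_lt)
  then have "\<exists>g. \<forall>e>0. \<exists>N. \<forall>n x. N \<le> n \<and> True \<longrightarrow> dist (f n x) (g x) < e"
    by (subst uniformly_convergent_eq_cauchy)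
  then obtain g where "uniform_limit UNIV f g sequentially"
    unfolding uniform_limit_sequentially_iff by auto
  then show "convergent f"
    by (metis uniform_limit_bcontfunE[OF _ sequentially_bot] convergentI)
qed

text \<open>Configurations are used with their product topology only, and the semigroup method needs
  \<open>config \<Rightarrow>\<^sub>C real\<close> to be a Banach space; hence completeness over an
  arbitrary topological domain.\<close>

instance bcontfun :: (topological_space, banach) banach ..

section \<open>Contraction semigroups and bounded perturbations\<close>

text \<open>Moves a variable upper limit into the integrand, so that the dependence on
  \<open>h\<close> becomes that of a parameter integral over a fixed interval, with no exception at
  \<open>h = 0\<close>.\<close>

lemma integral_affine_unit:
  fixes F :: "real \<Rightarrow> 'b::banach"
  assumes "0 \<le> h" "continuous_on {a..a + h} F"
  shows "integral {a..a + h} F = h *\<^sub>R integral {0..1} (\<lambda>\<sigma>. F (a + h * \<sigma>))"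
proof (cases "h = 0")
  case False
  then have h: "h > 0" using assms by simp
  have 1: "((\<lambda>\<sigma>. integral {a..a + h * \<sigma>} F) has_vector_derivative h *\<^sub>R F (a + h * \<sigma>))
      (at \<sigma> within {0..1})" if "\<sigma> \<in> {0..1}" for \<sigma>
  proof -
    have img: "(\<lambda>\<sigma>. a + h * \<sigma>) ` {0..1} \<subseteq> {a..a + h}"
      using h by (auto simp: mult_left_le)
    have "((\<lambda>y. integral {a..y} F) has_vector_derivative F (a + h * \<sigma>))
        (at (a + h * \<sigma>) within (\<lambda>\<sigma>. a + h * \<sigma>) ` {0..1})"
      using img that h
      by (intro has_vector_derivative_within_subset[OF integral_has_vector_derivative[OF assms(2)]]) auto
    moreover have "((\<lambda>\<sigma>. a + h * \<sigma>) has_vector_derivative h) (at \<sigma> within {0..1})"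
      by (auto intro!: derivative_eq_intros simp: has_real_derivative_iff_has_vector_derivative[symmetric])
    ultimately show ?thesis
      by (auto dest: vector_diff_chain_within simp: o_def)
  qed
  have "((\<lambda>\<sigma>. h *\<^sub>R F (a + h * \<sigma>)) has_integral
      integral {a..a + h * 1} F - integral {a..a + h * 0} F) {0..1}"
    by (rule fundamental_theorem_of_calculus) (use 1 in auto)
  from integral_unique[OF this] show ?thesis by simp
qed simp

text \<open>The subspace \<open>V\<close> is there for functions vanishing at infinity, which on
  pairs of configuration and position form a proper subspace of the bounded continuous functions. On
  configurations alone, by compactness, \<open>V\<close> is everything.\<close>

locale contraction_semigroup =
  fixes V :: "'b::real_normed_vector set" and T :: "real \<Rightarrow> 'b \<Rightarrow> 'b"
  assumes sub: "subspace V"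
    and maps: "0 \<le> t \<Longrightarrow> v \<in> V \<Longrightarrow> T t v \<in> V"
    and add: "0 \<le> t \<Longrightarrow> u \<in> V \<Longrightarrow> v \<in> V \<Longrightarrow> T t (u + v) = T t u + T t v"
    and scale: "0 \<le> t \<Longrightarrow> v \<in> V \<Longrightarrow> T t (a *\<^sub>R v) = a *\<^sub>R T t v"
    and contr: "0 \<le> t \<Longrightarrow> v \<in> V \<Longrightarrow> norm (T t v) \<le> norm v"
    and T_0: "v \<in> V \<Longrightarrow> T 0 v = v"
    and semi: "0 \<le> s \<Longrightarrow> 0 \<le> t \<Longrightarrow> v \<in> V \<Longrightarrow> T (s + t) v = T s (T t v)"
    and strong: "v \<in> V \<Longrightarrow> ((\<lambda>t. T t v) \<longlongrightarrow> v) (at_right 0)"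
begin

definition generator :: "('b \<times> 'b) set" where
  "generator = {(u, v). u \<in> V \<and> v \<in> V \<and> ((\<lambda>t. (T t u - u) /\<^sub>R t) \<longlongrightarrow> v) (at_right 0)}"

lemma diff: "0 \<le> t \<Longrightarrow> u \<in> V \<Longrightarrow> v \<in> V \<Longrightarrow> T t (u - v) = T t u - T t v"
  using add[of t u "- 1 *\<^sub>R v"] scale[of t v "- 1"] subspace_scale[OF sub, of v "-1"] by simp

lemma diff_V: "u \<in> V \<Longrightarrow> v \<in> V \<Longrightarrow> u - v \<in> V"
  using sub by (rule subspace_diff)

text \<open>Pull out the evolution up to the earlier time, which contracts: continuity at any time
  reduces to continuity at time 0.\<close>

lemma norm_T_diff:
  assumes "0 \<le> s" "0 \<le> t" "v \<in> V"
  shows "norm (T s v - T t v) \<le> norm (T \<bar>s - t\<bar> v - v)"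
proof -
  have *: "norm (T s v - T t v) \<le> norm (T (s - t) v - v)" if "0 \<le> t" "t \<le> s" for s t
  proof -
    have "T s v - T t v = T t (T (s - t) v - v)"
      using semi[of t "s - t" v] that assms maps by (simp add: diff)
    then show ?thesis using contr[of t "T (s - t) v - v"] that assms maps diff_V by simp
  qed
  show ?thesis using *[of t s] *[of s t] assms
    by (cases "t \<le> s") (auto simp: norm_minus_commute abs_if)
qed

text \<open>Reflecting time turns the one-sided limit at 0 into a two-sided one, which can be
  composed with a signed time difference.\<close>

lemma strong_0: "v \<in> V \<Longrightarrow> ((\<lambda>t. T \<bar>t\<bar> v) \<longlongrightarrow> v) (at 0)"
proof -
  assume v: "v \<in> V"
  have "((\<lambda>t. T \<bar>t\<bar> v) \<longlongrightarrow> v) (at_right 0)"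
    by (rule Lim_transform_eventually[OF strong[OF v]]) (auto simp: eventually_at_filter)
  moreover have "((\<lambda>t. T \<bar>t\<bar> v) \<longlongrightarrow> v) (at_left 0)"
    unfolding filterlim_at_left_to_right minus_zero abs_minus_cancel
    by (rule Lim_transform_eventually[OF strong[OF v]]) (auto simp: eventually_at_filter)
  ultimately show ?thesis by (rule filterlim_split_at[rotated])
qed

text \<open>The change of the vector is controlled by contraction, the change of time by the orbit
  of the fixed vector \<open>k x0\<close>.\<close>

lemma continuous_on_T:
  assumes a: "continuous_on A a" "\<And>x. x \<in> A \<Longrightarrow> 0 \<le> a x"
    and k: "continuous_on A k" "\<And>x. x \<in> A \<Longrightarrow> k x \<in> V"
  shows "continuous_on A (\<lambda>x. T (a x) (k x))"
  unfolding continuous_on_def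
proof
  fix x0 assume x0: "x0 \<in> A"
  have lim_a: "((\<lambda>x. a x - a x0) \<longlongrightarrow> 0) (at x0 within A)"
    using a x0 by (metis continuous_on_def LIM_zero)
  have lim_k: "((\<lambda>x. norm (k x - k x0)) \<longlongrightarrow> 0) (at x0 within A)"
    using k x0 by (metis continuous_on_def LIM_zero tendsto_norm_zero)
  have "isCont (\<lambda>t. T \<bar>t\<bar> (k x0)) 0"
    using strong_0[OF k(2)[OF x0]] T_0[OF k(2)[OF x0]] by (simp add: isCont_def)
  from isCont_tendsto_compose[OF this lim_a]
  have "((\<lambda>x. T \<bar>a x - a x0\<bar> (k x0)) \<longlongrightarrow> k x0) (at x0 within A)"
    using T_0[OF k(2)[OF x0]] by simp
  then have "((\<lambda>x. norm (T \<bar>a x - a x0\<bar> (k x0) - k x0)) \<longlongrightarrow> 0) (at x0 within A)"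
    by (metis LIM_zero tendsto_norm_zero)
  from tendsto_add[OF lim_k this]
  have lim: "((\<lambda>x. norm (k x - k x0) + norm (T \<bar>a x - a x0\<bar> (k x0) - k x0)) \<longlongrightarrow> 0) (at x0 within A)"
    by simp
  have "norm (T (a x) (k x) - T (a x0) (k x0)) \<le>
      norm (k x - k x0) + norm (T \<bar>a x - a x0\<bar> (k x0) - k x0)" if "x \<in> A" for x
  proof -
    have "T (a x) (k x) - T (a x0) (k x0) = T (a x) (k x - k x0) + (T (a x) (k x0) - T (a x0) (k x0))"
      using that x0 a k by (simp add: diff)
    also have "norm \<dots> \<le> norm (T (a x) (k x - k x0)) + norm (T (a x) (k x0) - T (a x0) (k x0))"
      by (rule norm_triangle_ineq)
    also have "\<dots> \<le> norm (k x - k x0) + norm (T \<bar>a x - a x0\<bar> (k x0) - k x0)"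
      using that x0 a k by (intro add_mono contr norm_T_diff diff_V) auto
    finally show ?thesis .
  qed
  then have "eventually (\<lambda>x. norm (T (a x) (k x) - T (a x0) (k x0)) \<le>
      norm (k x - k x0) + norm (T \<bar>a x - a x0\<bar> (k x0) - k x0)) (at x0 within A)"
    by (auto simp: eventually_at_topological)
  from Lim_null_comparison[OF this lim]
  show "((\<lambda>x. T (a x) (k x)) \<longlongrightarrow> T (a x0) (k x0)) (at x0 within A)"
    by (rule LIM_zero_cancel)
qed

text \<open>Forward difference quotients at \<open>t\<close> are images under \<open>T t\<close> of
  the quotient at 0. Backward ones are images under \<open>T y\<close> with \<open>y < t\<close> and
  produce \<open>T y v\<close> in place of \<open>T t v\<close>; strong continuity pays for the
  replacement.\<close>

lemma generator_has_vector_derivative: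
  assumes g: "(u, v) \<in> generator" and t: "0 \<le> t"
  shows "((\<lambda>t. T t u) has_vector_derivative T t v) (at t within {0..})"
proof -
  have V: "u \<in> V" "v \<in> V" and lim: "((\<lambda>t. (T t u - u) /\<^sub>R t) \<longlongrightarrow> v) (at_right 0)"
    using g by (auto simp: generator_def)
  \<comment> \<open>The first summand is the error of the difference quotient at 0, the second the
    cost of replacing \<open>T y v\<close> by \<open>T t v\<close> to the left of
    \<open>t\<close>.\<close>
  define q where "q h = norm ((T h u - u) /\<^sub>R h - v) + norm (T h v - v)" for h
  have "(q \<longlongrightarrow> 0 + 0) (at_right 0)"
    unfolding q_def by (intro tendsto_add tendsto_norm_zero LIM_zero lim strong V)
  then have q: "(q \<longlongrightarrow> 0) (at_right 0)" by simp
  have "filterlim (\<lambda>y. \<bar>y - t\<bar>) (at_right 0) (at t within {0..})"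
    unfolding filterlim_at
    by (auto simp: eventually_at_filter intro!: tendsto_rabs_zero LIM_zero tendsto_ident_at)
  from filterlim_compose[OF q this]
  have lim2: "((\<lambda>y. q \<bar>y - t\<bar>) \<longlongrightarrow> 0) (at t within {0..})" .
  have est: "norm (T (t + h) u - T t u - h *\<^sub>R T t w) \<le> h * norm ((T h u - u) /\<^sub>R h - w)"
    if "0 \<le> t" "0 < h" "w \<in> V" for t h w
  proof -
    have "T (t + h) u - T t u - h *\<^sub>R T t w = h *\<^sub>R T t ((T h u - u) /\<^sub>R h - w)"
    proof -
      have "T t ((T h u - u) /\<^sub>R h - w) = (T t (T h u) - T t u) /\<^sub>R h - T t w"
        using that V by (simp add: diff scale maps diff_V subspace_scale[OF sub])
      moreover have "T (t + h) u = T t (T h u)"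
        using that V by (simp add: semi)
      ultimately show ?thesis
        using that by (simp add: scaleR_right_diff_distrib)
    qed
    also have "norm \<dots> \<le> h * norm ((T h u - u) /\<^sub>R h - w)"
      using that V by (auto intro!: contr diff_V maps subspace_scale[OF sub])
    finally show ?thesis .
  qed
  have "norm (T y u - T t u - (y - t) *\<^sub>R T t v) / norm (y - t) \<le> q \<bar>y - t\<bar>"
    if y: "y \<ge> 0" "y \<noteq> t" for y
  proof (cases "y > t")
    case True
    define h where "h = y - t"
    have h: "h > 0" "y = t + h" using True by (auto simp: h_def)
    have "norm (T y u - T t u - (y - t) *\<^sub>R T t v) \<le> h * norm ((T h u - u) /\<^sub>R h - v)"
      using est[of t h v] V t h by simp
    also have "\<dots> \<le> h * q h"
      using h by (simp add: q_def)
    finally show ?thesis using h by (simp add: field_simps)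
  next
    case False
    define h where "h = t - y"
    have h: "h > 0" "t = y + h" using False y by (auto simp: h_def)
    have "T y u - T t u - (y - t) *\<^sub>R T t v =
        - (T (y + h) u - T y u - h *\<^sub>R T y v) + h *\<^sub>R (T t v - T y v)"
      using h by (simp add: algebra_simps)
    also have "norm \<dots> \<le> norm (T (y + h) u - T y u - h *\<^sub>R T y v) + norm (h *\<^sub>R (T t v - T y v))"
      using norm_triangle_ineq norm_minus_cancel by metis
    also have "norm (h *\<^sub>R (T t v - T y v)) \<le> h * norm (T h v - v)"
      using norm_T_diff[of t y v] h y V by simp
    also have "norm (T (y + h) u - T y u - h *\<^sub>R T y v) \<le> h * norm ((T h u - u) /\<^sub>R h - v)"
      using h y V by (intro est) auto
    finally have "norm (T y u - T t u - (y - t) *\<^sub>R T t v) \<le> h * q h"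
      by (simp add: q_def algebra_simps)
    moreover have "\<bar>y - t\<bar> = h" using h by simp
    ultimately show ?thesis using h by (simp add: field_simps)
  qed
  then have "eventually (\<lambda>y. norm (norm (T y u - T t u - (y - t) *\<^sub>R T t v) / norm (y - t)) \<le> q \<bar>y - t\<bar>)
     (at t within {0..})"
    by (auto simp: eventually_at_filter)
  from Lim_null_comparison[OF this lim2]
  show ?thesis
    unfolding has_vector_derivative_def has_derivative_iff_norm
    by (auto intro: bounded_linear_scaleR_left)
qed

end

section \<open>Bounded perturbations of a generator: positive, differentiable solutions\<close>

locale banach_contraction_semigroup = contraction_semigroup UNIV T
  for T :: "real \<Rightarrow> 'b::banach \<Rightarrow> 'b"
begin

lemma bounded_linear_T: "0 \<le> t \<Longrightarrow> bounded_linear (T t)"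
  by (rule bounded_linear_intro[where K=1]) (auto simp: add scale contr)

text \<open>The solution of \<open>f' = G f + B f\<close>, \<open>f 0 = u0\<close> is obtained through its derivative \<open>g\<close>, which is the
  mild solution started from \<open>G u0 + B u0\<close>: it is the fixed point of a map that is contracting for
  the norm \<open>sup \<bar>exp (- L t) g t\<bar>\<close>.\<close>

lemma mild_solution:
  assumes B: "bounded_linear B"
    and \<Lambda>: "\<And>l. l \<in> \<Lambda> \<Longrightarrow> bounded_linear l"
    and T_pos: "\<And>t x. 0 \<le> t \<Longrightarrow> \<forall>l\<in>\<Lambda>. (0::real) \<le> l x \<Longrightarrow> \<forall>l\<in>\<Lambda>. 0 \<le> l (T t x)"
    and B_pos: "\<And>x. \<forall>l\<in>\<Lambda>. 0 \<le> l x \<Longrightarrow> \<forall>l\<in>\<Lambda>. 0 \<le> l (B x)"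
    and w_pos: "\<forall>l\<in>\<Lambda>. 0 \<le> l w"
  obtains g where "continuous_on {0..} g" "\<And>t l. 0 \<le> t \<Longrightarrow> l \<in> \<Lambda> \<Longrightarrow> 0 \<le> l (g t)"
    "\<And>t. 0 \<le> t \<Longrightarrow> g t = T t w + integral {0..t} (\<lambda>s. T (t - s) (B (g s)))"
proof -
  obtain b where b: "0 \<le> b" "\<And>x. norm (B x) \<le> norm x * b"
    using bounded_linear.nonneg_bounded[OF B] by blast
  \<comment> \<open>Any \<open>L > b\<close> makes the factor \<open>b / L\<close> of the fixed
    point map less than 1; this choice is positive even for \<open>b = 0\<close>.\<close>
  define L where "L = 2 * b + 1"
  have L: "L > 0" using b by (simp add: L_def)
  \<comment> \<open>With \<open>y t = exp (- L t) g t\<close>, this is the integrand of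
    \<open>exp (- L t)\<close> times the Duhamel integral after the substitution
    \<open>s = t \<sigma>\<close>. Negative times are collapsed to 0, so that curves are bounded
    continuous functions on the whole real line.\<close>
  define k where "k y t \<sigma> = (max 0 t * exp (- (L * (max 0 t * (1 - \<sigma>))))) *\<^sub>R
      T (max 0 t * (1 - \<sigma>)) (B (apply_bcontfun y (max 0 t * \<sigma>)))"
    for y :: "real \<Rightarrow>\<^sub>C 'b" and t \<sigma> :: real
  define F where "F y t = exp (- (L * max 0 t)) *\<^sub>R T (max 0 t) w + integral {0..1} (k y t)"
    for y :: "real \<Rightarrow>\<^sub>C 'b" and t
  have cont_comp: "continuous_on S (\<lambda>x. apply_bcontfun y (a x))" if "continuous_on S a"
    for S :: "'z::topological_space set" and a and y :: "real \<Rightarrow>\<^sub>C 'b"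
    using continuous_on_compose2[OF continuous_on_apply_bcontfun[of UNIV y] that] by simp
  have cont_k2: "continuous_on (UNIV \<times> cbox 0 1) (\<lambda>(t, \<sigma>). k y t \<sigma>)" for y
    unfolding k_def case_prod_beta
    by (intro continuous_intros continuous_on_T bounded_linear.continuous_on[OF B] cont_comp) auto
  have cont_k: "continuous_on {0..1} (k y t)" for y t
    unfolding k_def
    by (intro continuous_intros continuous_on_T bounded_linear.continuous_on[OF B] cont_comp) auto
  have cont_F: "continuous_on UNIV (F y)" for y
    unfolding F_def
    using integral_continuous_on_param[OF cont_k2[of y]]
    by (intro continuous_intros continuous_on_T) auto
  \<comment> \<open>A weight of total mass at most \<open>1 / L\<close>; this is the origin of the
    contraction factor \<open>b / L\<close>.\<close>
  define e where "e t \<sigma> = max 0 t * exp (- (L * (max 0 t * (1 - \<sigma>))))" for t \<sigma> :: real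
  have e_nonneg: "0 \<le> e t \<sigma>" for t \<sigma> by (simp add: e_def)
  have e_int: "(e t has_integral ((1 - exp (- (L * max 0 t))) / L)) {0..1}" for t
  proof -
    have "((\<lambda>\<sigma>. exp (- (L * (max 0 t * (1 - \<sigma>)))) / L) has_vector_derivative e t \<sigma>) (at \<sigma> within {0..1})" for \<sigma>
      unfolding has_real_derivative_iff_has_vector_derivative[symmetric] e_def
      using L by (auto intro!: derivative_eq_intros)
    from fundamental_theorem_of_calculus[of 0 1, OF _ this]
    show ?thesis by (simp add: diff_divide_distrib)
  qed
  have int_bound: "norm (integral {0..1} h) \<le> C / L"
    if "continuous_on {0..1} h" "\<And>\<sigma>. \<sigma> \<in> {0..1} \<Longrightarrow> norm (h \<sigma>) \<le> e t \<sigma> * C" "0 \<le> C"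
    for h :: "real \<Rightarrow> 'b" and C t
  proof -
    have eC: "((\<lambda>\<sigma>. e t \<sigma> * C) has_integral ((1 - exp (- (L * max 0 t))) / L * C)) {0..1}"
      by (rule has_integral_mult_left[OF e_int])
    have "norm (integral {0..1} h) \<le> integral {0..1} (\<lambda>\<sigma>. e t \<sigma> * C)"
      using that has_integral_integrable[OF eC]
      by (intro integral_norm_bound_integral) (auto intro: integrable_continuous_real)
    also have "\<dots> = (1 - exp (- (L * max 0 t))) * C / L"
      using integral_unique[OF eC] by simp
    also have "\<dots> \<le> C / L"
      using L that by (intro divide_right_mono mult_left_le_one_le) auto
    finally show ?thesis .
  qed
  have norm_k: "norm (k y t \<sigma>) \<le> e t \<sigma> * (b * norm y)" if "\<sigma> \<in> {0..1}" for y t \<sigma>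
  proof -
    have "norm (k y t \<sigma>) \<le> e t \<sigma> * norm (B (apply_bcontfun y (max 0 t * \<sigma>)))"
      unfolding k_def e_def using that by (auto simp: abs_mult intro!: mult_left_mono contr)
    also have "\<dots> \<le> e t \<sigma> * (b * norm y)"
      using b(2)[of "apply_bcontfun y (max 0 t * \<sigma>)"] norm_bounded[of y "max 0 t * \<sigma>"] b(1)
      by (intro mult_left_mono e_nonneg) (metis mult.commute mult_left_mono order.trans)
    finally show ?thesis .
  qed
  have F_bcont: "F y \<in> bcontfun" for y
  proof (rule bcontfun_normI[OF cont_F])
    fix t
    have "norm (F y t) \<le> norm (exp (- (L * max 0 t)) *\<^sub>R T (max 0 t) w) + norm (integral {0..1} (k y t))"
      unfolding F_def by (rule norm_triangle_ineq)
    also have "norm (exp (- (L * max 0 t)) *\<^sub>R T (max 0 t) w) \<le> norm w"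
      using L contr[of "max 0 t" w] mult_mono[of "exp (- (L * max 0 t))" 1 "norm (T (max 0 t) w)" "norm w"]
      by simp
    also have "norm (integral {0..1} (k y t)) \<le> (b * norm y) / L"
      by (rule int_bound[OF cont_k norm_k]) (use b in auto)
    finally show "norm (F y t) \<le> norm w + b * norm y / L" by simp
  qed
  define \<Phi> where "\<Phi> y = Bcontfun (F y)" for y
  have \<Phi>: "apply_bcontfun (\<Phi> y) = F y" for y
    unfolding \<Phi>_def using F_bcont by (rule Bcontfun_inverse)
  \<comment> \<open>This set is closed, contains 0 and is mapped into itself, so the fixed point
    inherits the positivity constraints listed in \<open>\<Lambda>\<close>; an empty
    \<open>\<Lambda>\<close> imposes none.\<close>
  define S where "S = {y :: real \<Rightarrow>\<^sub>C 'b. \<forall>t. \<forall>l\<in>\<Lambda>. 0 \<le> l (apply_bcontfun y t)}"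
  have "closed S"
  proof -
    have "S = (\<Inter>t. \<Inter>l\<in>\<Lambda>. {y. 0 \<le> l (apply_bcontfun y t)})" by (auto simp: S_def)
    moreover have "continuous_on UNIV (\<lambda>y. l (apply_bcontfun y t))" if "l \<in> \<Lambda>" for l and t :: real
    proof -
      have "bounded_linear (\<lambda>y. apply_bcontfun y t :: 'b)"
        by (rule bounded_linear_intro[where K=1]) (auto intro: norm_bounded)
      from bounded_linear.continuous_on[OF \<Lambda>[OF that] bounded_linear.continuous_on[OF this continuous_on_id]]
      show ?thesis .
    qed
    ultimately show ?thesis
      by (auto intro!: closed_INT closed_Collect_le continuous_on_const)
  qed
  have "\<exists>!y\<in>S. \<Phi> y = y"
  proof (rule Banach_fix[OF iffD2[OF complete_eq_closed \<open>closed S\<close>], where c = "b / L"])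
    have "0 \<in> S" using \<Lambda> by (auto simp: S_def bounded_linear.linear linear_0)
    then show "S \<noteq> {}" by auto
    show "0 \<le> b / L" "b / L < 1" using b L by (auto simp: L_def)
    show "\<Phi> ` S \<subseteq> S"
    proof clarify
      fix y assume y: "y \<in> S"
      have "0 \<le> l (F y t)" if l: "l \<in> \<Lambda>" for l t
      proof -
        note bl = \<Lambda>[OF l]
        interpret l: bounded_linear l by fact
        have "0 \<le> l (k y t \<sigma>)" if "\<sigma> \<in> {0..1}" for \<sigma>
        proof -
          have "\<forall>l\<in>\<Lambda>. 0 \<le> l (T (max 0 t * (1 - \<sigma>)) (B (apply_bcontfun y (max 0 t * \<sigma>))))"
            by (rule T_pos[OF _ B_pos]) (use that y in \<open>auto simp: S_def\<close>)
          then show ?thesis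
            unfolding k_def l.scaleR real_scaleR_def using l by (intro mult_nonneg_nonneg) auto
        qed
        then have "0 \<le> integral {0..1} (\<lambda>\<sigma>. l (k y t \<sigma>))"
          by (intro integral_nonneg integrable_continuous_real l.continuous_on cont_k)
        also have "\<dots> = l (integral {0..1} (k y t))"
          using integral_linear[OF integrable_continuous_real[OF cont_k] bl] by (simp add: o_def)
        finally have "0 \<le> l (integral {0..1} (k y t))" .
        then show ?thesis
          unfolding F_def l.add l.scaleR using l w_pos T_pos[of "max 0 t" w] by auto
      qed
      then show "\<Phi> y \<in> S" by (simp add: S_def \<Phi>)
    qed
    fix y z assume "y \<in> S" "z \<in> S"
    show "dist (\<Phi> y) (\<Phi> z) \<le> b / L * dist y z"
    proof (rule dist_bound)
      fix t
      have *: "k y t \<sigma> - k z t \<sigma> = k (y - z) t \<sigma>" if "\<sigma> \<in> {0..1}" for \<sigma>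
        unfolding k_def minus_bcontfun.rep_eq linear_diff[OF bounded_linear.linear[OF B]] using that
        by (subst diff) (auto simp: scaleR_right_diff_distrib)
      have "F y t - F z t = integral {0..1} (\<lambda>\<sigma>. k y t \<sigma> - k z t \<sigma>)"
        unfolding F_def
        by (subst integral_diff) (auto intro!: integrable_continuous_real cont_k)
      also have "\<dots> = integral {0..1} (k (y - z) t)"
        using * by (intro integral_cong) auto
      also have "norm \<dots> \<le> (b * norm (y - z)) / L"
        by (rule int_bound[OF cont_k norm_k]) (use b in auto)
      finally show "dist (apply_bcontfun (\<Phi> y) t) (apply_bcontfun (\<Phi> z) t) \<le> b / L * dist y z"
        by (simp add: \<Phi> dist_norm)
    qed
  qed
  then obtain y where y: "y \<in> S" "\<Phi> y = y" by blast
  define g where "g t = exp (L * t) *\<^sub>R apply_bcontfun y t" for t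
  have cont_g: "continuous_on {0..} g"
    unfolding g_def by (intro continuous_intros cont_comp)
  have g_pos: "0 \<le> l (g t)" if "0 \<le> t" "l \<in> \<Lambda>" for t l
    using y that by (simp add: g_def S_def bounded_linear.linear[OF \<Lambda>] linear_scale)
  have "g t = T t w + integral {0..t} (\<lambda>s. T (t - s) (B (g s)))" if t: "0 \<le> t" for t
  proof -
    have ek: "exp (L * t) *\<^sub>R k y t \<sigma> = t *\<^sub>R T (t - t * \<sigma>) (B (g (t * \<sigma>)))" if "\<sigma> \<in> {0..1}" for \<sigma>
      using that t mult_left_le_one_le[of t \<sigma>]
      by (simp add: k_def g_def bounded_linear.linear[OF B] linear_scale scale mult_left_le
          exp_add[symmetric] algebra_simps)
    have "g t = exp (L * t) *\<^sub>R F y t"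
      using y \<Phi> by (metis g_def)
    also have "\<dots> = T t w + exp (L * t) *\<^sub>R integral {0..1} (k y t)"
      using t by (simp add: F_def scaleR_right_distrib exp_add[symmetric])
    also have "exp (L * t) *\<^sub>R integral {0..1} (k y t) = integral {0..1} (\<lambda>\<sigma>. exp (L * t) *\<^sub>R k y t \<sigma>)"
      by simp
    also have "\<dots> = integral {0..1} (\<lambda>\<sigma>. t *\<^sub>R T (t - t * \<sigma>) (B (g (t * \<sigma>))))"
      using ek by (intro integral_cong) auto
    also have "\<dots> = t *\<^sub>R integral {0..1} (\<lambda>\<sigma>. T (t - (0 + t * \<sigma>)) (B (g (0 + t * \<sigma>))))"
      by simp
    also have "\<dots> = integral {0..0 + t} (\<lambda>s. T (t - s) (B (g s)))"
      using t cont_g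
      by (intro integral_affine_unit[symmetric] continuous_on_T bounded_linear.continuous_on[OF B] continuous_intros)
         (auto intro: continuous_on_subset)
    finally show ?thesis by simp
  qed
  then show ?thesis using that cont_g g_pos by blast
qed

text \<open>The derivative of \<open>f\<close> is immediate; the content is that \<open>f t\<close>
  lies in the domain of the generator. Integrating the identity \<open>Tg\<close> over [0, t]
  expresses \<open>T h (f t) - f t\<close> through \<open>T h u0 - u0\<close>, increments of
  \<open>f\<close> and averages of the perturbation, and each of these converges after division by
  \<open>h\<close>.\<close>

lemma perturbed_curve:
  assumes B: "bounded_linear B" and u0: "(u0, v0) \<in> generator"
    and cont_g: "continuous_on {0..} g"
    and g: "\<And>t. 0 \<le> t \<Longrightarrow> g t = T t (v0 + B u0) + integral {0..t} (\<lambda>s. T (t - s) (B (g s)))"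
    and t: "0 \<le> t"
  defines "f \<equiv> (\<lambda>t. u0 + integral {0..t} g)"
  shows "(f has_vector_derivative g t) (at t within {0..})" "(f t, g t - B (f t)) \<in> generator"
proof -
  have df: "(f has_vector_derivative g t) (at t within {0..})" if "0 \<le> t" for t
  proof -
    have "continuous_on {0..t + 1} g" using cont_g by (rule continuous_on_subset) auto
    from integral_has_vector_derivative[OF this, of t] that
    have "((\<lambda>t. integral {0..t} g) has_vector_derivative g t) (at t within {0..t + 1})" by simp
    moreover have "at t within {0..} = at t within {0..t + 1}"
      by (rule at_within_nhd[of t "{..<t+1}"]) auto
    ultimately have "((\<lambda>t. integral {0..t} g) has_vector_derivative g t) (at t within {0..})"
      by simp
    then show ?thesis unfolding f_def by (auto intro!: derivative_eq_intros)
  qed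
  then show "(f has_vector_derivative g t) (at t within {0..})" using t .
  have sub_g: "continuous_on S g" if "S \<subseteq> {0..}" for S
    using cont_g that by (rule continuous_on_subset)
  have cont_gg: "continuous_on S (\<lambda>x. g (a x))" if "continuous_on S a" "\<And>x. x \<in> S \<Longrightarrow> 0 \<le> a x"
    for S :: "'z::topological_space set" and a
    using continuous_on_compose2[OF cont_g that(1)] that(2) by auto
  note BC = bounded_linear.continuous_on[OF B]
  \<comment> \<open>The average of \<open>T (s + h - r) (B (g r))\<close> over \<open>r\<close> in
    [s, s + h], written over the unit interval so that it extends continuously to
    \<open>h = 0\<close>, where it equals \<open>B (g s)\<close>.\<close>
  define e where "e h s = integral {0..1} (\<lambda>\<sigma>. T (h * (1 - \<sigma>)) (B (g (s + h * \<sigma>))))" for h s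
  have e2: "continuous_on ({0..} \<times> cbox 0 t) (\<lambda>(h, s). e h s)"
  proof -
    have "continuous_on (({0..} \<times> cbox 0 t) \<times> cbox 0 1)
        (\<lambda>((h, s), \<sigma>). T (h * (1 - \<sigma>)) (B (g (s + h * \<sigma>))))"
      unfolding case_prod_beta
      by (intro continuous_intros continuous_on_T BC cont_gg) auto
    from integral_continuous_on_param[of "{0..} \<times> cbox 0 t" 0 1
        "\<lambda>(h, s) \<sigma>. T (h * (1 - \<sigma>)) (B (g (s + h * \<sigma>)))"] this
    show ?thesis unfolding e_def by (simp add: case_prod_beta)
  qed
  from integral_continuous_on_param[OF e2]
  have "continuous_on {0..} (\<lambda>h. integral {0..t} (e h))" by simp
  then have "((\<lambda>h. integral {0..t} (e h)) \<longlongrightarrow> integral {0..t} (e 0)) (at 0 within {0..})"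
    by (simp add: continuous_on_def)
  then have "((\<lambda>h. integral {0..t} (e h)) \<longlongrightarrow> integral {0..t} (e 0)) (at_right 0)"
    by (rule tendsto_within_subset) auto
  moreover have "integral {0..t} (e 0) = B (f t - u0)"
  proof -
    have "e 0 = (\<lambda>s. B (g s))"
      by (simp add: e_def T_0 fun_eq_iff)
    then have "integral {0..t} (e 0) = integral {0..t} (\<lambda>s. B (g s))"
      by simp
    also have "\<dots> = B (f t - u0)"
      using integral_linear[OF integrable_continuous_real[OF sub_g] B, of 0 t] by (simp add: o_def f_def)
    finally show ?thesis .
  qed
  ultimately have lim_e: "((\<lambda>h. integral {0..t} (e h)) \<longlongrightarrow> B (f t - u0)) (at_right 0)" by simp

  \<comment> \<open>Duhamel's formula at time \<open>s + h\<close>, minus what has accumulated on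
    [s, s + h].\<close>
  have Tg: "T h (g s) = g (s + h) - h *\<^sub>R e h s" if "0 \<le> h" "0 \<le> s" for h s
  proof -
    note bT = bounded_linear_T[OF that(1)]
    have cont: "continuous_on S (\<lambda>r. T (a - r) (B (g r)))" if "S \<subseteq> {0..a}" for S a
      using that by (intro continuous_on_T BC sub_g continuous_intros) auto
    have "T h (g s) = T h (T s (v0 + B u0)) + T h (integral {0..s} (\<lambda>r. T (s - r) (B (g r))))"
      using that by (subst g) (auto simp: add)
    also have "T h (integral {0..s} (\<lambda>r. T (s - r) (B (g r)))) = integral {0..s} (\<lambda>r. T h (T (s - r) (B (g r))))"
      using integral_linear[OF integrable_continuous_real[OF cont] bT, of 0 s s] by (simp add: o_def)
    also have "\<dots> = integral {0..s} (\<lambda>r. T (s + h - r) (B (g r)))"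
      using that by (intro integral_cong) (simp add: semi[symmetric] algebra_simps)
    also have "T h (T s (v0 + B u0)) = T (s + h) (v0 + B u0)"
      using that by (simp add: semi[symmetric] add.commute)
    finally have 1: "T h (g s) = T (s + h) (v0 + B u0) + integral {0..s} (\<lambda>r. T (s + h - r) (B (g r)))" .
    have "integral {0..s} (\<lambda>r. T (s + h - r) (B (g r))) + integral {s..s + h} (\<lambda>r. T (s + h - r) (B (g r)))
        = integral {0..s + h} (\<lambda>r. T (s + h - r) (B (g r)))"
      using that by (intro Henstock_Kurzweil_Integration.integral_combine integrable_continuous_real cont) auto
    moreover have "integral {s..s + h} (\<lambda>r. T (s + h - r) (B (g r))) = h *\<^sub>R e h s"
      unfolding e_def using that
      by (subst integral_affine_unit) (auto intro!: cont simp: algebra_simps)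
    ultimately show ?thesis
      using 1 g[of "s + h"] that by (simp add: algebra_simps)
  qed
  have main: "(T h (f t) - f t) /\<^sub>R h =
      (T h u0 - u0) /\<^sub>R h + (f (t + h) - f t) /\<^sub>R h - (f h - f 0) /\<^sub>R h - integral {0..t} (e h)"
    if h: "0 < h" for h
  proof -
    have "T h (f t) = T h u0 + T h (integral {0..t} g)" using h by (simp add: f_def add)
    also have "T h (integral {0..t} g) = integral {0..t} (\<lambda>s. T h (g s))"
      using integral_linear[OF integrable_continuous_real[OF sub_g] bounded_linear_T, of 0 t h] h
      by (simp add: o_def)
    also have "\<dots> = integral {0..t} (\<lambda>s. g (s + h) - h *\<^sub>R e h s)"
      using h by (intro integral_cong) (simp add: Tg)
    also have "\<dots> = integral {0..t} (\<lambda>s. g (s + h)) - h *\<^sub>R integral {0..t} (e h)"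
    proof -
      have "Pair h ` {0..t} \<subseteq> {0..} \<times> {0..t}" using h by auto
      then have "continuous_on {0..t} (\<lambda>s. e h s)"
        using h continuous_on_compose2[OF e2 continuous_on_Pair[OF continuous_on_const[of "{0..t}" h]
              continuous_on_id]] by simp
      then show ?thesis
        using h by (subst integral_diff)
          (auto intro!: integrable_continuous_real continuous_intros cont_gg)
    qed
    also have "integral {0..t} (\<lambda>s. g (s + h)) = f (t + h) - f h"
    proof -
      have "((\<lambda>s. f (s + h)) has_vector_derivative g (s + h)) (at s within {0..t})" if "s \<in> {0..t}" for s
      proof -
        have "(f has_vector_derivative g (s + h)) (at (s + h) within (\<lambda>s. s + h) ` {0..t})"
          using df[of "s + h"] that h by (auto elim!: has_vector_derivative_within_subset)
        moreover have "((\<lambda>s. s + h) has_vector_derivative 1) (at s within {0..t})"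
          by (auto intro!: derivative_eq_intros)
        ultimately show ?thesis
          by (auto dest: vector_diff_chain_within simp: o_def)
      qed
      from fundamental_theorem_of_calculus[OF t this] show ?thesis by (auto dest: integral_unique)
    qed
    finally have "T h (f t) - f t = (T h u0 - u0) + (f (t + h) - f t) - (f h - f 0) - h *\<^sub>R integral {0..t} (e h)"
      by (simp add: f_def)
    then show ?thesis using h by (simp add: scaleR_right_diff_distrib scaleR_right_distrib)
  qed
  have lim_f: "((\<lambda>h. (f (s + h) - f s) /\<^sub>R h) \<longlongrightarrow> g s) (at_right 0)" if "0 \<le> s" for s
  proof -
    have "((\<lambda>h. f (s + h)) has_vector_derivative g s) (at 0 within {0..})"
    proof -
      have "(f has_vector_derivative g s) (at (s + 0) within (\<lambda>h. s + h) ` {0..})"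
        using df[OF that] that by (auto elim!: has_vector_derivative_within_subset)
      moreover have "((\<lambda>h. s + h) has_vector_derivative 1) (at 0 within {0..})"
        by (auto intro!: derivative_eq_intros)
      ultimately show ?thesis
        by (auto dest: vector_diff_chain_within simp: o_def)
    qed
    then have "((\<lambda>h. norm (f (s + h) - f s - h *\<^sub>R g s) / norm h) \<longlongrightarrow> 0) (at 0 within {0..})"
      by (simp add: has_vector_derivative_def has_derivative_iff_norm)
    then have "((\<lambda>h. norm (f (s + h) - f s - h *\<^sub>R g s) / norm h) \<longlongrightarrow> 0) (at_right 0)"
      by (rule tendsto_within_subset) auto
    then have "((\<lambda>h. norm ((f (s + h) - f s) /\<^sub>R h - g s)) \<longlongrightarrow> 0) (at_right 0)"
    proof (rule Lim_transform_eventually)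
      have "norm (f (s + h) - f s - h *\<^sub>R g s) / norm h = norm ((f (s + h) - f s) /\<^sub>R h - g s)" if "h > 0" for h
      proof -
        have "(f (s + h) - f s) /\<^sub>R h - g s = (f (s + h) - f s - h *\<^sub>R g s) /\<^sub>R h"
          using that by (simp add: scaleR_right_diff_distrib)
        then show ?thesis using that by (simp add: divide_inverse mult.commute)
      qed
      then show "\<forall>\<^sub>F h in at_right 0. norm (f (s + h) - f s - h *\<^sub>R g s) / norm h =
          norm ((f (s + h) - f s) /\<^sub>R h - g s)"
        by (auto simp: eventually_at_filter)
    qed
    then show ?thesis by (simp add: tendsto_norm_zero_iff LIM_zero_iff)
  qed
  have "((\<lambda>h. (T h u0 - u0) /\<^sub>R h + (f (t + h) - f t) /\<^sub>R h - (f (0 + h) - f 0) /\<^sub>R h - integral {0..t} (e h))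
      \<longlongrightarrow> v0 + g t - g 0 - B (f t - u0)) (at_right 0)"
    using u0 t by (intro tendsto_intros lim_f lim_e) (auto simp: generator_def)
  then have "((\<lambda>h. (T h (f t) - f t) /\<^sub>R h) \<longlongrightarrow> v0 + g t - g 0 - B (f t - u0)) (at_right 0)"
    by (rule Lim_transform_eventually) (auto simp: eventually_at_filter main)
  \<comment> \<open>The value \<open>g 0 = v0 + B u0\<close> cancels the contributions of the
    initial point.\<close>
  moreover have "v0 + g t - g 0 - B (f t - u0) = g t - B (f t)"
    using g[of 0] by (simp add: T_0 bounded_linear.linear[OF B] linear_diff)
  ultimately show "(f t, g t - B (f t)) \<in> generator"
    by (simp add: generator_def)
qed

end

section \<open>Continuous functions of configurations\<close>

lemma compact_UNIV_config: "compact (UNIV :: config set)"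
proof -
  have "compact_space (euclidean :: bool topology)"
    by (simp add: compact_space_def finite_imp_compact)
  then have "compact_space (product_topology (\<lambda>_::int. euclidean :: bool topology) UNIV)"
    unfolding compact_space_product_topology by simp
  then show ?thesis
    by (simp add: euclidean_product_topology compact_space_def)
qed

lemma continuous_config_bcontfun:
  fixes f :: "config \<Rightarrow> real"
  assumes "continuous_on UNIV f"
  shows "f \<in> bcontfun"
  unfolding bcontfun_def
  using assms compact_continuous_image[OF assms compact_UNIV_config] by (auto intro: compact_imp_bounded)

lemma apply_Bcontfun_config [simp]:
  fixes f :: "config \<Rightarrow> real"
  shows "continuous_on UNIV f \<Longrightarrow> apply_bcontfun (Bcontfun f) = f"
  by (rule Bcontfun_inverse[OF continuous_config_bcontfun])

lemma C0_config: "C0 = {f :: config \<Rightarrow> real. continuous_on UNIV f}"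
  using compact_UNIV_config by (auto simp: C0_def)

lemma continuous_on_reindex:
  fixes u :: "config \<Rightarrow> real"
  assumes "continuous_on UNIV u"
  shows "continuous_on UNIV (\<lambda>\<eta>. u (\<lambda>y. \<eta> (p y)))"
  by (rule continuous_on_compose2[OF assms])
     (auto intro!: continuous_on_coordinatewise_then_product)

text \<open>Like a shift, an exchange only reindexes coordinates by an injective map; continuity,
  locality and invariance of the product measure are proved once for such maps.\<close>

lemma exchange_eq: "exchange x \<eta> = (\<lambda>y. \<eta> (Transposition.transpose x (x + 1) y))"
  by (auto simp: exchange_def Transposition.transpose_def)

lemma continuous_on_shift:
  fixes u :: "config \<Rightarrow> real"
  assumes "continuous_on UNIV u"
  shows "continuous_on UNIV (\<lambda>\<eta>. u (shift x \<eta>))"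
  unfolding shift_def by (rule continuous_on_reindex[OF assms])

lemma shift_0 [simp]: "shift 0 \<eta> = \<eta>"
  by (simp add: shift_def)

lemma shift_shift [simp]: "shift x (shift y \<eta>) = shift (x + y) \<eta>"
  by (simp add: shift_def algebra_simps)

lemma exchange_exchange [simp]: "exchange x (exchange x \<eta>) = \<eta>"
  by (auto simp: exchange_def)

lemma exchange_shift: "exchange x (shift y \<eta>) = shift y (exchange (x + y) \<eta>)"
  by (auto simp: exchange_def shift_def algebra_simps)

lemma local_functionsI:
  assumes "finite A" "\<And>\<eta> \<xi>. (\<And>y. y \<in> A \<Longrightarrow> \<eta> y = \<xi> y) \<Longrightarrow> f \<eta> = f \<xi>"
  shows "f \<in> local_functions"
proof -
  have "\<forall>\<eta> \<xi>. (\<forall>y\<in>A. \<eta> y = \<xi> y) \<longrightarrow> f \<eta> = f \<xi>"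
    by (intro allI impI assms(2)) simp
  then show ?thesis using assms(1) unfolding local_functions_def by blast
qed

lemma local_functionsD:
  assumes "f \<in> local_functions"
  shows "\<exists>A. finite A \<and> (\<forall>\<eta> \<xi>. (\<forall>y\<in>A. \<eta> y = \<xi> y) \<longrightarrow> f \<eta> = f \<xi>)"
  using assms unfolding local_functions_def by blast

lemma local_const [simp]: "(\<lambda>_. a) \<in> local_functions"
  by (rule local_functionsI[of "{}"]) auto

lemma local_comp2:
  assumes "f \<in> local_functions" "g \<in> local_functions"
  shows "(\<lambda>\<eta>. h (f \<eta>) (g \<eta>)) \<in> local_functions"
proof -
  obtain A where A: "finite A" "\<forall>\<eta> \<xi>. (\<forall>y\<in>A. \<eta> y = \<xi> y) \<longrightarrow> f \<eta> = f \<xi>"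
    using local_functionsD[OF assms(1)] by blast
  obtain B where B: "finite B" "\<forall>\<eta> \<xi>. (\<forall>y\<in>B. \<eta> y = \<xi> y) \<longrightarrow> g \<eta> = g \<xi>"
    using local_functionsD[OF assms(2)] by blast
  show ?thesis
  proof (rule local_functionsI)
    show "finite (A \<union> B)" using A(1) B(1) by simp
    fix \<eta> \<xi> :: config assume *: "\<And>y. y \<in> A \<union> B \<Longrightarrow> \<eta> y = \<xi> y"
    have "f \<eta> = f \<xi>" by (rule A(2)[rule_format]) (simp add: *)
    moreover have "g \<eta> = g \<xi>" by (rule B(2)[rule_format]) (simp add: *)
    ultimately show "h (f \<eta>) (g \<eta>) = h (f \<xi>) (g \<xi>)" by (rule arg_cong2)
  qed
qed

lemma local_comp: "f \<in> local_functions \<Longrightarrow> (\<lambda>\<eta>. h (f \<eta>)) \<in> local_functions"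
  using local_comp2[of f f "\<lambda>a _. h a"] .

lemmas local_mult = local_comp2[where h="(*)"]
lemmas local_add = local_comp2[where h="(+)"]
lemmas local_diff = local_comp2[where h="(-)"]

lemma local_sum:
  "(\<And>i. i \<in> I \<Longrightarrow> f i \<in> local_functions) \<Longrightarrow> (\<lambda>\<eta>. \<Sum>i\<in>I. f i \<eta>) \<in> local_functions"
  by (induction I rule: infinite_finite_induct) (auto intro: local_add)

lemma local_reindex:
  assumes "f \<in> local_functions"
  shows "(\<lambda>\<eta>. f (\<lambda>y. \<eta> (p y))) \<in> local_functions"
proof -
  obtain A where A: "finite A" "\<forall>\<eta> \<xi>. (\<forall>y\<in>A. \<eta> y = \<xi> y) \<longrightarrow> f \<eta> = f \<xi>"
    using local_functionsD[OF assms] by blast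
  show ?thesis
  proof (rule local_functionsI)
    show "finite (p ` A)" using A(1) by simp
  qed (rule A(2)[rule_format], simp)
qed

lemma local_shift: "f \<in> local_functions \<Longrightarrow> (\<lambda>\<eta>. f (shift x \<eta>)) \<in> local_functions"
  unfolding shift_def by (rule local_reindex)

lemma local_exchange: "f \<in> local_functions \<Longrightarrow> (\<lambda>\<eta>. f (exchange x \<eta>)) \<in> local_functions"
  unfolding exchange_eq by (rule local_reindex)

text \<open>The function is constant on the open cylinder of all configurations that agree with a
  given one on the finite support.\<close>

lemma local_continuous:
  assumes "f \<in> local_functions"
  shows "continuous_on S f"
proof -
  obtain A where A: "finite A" "\<forall>\<eta> \<xi>. (\<forall>y\<in>A. \<eta> y = \<xi> y) \<longrightarrow> f \<eta> = f \<xi>"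
    using local_functionsD[OF assms] by blast
  have "(f \<longlongrightarrow> f \<eta>) (at \<eta> within S)" for \<eta>
  proof -
    have "open {\<xi>::config. \<xi> y = \<eta> y}" for y
    proof -
      have "open ((\<lambda>\<xi>::config. \<xi> y) -` {\<eta> y})"
        by (rule open_vimage) (auto simp: discrete_topology_class.open_discrete)
      then show ?thesis by (simp add: vimage_def)
    qed
    then have "open (\<Inter>y\<in>A. {\<xi>::config. \<xi> y = \<eta> y})"
      using A(1) by (intro open_INT) auto
    then have "\<forall>\<^sub>F \<xi> in nhds \<eta>. \<xi> \<in> (\<Inter>y\<in>A. {\<xi>::config. \<xi> y = \<eta> y})"
      by (intro eventually_nhds_in_open) auto
    then have "\<forall>\<^sub>F \<xi> in at \<eta> within S. f \<xi> = f \<eta>"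
      unfolding eventually_at_filter by (rule eventually_mono) (auto intro: A(2)[rule_format])
    then show ?thesis
      by (rule tendsto_eventually)
  qed
  then show ?thesis by (simp add: continuous_on_def)
qed

lemma local_bounded:
  assumes "f \<in> local_functions"
  obtains M where "0 \<le> M" "\<And>\<eta>. \<bar>f \<eta>\<bar> \<le> M"
proof -
  have "bounded (range f)"
    using continuous_config_bcontfun[OF local_continuous[OF assms]] by (simp add: bcontfun_def)
  then obtain M where "\<And>\<eta>. \<bar>f \<eta>\<bar> \<le> M" by (auto simp: bounded_iff)
  then show ?thesis using that[of "max 0 M"] by (metis max.cobounded1 max.coboundedI2)
qed

section \<open>The Bernoulli product measure\<close>

lemma prob_space_bernoulli_product: "prob_space (bernoulli_product \<rho>)"
  unfolding bernoulli_product_def by (intro prob_space_PiM measure_pmf.prob_space_axioms)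

lemma space_bernoulli_product [simp]: "space (bernoulli_product \<rho>) = UNIV"
  by (auto simp: bernoulli_product_def space_PiM)

lemma measurable_bernoulli_product [simp]:
  "borel_measurable (bernoulli_product \<rho>) = borel_measurable borel"
  by (rule measurable_cong_sets) (simp_all add: sets_bernoulli_product)

lemma integrable_bernoulli:
  fixes u :: "config \<Rightarrow> real"
  assumes "continuous_on UNIV u"
  shows "integrable (bernoulli_product \<rho>) u"
proof -
  interpret prob_space "bernoulli_product \<rho>" by (rule prob_space_bernoulli_product)
  have "bounded (range u)"
    using continuous_config_bcontfun[OF assms] by (simp add: bcontfun_def)
  then obtain M where "\<And>\<eta>. norm (u \<eta>) \<le> M" by (auto simp: bounded_iff)
  then show ?thesis
    using borel_measurable_continuous_onI[OF assms]
    by (intro integrable_const_bound[of u M]) auto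
qed

lemmas integrable_local = integrable_bernoulli[OF local_continuous]

text \<open>An injective selection from an i.i.d. family has the same law, so one statement covers
  shifts and exchanges.\<close>

lemma bernoulli_reindex:
  fixes u :: "config \<Rightarrow> real"
  assumes "inj p" and u: "continuous_on UNIV u"
  shows "(LINT \<eta>|bernoulli_product \<rho>. u (\<lambda>y. \<eta> (p y))) = (LINT \<eta>|bernoulli_product \<rho>. u \<eta>)"
proof -
  let ?\<nu> = "bernoulli_product \<rho>"
  have *: "distr ?\<nu> ?\<nu> (\<lambda>\<omega> y. \<omega> (p y)) = ?\<nu>"
    unfolding bernoulli_product_def
    using distr_PiM_reindex[of UNIV "\<lambda>_. measure_pmf (bernoulli_pmf \<rho>)" p UNIV] assms
    by (simp add: measure_pmf.prob_space_axioms restrict_def)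
  have m: "(\<lambda>\<omega> y. \<omega> (p y)) \<in> measurable ?\<nu> ?\<nu>"
    unfolding bernoulli_product_def using measurable_component_singleton[of _ UNIV "\<lambda>_. measure_pmf (bernoulli_pmf \<rho>)"]
    by (rule measurable_PiM_single') (simp_all add: space_PiM)
  have "(LINT \<eta>|?\<nu>. u \<eta>) = (LINT \<eta>|distr ?\<nu> ?\<nu> (\<lambda>\<omega> y. \<omega> (p y)). u \<eta>)"
    unfolding * ..
  also have "\<dots> = (LINT \<eta>|?\<nu>. u (\<lambda>y. \<eta> (p y)))"
    using borel_measurable_continuous_onI[OF u] by (intro integral_distr[OF m]) simp
  finally show ?thesis ..
qed

lemma bernoulli_shift:
  fixes u :: "config \<Rightarrow> real"
  assumes "continuous_on UNIV u"
  shows "(LINT \<eta>|bernoulli_product \<rho>. u (shift x \<eta>)) = (LINT \<eta>|bernoulli_product \<rho>. u \<eta>)"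
  unfolding shift_def by (rule bernoulli_reindex[OF _ assms]) (auto simp: inj_def)

lemma bernoulli_exchange:
  fixes u :: "config \<Rightarrow> real"
  assumes "continuous_on UNIV u"
  shows "(LINT \<eta>|bernoulli_product \<rho>. u (exchange x \<eta>)) = (LINT \<eta>|bernoulli_product \<rho>. u \<eta>)"
  unfolding exchange_eq by (rule bernoulli_reindex[OF _ assms]) (simp add: inj_transpose)

section \<open>The gas generator on local functions\<close>

text \<open>\<open>F\<close> collects the bonds that meet the support of \<open>f\<close>. Every
  larger finite set is allowed too, so that sums arising from two functions can be put over a common
  index set.\<close>

lemma gas_generator_local:
  assumes "f \<in> local_functions"
  obtains F where "finite F"
    "\<And>F' c \<eta>. finite F' \<Longrightarrow> F \<subseteq> F' \<Longrightarrow>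
       gas_generator c f \<eta> = (\<Sum>x\<in>F'. c (shift x \<eta>) * (f (exchange x \<eta>) - f \<eta>))"
proof -
  obtain A where A: "finite A" "\<forall>\<eta> \<xi>. (\<forall>y\<in>A. \<eta> y = \<xi> y) \<longrightarrow> f \<eta> = f \<xi>"
    using local_functionsD[OF assms] by blast
  \<comment> \<open>The bond between \<open>x\<close> and \<open>x + 1\<close> can meet
    \<open>A\<close> at either end, hence the translate by -1.\<close>
  define F where "F = A \<union> (\<lambda>y. y - 1) ` A"
  have zero: "f (exchange x \<eta>) = f \<eta>" if "x \<notin> F" for x \<eta>
  proof (rule A(2)[rule_format])
    fix y assume "y \<in> A"
    then have "y \<noteq> x" "y \<noteq> x + 1" using that by (force simp: F_def)+
    then show "exchange x \<eta> y = \<eta> y" by (simp add: exchange_def)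
  qed
  have "gas_generator c f \<eta> = (\<Sum>x\<in>F'. c (shift x \<eta>) * (f (exchange x \<eta>) - f \<eta>))"
    if "finite F'" "F \<subseteq> F'" for F' c \<eta>
  proof -
    have "gas_generator c f \<eta> = (\<Sum>\<^sub>\<infinity>x\<in>F'. c (shift x \<eta>) * (f (exchange x \<eta>) - f \<eta>))"
      unfolding gas_generator_def
      by (rule infsum_cong_neutral) (use zero that in auto)
    then show ?thesis using that by simp
  qed
  moreover have "finite F" using A by (simp add: F_def)
  ultimately show ?thesis using that by blast
qed

lemma local_gas_generator:
  assumes "c \<in> local_functions" "f \<in> local_functions"
  shows "gas_generator c f \<in> local_functions"
proof -
  obtain F where F: "finite F"
    "\<And>F' c \<eta>. finite F' \<Longrightarrow> F \<subseteq> F' \<Longrightarrow>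
       gas_generator c f \<eta> = (\<Sum>x\<in>F'. c (shift x \<eta>) * (f (exchange x \<eta>) - f \<eta>))"
    using gas_generator_local[OF assms(2)] by blast
  have "gas_generator c f = (\<lambda>\<eta>. \<Sum>x\<in>F. c (shift x \<eta>) * (f (exchange x \<eta>) - f \<eta>))"
    using F by auto
  then show ?thesis
    by (simp add: local_sum local_mult local_diff local_shift[OF assms(1)] local_exchange[OF assms(2)] assms)
qed

text \<open>The rate of a bond ignores the occupation of its end points. Together with the
  invariance of the measure under exchanges this is detailed balance.\<close>

lemma rate_exchange:
  assumes "interaction_rate \<epsilon>0 c"
  shows "c (shift x (exchange x \<eta>)) = c (shift x \<eta>)"
proof -
  have "\<And>\<eta> \<xi>. (\<forall>x. x \<noteq> 0 \<and> x \<noteq> 1 \<longrightarrow> \<eta> x = \<xi> x) \<Longrightarrow> c \<eta> = c \<xi>"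
    using assms unfolding interaction_rate_def by blast
  then show ?thesis by (auto simp: shift_def exchange_def)
qed

text \<open>Measure and rate of a bond are invariant under its exchange, so averaging each bond term
  with its exchanged copy yields a product of two differences and the factor 1/2.\<close>

lemma gas_dirichlet:
  assumes c: "interaction_rate \<epsilon>0 c" and f: "f \<in> local_functions" and g: "g \<in> local_functions"
  obtains F where "finite F"
    "\<And>F'. finite F' \<Longrightarrow> F \<subseteq> F' \<Longrightarrow>
       (LINT \<eta>|bernoulli_product \<rho>. gas_generator c f \<eta> * g \<eta>) =
       - (\<Sum>x\<in>F'. LINT \<eta>|bernoulli_product \<rho>.
            c (shift x \<eta>) * ((f (exchange x \<eta>) - f \<eta>) * (g (exchange x \<eta>) - g \<eta>))) / 2"
proof -
  let ?\<nu> = "bernoulli_product \<rho>"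
  have cl: "c \<in> local_functions" using c by (simp add: interaction_rate_def)
  obtain F where F: "finite F"
    "\<And>F' c \<eta>. finite F' \<Longrightarrow> F \<subseteq> F' \<Longrightarrow>
       gas_generator c f \<eta> = (\<Sum>x\<in>F'. c (shift x \<eta>) * (f (exchange x \<eta>) - f \<eta>))"
    using gas_generator_local[OF f] by blast
  note loc = local_mult local_diff local_shift[OF cl] local_exchange[OF f] local_exchange[OF g] f g
  have bond: "(LINT \<eta>|?\<nu>. c (shift x \<eta>) * (f (exchange x \<eta>) - f \<eta>) * g \<eta>) =
      - (LINT \<eta>|?\<nu>. c (shift x \<eta>) * ((f (exchange x \<eta>) - f \<eta>) * (g (exchange x \<eta>) - g \<eta>))) / 2" for x
  proof -
    let ?h = "\<lambda>\<eta>. c (shift x \<eta>) * (f (exchange x \<eta>) - f \<eta>) * g \<eta>"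
    have l: "?h \<in> local_functions" by (intro loc)
    have "(LINT \<eta>|?\<nu>. ?h \<eta>) = (LINT \<eta>|?\<nu>. ?h (exchange x \<eta>))"
      by (rule bernoulli_exchange[symmetric]) (intro local_continuous l)
    then have "2 * (LINT \<eta>|?\<nu>. ?h \<eta>) = (LINT \<eta>|?\<nu>. ?h \<eta>) + (LINT \<eta>|?\<nu>. ?h (exchange x \<eta>))"
      by simp
    also have "\<dots> = (LINT \<eta>|?\<nu>. ?h \<eta> + ?h (exchange x \<eta>))"
      by (intro Bochner_Integration.integral_add[symmetric] integrable_local l local_exchange[OF l])
    also have "\<dots> = (LINT \<eta>|?\<nu>. - (c (shift x \<eta>) * ((f (exchange x \<eta>) - f \<eta>) * (g (exchange x \<eta>) - g \<eta>))))"
      by (intro Bochner_Integration.integral_cong) (auto simp: rate_exchange[OF c] algebra_simps)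
    finally show ?thesis by simp
  qed
  have "(LINT \<eta>|?\<nu>. gas_generator c f \<eta> * g \<eta>) =
       - (\<Sum>x\<in>F'. LINT \<eta>|?\<nu>.
            c (shift x \<eta>) * ((f (exchange x \<eta>) - f \<eta>) * (g (exchange x \<eta>) - g \<eta>))) / 2"
    if "finite F'" "F \<subseteq> F'" for F'
  proof -
    have "(LINT \<eta>|?\<nu>. gas_generator c f \<eta> * g \<eta>) =
        (LINT \<eta>|?\<nu>. (\<Sum>x\<in>F'. c (shift x \<eta>) * (f (exchange x \<eta>) - f \<eta>) * g \<eta>))"
      using F(2)[OF that] by (simp add: sum_distrib_right)
    also have "\<dots> = (\<Sum>x\<in>F'. LINT \<eta>|?\<nu>. c (shift x \<eta>) * (f (exchange x \<eta>) - f \<eta>) * g \<eta>)"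
      by (intro Bochner_Integration.integral_sum integrable_local loc)
    also have "\<dots> = - (\<Sum>x\<in>F'. LINT \<eta>|?\<nu>.
            c (shift x \<eta>) * ((f (exchange x \<eta>) - f \<eta>) * (g (exchange x \<eta>) - g \<eta>))) / 2"
      unfolding bond by (simp add: sum_negf sum_divide_distrib)
    finally show ?thesis .
  qed
  then show ?thesis using that F by blast
qed

lemma gas_symmetric:
  assumes c: "interaction_rate \<epsilon>0 c" and f: "f \<in> local_functions" and g: "g \<in> local_functions"
  shows "(LINT \<eta>|bernoulli_product \<rho>. gas_generator c f \<eta> * g \<eta>) =
    (LINT \<eta>|bernoulli_product \<rho>. f \<eta> * gas_generator c g \<eta>)"
proof -
  obtain F where F: "finite F"
    "\<And>F'. finite F' \<Longrightarrow> F \<subseteq> F' \<Longrightarrow>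
       (LINT \<eta>|bernoulli_product \<rho>. gas_generator c f \<eta> * g \<eta>) =
       - (\<Sum>x\<in>F'. LINT \<eta>|bernoulli_product \<rho>.
            c (shift x \<eta>) * ((f (exchange x \<eta>) - f \<eta>) * (g (exchange x \<eta>) - g \<eta>))) / 2"
    using gas_dirichlet[OF c f g] by blast
  obtain G where G: "finite G"
    "\<And>F'. finite F' \<Longrightarrow> G \<subseteq> F' \<Longrightarrow>
       (LINT \<eta>|bernoulli_product \<rho>. gas_generator c g \<eta> * f \<eta>) =
       - (\<Sum>x\<in>F'. LINT \<eta>|bernoulli_product \<rho>.
            c (shift x \<eta>) * ((g (exchange x \<eta>) - g \<eta>) * (f (exchange x \<eta>) - f \<eta>))) / 2"
    using gas_dirichlet[OF c g f] by blast
  show ?thesis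
    using F(2)[of "F \<union> G"] G(2)[of "F \<union> G"] F(1) G(1) by (simp add: mult.commute)
qed

section \<open>The walk part and its adjoint\<close>

definition walk_generator :: "int set \<Rightarrow> (int \<Rightarrow> config \<Rightarrow> real) \<Rightarrow> (config \<Rightarrow> real) \<Rightarrow> config \<Rightarrow> real" where
  "walk_generator R r u \<xi> = (\<Sum>z\<in>R. r z \<xi> * (u (shift z \<xi>) - u \<xi>))"

text \<open>The adjoint with respect to the product measure, computed from shift invariance: the
  gain at \<open>\<xi>\<close> comes from \<open>shift (- z) \<xi>\<close>. It need not annihilate
  constants, since the walk need not preserve the measure.\<close>

definition walk_adjoint :: "int set \<Rightarrow> (int \<Rightarrow> config \<Rightarrow> real) \<Rightarrow> (config \<Rightarrow> real) \<Rightarrow> config \<Rightarrow> real" where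
  "walk_adjoint R r u \<xi> = (\<Sum>z\<in>R. r z (shift (- z) \<xi>) * u (shift (- z) \<xi>) - r z \<xi> * u \<xi>)"

lemma continuous_walk_generator:
  assumes "\<And>z. z \<in> R \<Longrightarrow> r z \<in> local_functions" "continuous_on UNIV u"
  shows "continuous_on UNIV (walk_generator R r u)"
  unfolding walk_generator_def
  by (intro continuous_intros local_continuous assms continuous_on_shift)

lemma continuous_walk_adjoint:
  assumes "\<And>z. z \<in> R \<Longrightarrow> r z \<in> local_functions" "continuous_on UNIV u"
  shows "continuous_on UNIV (walk_adjoint R r u)"
  unfolding walk_adjoint_def
  by (intro continuous_intros continuous_on_shift local_continuous assms)

lemma walk_adjoint_duality:
  fixes u v :: "config \<Rightarrow> real"
  assumes r: "\<And>z. z \<in> R \<Longrightarrow> r z \<in> local_functions"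
    and u: "continuous_on UNIV u" and v: "continuous_on UNIV v"
  shows "(LINT \<xi>|bernoulli_product \<rho>. walk_adjoint R r u \<xi> * v \<xi>) =
    (LINT \<xi>|bernoulli_product \<rho>. u \<xi> * walk_generator R r v \<xi>)"
proof -
  let ?\<nu> = "bernoulli_product \<rho>"
  note [simp] = integrable_bernoulli continuous_on_shift[OF u] continuous_on_shift[OF v] u v
    continuous_on_mult continuous_on_diff
  have rc [simp]: "continuous_on UNIV (r z)" "continuous_on UNIV (\<lambda>\<xi>. r z (shift a \<xi>))" if "z \<in> R" for z a
    using that r by (auto intro: local_continuous continuous_on_shift)
  have "(LINT \<xi>|?\<nu>. walk_adjoint R r u \<xi> * v \<xi>) =
      (\<Sum>z\<in>R. LINT \<xi>|?\<nu>. r z (shift (- z) \<xi>) * u (shift (- z) \<xi>) * v \<xi> - r z \<xi> * u \<xi> * v \<xi>)"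
    unfolding walk_adjoint_def
    by (subst Bochner_Integration.integral_sum[symmetric]) (auto simp: sum_distrib_right left_diff_distrib)
  also have "\<dots> = (\<Sum>z\<in>R. LINT \<xi>|?\<nu>. u \<xi> * (r z \<xi> * (v (shift z \<xi>) - v \<xi>)))"
  proof (rule sum.cong[OF refl])
    fix z assume z: "z \<in> R"
    have "(LINT \<xi>|?\<nu>. r z (shift (- z) \<xi>) * u (shift (- z) \<xi>) * v \<xi>) =
        (LINT \<xi>|?\<nu>. (\<lambda>\<xi>. r z \<xi> * u \<xi> * v (shift z \<xi>)) (shift (- z) \<xi>))" by simp
    also have "\<dots> = (LINT \<xi>|?\<nu>. r z \<xi> * u \<xi> * v (shift z \<xi>))"
      using z by (intro bernoulli_shift) simp
    finally have "(LINT \<xi>|?\<nu>. r z (shift (- z) \<xi>) * u (shift (- z) \<xi>) * v \<xi> - r z \<xi> * u \<xi> * v \<xi>) =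
      (LINT \<xi>|?\<nu>. r z \<xi> * u \<xi> * v (shift z \<xi>)) - (LINT \<xi>|?\<nu>. r z \<xi> * u \<xi> * v \<xi>)"
      using z by (subst Bochner_Integration.integral_diff) auto
    also have "\<dots> = (LINT \<xi>|?\<nu>. r z \<xi> * u \<xi> * v (shift z \<xi>) - r z \<xi> * u \<xi> * v \<xi>)"
      using z by (intro Bochner_Integration.integral_diff[symmetric]) auto
    finally show "(LINT \<xi>|?\<nu>. r z (shift (- z) \<xi>) * u (shift (- z) \<xi>) * v \<xi> - r z \<xi> * u \<xi> * v \<xi>) =
        (LINT \<xi>|?\<nu>. u \<xi> * (r z \<xi> * (v (shift z \<xi>) - v \<xi>)))"
      by (simp add: algebra_simps)
  qed
  also have "\<dots> = (LINT \<xi>|?\<nu>. (\<Sum>z\<in>R. u \<xi> * (r z \<xi> * (v (shift z \<xi>) - v \<xi>))))"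
    by (intro Bochner_Integration.integral_sum[symmetric]) auto
  finally show ?thesis by (simp add: walk_generator_def sum_distrib_left)
qed

section \<open>Functions controlled by finitely many exchanges\<close>

text \<open>A weak form of being a discrete divergence: tested against \<open>u\<close>, the
  function \<open>h\<close> sees only the variation of \<open>u\<close> across finitely many bonds.
  Young's inequality compares this first-power form with the Dirichlet form of
  \<open>sqrt u\<close>.\<close>

definition exchange_controlled :: "real \<Rightarrow> (config \<Rightarrow> real) \<Rightarrow> bool" where
  "exchange_controlled \<rho> h \<longleftrightarrow> (\<exists>F M. finite F \<and> 0 \<le> M \<and> (\<forall>u\<in>local_functions.
     \<bar>LINT \<eta>|bernoulli_product \<rho>. h \<eta> * u \<eta>\<bar> \<le>
       M * (\<Sum>x\<in>F. LINT \<eta>|bernoulli_product \<rho>. \<bar>u (exchange x \<eta>) - u \<eta>\<bar>)))"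

lemma exchange_controlled_0: "exchange_controlled \<rho> (\<lambda>_. 0)"
  unfolding exchange_controlled_def by (intro exI[of _ "{}"] exI[of _ 0]) auto

lemma exchange_controlled_uminus:
  "exchange_controlled \<rho> h \<Longrightarrow> exchange_controlled \<rho> (\<lambda>\<eta>. - h \<eta>)"
  unfolding exchange_controlled_def by simp

lemma exchange_controlled_add:
  assumes "exchange_controlled \<rho> h" "exchange_controlled \<rho> k"
    and loc: "h \<in> local_functions" "k \<in> local_functions"
  shows "exchange_controlled \<rho> (\<lambda>\<eta>. h \<eta> + k \<eta>)"
proof -
  let ?D = "\<lambda>u F. \<Sum>x\<in>F. LINT \<eta>|bernoulli_product \<rho>. \<bar>u (exchange x \<eta>) - u \<eta> :: real\<bar>"
  obtain F M where F: "finite F" "0 \<le> M"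
    "\<forall>u\<in>local_functions. \<bar>LINT \<eta>|bernoulli_product \<rho>. h \<eta> * u \<eta>\<bar> \<le> M * ?D u F"
    using assms(1) unfolding exchange_controlled_def by auto
  obtain G N where G: "finite G" "0 \<le> N"
    "\<forall>u\<in>local_functions. \<bar>LINT \<eta>|bernoulli_product \<rho>. k \<eta> * u \<eta>\<bar> \<le> N * ?D u G"
    using assms(2) unfolding exchange_controlled_def by auto
  have "\<bar>LINT \<eta>|bernoulli_product \<rho>. (h \<eta> + k \<eta>) * u \<eta>\<bar> \<le> (M + N) * ?D u (F \<union> G)"
    if u: "u \<in> local_functions" for u
  proof -
    have "(LINT \<eta>|bernoulli_product \<rho>. (h \<eta> + k \<eta>) * u \<eta>) =
      (LINT \<eta>|bernoulli_product \<rho>. h \<eta> * u \<eta>) + (LINT \<eta>|bernoulli_product \<rho>. k \<eta> * u \<eta>)"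
      unfolding distrib_right
      by (intro Bochner_Integration.integral_add integrable_local local_mult loc u)
    then have "\<bar>LINT \<eta>|bernoulli_product \<rho>. (h \<eta> + k \<eta>) * u \<eta>\<bar> \<le> M * ?D u F + N * ?D u G"
      using F(3) G(3) u by fastforce
    also have "\<dots> \<le> M * ?D u (F \<union> G) + N * ?D u (F \<union> G)"
      using F G by (intro add_mono mult_left_mono sum_mono2) auto
    finally show ?thesis by (simp add: distrib_right)
  qed
  then show ?thesis
    unfolding exchange_controlled_def using F G
    by (intro exI[of _ "F \<union> G"] exI[of _ "M + N"]) auto
qed

lemma exchange_controlled_sum:
  assumes "\<And>i. i \<in> I \<Longrightarrow> exchange_controlled \<rho> (h i)" "\<And>i. i \<in> I \<Longrightarrow> h i \<in> local_functions"
  shows "exchange_controlled \<rho> (\<lambda>\<eta>. \<Sum>i\<in>I. h i \<eta>)"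
  using assms
  by (induction I rule: infinite_finite_induct)
     (auto intro!: exchange_controlled_0 exchange_controlled_add local_sum)

text \<open>Invariance of the measure moves the exchange from \<open>k\<close> to \<open>u\<close>;
  then only a bound for \<open>k\<close> is needed.\<close>

lemma exchange_controlled_exchange:
  assumes k: "k \<in> local_functions"
  shows "exchange_controlled \<rho> (\<lambda>\<eta>. k (exchange x \<eta>) - k \<eta>)"
proof -
  let ?\<nu> = "bernoulli_product \<rho>"
  obtain M where M: "0 \<le> M" "\<And>\<eta>. \<bar>k \<eta>\<bar> \<le> M" using local_bounded[OF k] by blast
  have "\<bar>LINT \<eta>|?\<nu>. (k (exchange x \<eta>) - k \<eta>) * u \<eta>\<bar> \<le> M * (LINT \<eta>|?\<nu>. \<bar>u (exchange x \<eta>) - u \<eta>\<bar>)"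
    if u: "u \<in> local_functions" for u
  proof -
    note loc = k u local_exchange[OF k] local_exchange[OF u]
    note int = integrable_local local_mult local_diff loc
    have "(LINT \<eta>|?\<nu>. k (exchange x \<eta>) * u \<eta>) = (LINT \<eta>|?\<nu>. k \<eta> * u (exchange x \<eta>))"
      using bernoulli_exchange[OF local_continuous[OF local_mult[OF k local_exchange[OF u, of x]]], of \<rho> x]
      by simp
    then have "(LINT \<eta>|?\<nu>. (k (exchange x \<eta>) - k \<eta>) * u \<eta>) =
      (LINT \<eta>|?\<nu>. k \<eta> * u (exchange x \<eta>)) - (LINT \<eta>|?\<nu>. k \<eta> * u \<eta>)"
      unfolding left_diff_distrib
      by (subst Bochner_Integration.integral_diff) (auto intro!: int)
    also have "\<dots> = (LINT \<eta>|?\<nu>. k \<eta> * (u (exchange x \<eta>) - u \<eta>))"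
      unfolding right_diff_distrib by (intro Bochner_Integration.integral_diff[symmetric] int)
    also have "\<bar>\<dots>\<bar> \<le> (LINT \<eta>|?\<nu>. \<bar>k \<eta> * (u (exchange x \<eta>) - u \<eta>)\<bar>)"
      by (rule integral_abs_bound)
    also have "\<dots> \<le> (LINT \<eta>|?\<nu>. M * \<bar>u (exchange x \<eta>) - u \<eta>\<bar>)"
      using M by (intro integral_mono int local_comp[of _ abs] local_const)
        (auto simp: abs_mult intro!: mult_right_mono)
    finally show ?thesis by simp
  qed
  then show ?thesis
    unfolding exchange_controlled_def using M
    by (intro exI[of _ "{x}"] exI[of _ M]) simp
qed

text \<open>On the support of \<open>k\<close> the shift by one agrees with a composition of exchanges of neighbours,
  which carries the particle left of the support across it.\<close>

lemma exchange_controlled_shift_1: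
  assumes k: "k \<in> local_functions"
  shows "exchange_controlled \<rho> (\<lambda>\<eta>. k (shift 1 \<eta>) - k \<eta>)"
proof -
  obtain A where A: "finite A" "\<forall>\<eta> \<xi>. (\<forall>y\<in>A. \<eta> y = \<xi> y) \<longrightarrow> k \<eta> = k \<xi>"
    using local_functionsD[OF k] by blast
  define m where "m = (\<Sum>y\<in>A. \<bar>y\<bar>)"
  have m: "\<bar>y\<bar> \<le> m" if "y \<in> A" for y
    unfolding m_def using that A(1) by (intro member_le_sum) auto
  \<comment> \<open>The coordinate map of the composed exchanges at m, m - 1, ..., m - j + 1: a
    cyclic shift of the sites m - j + 1, ..., m + 1.\<close>
  define p where "p j y = (if m - int j < y \<and> y \<le> m then y + 1 else if y = m + 1 then m - int j + 1 else y)"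
    for j y
  define K where "K j \<eta> = k (\<lambda>y. \<eta> (p j y))" for j and \<eta> :: config
  have K_loc: "K j \<in> local_functions" for j
    unfolding K_def by (rule local_reindex[OF k])
  have K_Suc: "K (Suc j) \<eta> = K j (exchange (m - int j) \<eta>)" for j \<eta>
    unfolding K_def by (intro arg_cong[of _ _ k] ext) (auto simp: p_def exchange_def)
  have K_0: "K 0 = k"
    unfolding K_def by (intro ext arg_cong[of _ _ k]) (auto simp: p_def)
  \<comment> \<open>The number of sites in [-m, m], which contains the support \<open>A\<close>;
    after that many exchanges each of these sites reads its right neighbour.\<close>
  define N where "N = nat (2 * m + 1)"
  have K_N: "K N \<eta> = k (shift 1 \<eta>)" for \<eta>
    unfolding K_def
    by (rule A(2)[rule_format]) (use m in \<open>force simp: p_def N_def shift_def add.commute\<close>)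
  have "(\<lambda>\<eta>. k (shift 1 \<eta>) - k \<eta>) = (\<lambda>\<eta>. \<Sum>j<N. K j (exchange (m - int j) \<eta>) - K j \<eta>)"
    unfolding K_Suc[symmetric] using sum_lessThan_telescope[of "\<lambda>j. K j _" N] by (simp add: K_N K_0)
  moreover have "exchange_controlled \<rho> \<dots>"
    by (intro exchange_controlled_sum exchange_controlled_exchange local_diff local_exchange[OF K_loc] K_loc)
  ultimately show ?thesis by simp
qed

text \<open>A positive displacement telescopes into unit shifts. A negative one is, up to sign, a
  positive displacement of the translate \<open>k (shift z \<eta>)\<close>.\<close>

lemma exchange_controlled_shift:
  assumes k: "k \<in> local_functions"
  shows "exchange_controlled \<rho> (\<lambda>\<eta>. k (shift z \<eta>) - k \<eta>)"
proof -
  have nonneg: "exchange_controlled \<rho> (\<lambda>\<eta>. k (shift (int n) \<eta>) - k \<eta>)"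
    if k: "k \<in> local_functions" for k n
  proof (induction n)
    case 0
    then show ?case by (simp add: exchange_controlled_0)
  next
    case (Suc n)
    note loc = local_shift[OF k]
    have "(\<lambda>\<eta>. k (shift (int (Suc n)) \<eta>) - k \<eta>) =
      (\<lambda>\<eta>. (k (shift (int n) (shift 1 \<eta>)) - k (shift (int n) \<eta>)) + (k (shift (int n) \<eta>) - k \<eta>))"
      by (simp add: add.commute)
    then show ?case
      using exchange_controlled_add[OF exchange_controlled_shift_1[OF loc[of "int n"]] Suc]
        local_diff[OF local_shift[OF loc[of "int n"], of 1] loc[of "int n"]]
        local_diff[OF loc[of "int n"] k] by simp
  qed
  show ?thesis
  proof (cases z)
    case (nonneg n)
    then show ?thesis using \<open>\<And>k n. k \<in> local_functions \<Longrightarrow> exchange_controlled \<rho> (\<lambda>\<eta>. k (shift (int n) \<eta>) - k \<eta>)\<close>[OF k] by simp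
  next
    case (neg n)
    have "exchange_controlled \<rho> (\<lambda>\<eta>. k (shift z (shift (int (Suc n)) \<eta>)) - k (shift z \<eta>))"
      by (rule nonneg[OF local_shift[OF k]])
    from exchange_controlled_uminus[OF this] show ?thesis using neg by simp
  qed
qed

lemma exchange_controlled_walk_adjoint_1:
  assumes r: "\<And>z. z \<in> R \<Longrightarrow> r z \<in> local_functions"
  shows "exchange_controlled \<rho> (walk_adjoint R r (\<lambda>_. 1))"
  unfolding walk_adjoint_def mult_1_right
  by (intro exchange_controlled_sum exchange_controlled_shift local_diff local_shift r)

section \<open>The entropy production of local densities\<close>

text \<open>Passes from the entropy production of a bond to the Dirichlet term of the square root.
  It rests on \<open>ln y \<le> y - 1\<close> at \<open>y = sqrt b / sqrt a\<close>; the factor 2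
  comes from \<open>ln a = 2 * ln (sqrt a)\<close> and offsets the 1/2 of the Dirichlet
  form.\<close>

lemma log_diff_sqrt_bound:
  fixes a b :: real
  assumes "0 < a" "0 < b"
  shows "2 * (sqrt a - sqrt b)\<^sup>2 \<le> (a - b) * (ln a - ln b)"
proof -
  have *: "2 * (sqrt a - sqrt b)\<^sup>2 \<le> (a - b) * (ln a - ln b)" if "0 < b" "b \<le> a" for a b
  proof -
    define s t where "s = sqrt a" and "t = sqrt b"
    have st: "0 < t" "t \<le> s" "a = s\<^sup>2" "b = t\<^sup>2" using that by (auto simp: s_def t_def)
    have "ln (t / s) \<le> t / s - 1" using st by (intro ln_le_minus_one) auto
    then have "(s - t) / s \<le> ln s - ln t"
      using st by (simp add: ln_div field_simps)
    then have "(s\<^sup>2 - t\<^sup>2) * ((s - t) / s) \<le> (s\<^sup>2 - t\<^sup>2) * (ln s - ln t)"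
      using st by (intro mult_left_mono) (auto intro: power_mono)
    moreover have "(s - t)\<^sup>2 \<le> (s\<^sup>2 - t\<^sup>2) * ((s - t) / s)"
    proof -
      have "(s - t)\<^sup>2 * 1 \<le> (s - t)\<^sup>2 * ((s + t) / s)"
        using st by (intro mult_left_mono) auto
      also have "(s - t)\<^sup>2 * (s + t) = (s\<^sup>2 - t\<^sup>2) * (s - t)"
        by (simp add: power2_eq_square algebra_simps)
      then have "(s - t)\<^sup>2 * ((s + t) / s) = (s\<^sup>2 - t\<^sup>2) * ((s - t) / s)"
        by (simp only: times_divide_eq_right)
      finally show ?thesis by simp
    qed
    ultimately have "2 * (s - t)\<^sup>2 \<le> (s\<^sup>2 - t\<^sup>2) * (2 * ln s - 2 * ln t)"
      by (simp add: algebra_simps)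
    moreover have "ln a = 2 * ln s" "ln b = 2 * ln t" using st by (simp_all add: ln_realpow)
    ultimately show ?thesis unfolding s_def[symmetric] t_def[symmetric] st(3)[symmetric] st(4)[symmetric]
      by simp
  qed
  show ?thesis
  proof (cases "b \<le> a")
    case False
    have "(a - b) * (ln a - ln b) = (b - a) * (ln b - ln a)" by (simp add: algebra_simps)
    then show ?thesis
      using *[where a = b and b = a] assms False by (simp add: power2_commute)
  qed (use assms * in auto)
qed

text \<open>In the Dirichlet form of \<open>u\<close> and \<open>ln u\<close> every bond has a
  favourable sign, so the estimate may keep any prescribed finite set \<open>F\<close>. It will be
  the set of bonds needed to control the walk.\<close>

lemma gas_entropy_production:
  assumes c: "interaction_rate \<epsilon>0 c" and "0 < \<epsilon>0" and u: "u \<in> local_functions" and pos: "\<And>\<eta>. 0 < u \<eta>"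
    and F: "finite F"
  shows "(LINT \<eta>|bernoulli_product \<rho>. gas_generator c u \<eta> * ln (u \<eta>)) \<le>
    - \<epsilon>0 * (\<Sum>x\<in>F. LINT \<eta>|bernoulli_product \<rho>. (sqrt (u (exchange x \<eta>)) - sqrt (u \<eta>))\<^sup>2)"
proof -
  let ?\<nu> = "bernoulli_product \<rho>"
  let ?D = "\<lambda>x. LINT \<eta>|?\<nu>. c (shift x \<eta>) * ((u (exchange x \<eta>) - u \<eta>) * (ln (u (exchange x \<eta>)) - ln (u \<eta>)))"
  have cl: "c \<in> local_functions" and c_ge: "\<epsilon>0 \<le> c \<eta>" for \<eta> using c by (auto simp: interaction_rate_def)
  note loc = local_mult local_diff local_comp[OF u, of ln] local_comp[OF u, of sqrt] u local_exchange[OF u]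
    local_exchange[OF local_comp[OF u, of ln]] local_exchange[OF local_comp[OF u, of sqrt]] local_shift[OF cl]
    local_const
  obtain G where G: "finite G" "\<And>F'. finite F' \<Longrightarrow> G \<subseteq> F' \<Longrightarrow>
       (LINT \<eta>|?\<nu>. gas_generator c u \<eta> * ln (u \<eta>)) = - (\<Sum>x\<in>F'. ?D x) / 2"
    using gas_dirichlet[OF c u local_comp[OF u, of ln]] by blast
  have D: "2 * \<epsilon>0 * (LINT \<eta>|?\<nu>. (sqrt (u (exchange x \<eta>)) - sqrt (u \<eta>))\<^sup>2) \<le> ?D x" for x
  proof -
    have "2 * \<epsilon>0 * (LINT \<eta>|?\<nu>. (sqrt (u (exchange x \<eta>)) - sqrt (u \<eta>))\<^sup>2) =
        (LINT \<eta>|?\<nu>. \<epsilon>0 * (2 * (sqrt (u (exchange x \<eta>)) - sqrt (u \<eta>))\<^sup>2))"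
      by simp
    also have "\<dots> \<le> ?D x"
    proof (intro integral_mono)
      show "integrable ?\<nu> (\<lambda>\<eta>. \<epsilon>0 * (2 * (sqrt (u (exchange x \<eta>)) - sqrt (u \<eta>))\<^sup>2))"
        unfolding power2_eq_square by (intro integrable_local loc)
      show "integrable ?\<nu> (\<lambda>\<eta>. c (shift x \<eta>) * ((u (exchange x \<eta>) - u \<eta>) * (ln (u (exchange x \<eta>)) - ln (u \<eta>))))"
        by (intro integrable_local loc)
      fix \<eta>
      show "\<epsilon>0 * (2 * (sqrt (u (exchange x \<eta>)) - sqrt (u \<eta>))\<^sup>2) \<le>
          c (shift x \<eta>) * ((u (exchange x \<eta>) - u \<eta>) * (ln (u (exchange x \<eta>)) - ln (u \<eta>)))"
        using \<open>0 < \<epsilon>0\<close> by (intro mult_mono c_ge log_diff_sqrt_bound pos) (auto intro: order.trans[OF _ c_ge])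
    qed
    finally show ?thesis .
  qed
  have "2 * \<epsilon>0 * (\<Sum>x\<in>F. LINT \<eta>|?\<nu>. (sqrt (u (exchange x \<eta>)) - sqrt (u \<eta>))\<^sup>2) \<le>
      2 * \<epsilon>0 * (\<Sum>x\<in>F \<union> G. LINT \<eta>|?\<nu>. (sqrt (u (exchange x \<eta>)) - sqrt (u \<eta>))\<^sup>2)"
    using F G(1) \<open>0 < \<epsilon>0\<close> by (intro mult_left_mono sum_mono2) auto
  also have "\<dots> \<le> (\<Sum>x\<in>F \<union> G. ?D x)"
    unfolding sum_distrib_left by (intro sum_mono D)
  finally show ?thesis using G(2)[of "F \<union> G"] F G(1) by simp
qed

text \<open>Duality is applied twice: to put the generator on \<open>ln u\<close>, and, after the
  pointwise inequality, to put the adjoint on the constant 1.\<close>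

lemma walk_entropy_production:
  assumes r: "\<And>z. z \<in> R \<Longrightarrow> r z \<in> local_functions" "\<And>z \<xi>. z \<in> R \<Longrightarrow> 0 \<le> r z \<xi>"
    and u: "u \<in> local_functions" and pos: "\<And>\<eta>. 0 < u \<eta>"
  shows "(LINT \<eta>|bernoulli_product \<rho>. walk_adjoint R r u \<eta> * ln (u \<eta>)) \<le>
    (LINT \<eta>|bernoulli_product \<rho>. walk_adjoint R r (\<lambda>_. 1) \<eta> * u \<eta>)"
proof -
  let ?\<nu> = "bernoulli_product \<rho>"
  have cu: "continuous_on UNIV u" "continuous_on UNIV (\<lambda>\<eta>. ln (u \<eta>))"
    by (intro local_continuous u local_comp[OF u, of ln])+
  have "(LINT \<eta>|?\<nu>. walk_adjoint R r u \<eta> * ln (u \<eta>)) = (LINT \<eta>|?\<nu>. u \<eta> * walk_generator R r (\<lambda>\<eta>. ln (u \<eta>)) \<eta>)"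
    by (rule walk_adjoint_duality[OF r(1) cu])
  also have "\<dots> \<le> (LINT \<eta>|?\<nu>. walk_generator R r u \<eta>)"
  proof (intro integral_mono integrable_bernoulli continuous_on_mult continuous_walk_generator r cu)
    fix \<xi>
    have "r z \<xi> * (u \<xi> * (ln (u (shift z \<xi>)) - ln (u \<xi>))) \<le> r z \<xi> * (u (shift z \<xi>) - u \<xi>)" if "z \<in> R" for z
    proof (intro mult_left_mono r that)
      have "ln (u (shift z \<xi>) / u \<xi>) \<le> u (shift z \<xi>) / u \<xi> - 1"
        using pos by (intro ln_le_minus_one) auto
      then show "u \<xi> * (ln (u (shift z \<xi>)) - ln (u \<xi>)) \<le> u (shift z \<xi>) - u \<xi>"
        using pos[of \<xi>] pos[of "shift z \<xi>"] by (simp add: ln_div field_simps)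
    qed
    then show "u \<xi> * walk_generator R r (\<lambda>\<eta>. ln (u \<eta>)) \<xi> \<le> walk_generator R r u \<xi>"
      unfolding walk_generator_def sum_distrib_left
      by (intro sum_mono) (simp add: mult.left_commute)
  qed
  also have "\<dots> = (LINT \<eta>|?\<nu>. walk_adjoint R r (\<lambda>_. 1) \<eta> * u \<eta>)"
    using walk_adjoint_duality[OF r(1), where R = R and u = "\<lambda>_. 1" and v = u and \<rho> = \<rho>] cu by simp
  finally show ?thesis .
qed

text \<open>The bonds \<open>F\<close> and the bound \<open>M\<close> are obtained from the walk
  rates and \<open>\<rho>\<close> alone, so the constant can be fixed before \<open>c\<close>,
  \<open>u\<close> and \<open>\<beta>\<close>. The square of \<open>\<beta>\<close> is what later
  offsets the speed of the gas.\<close>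

lemma local_entropy_production:
  assumes "0 < \<epsilon>0"
    and r: "\<And>z. z \<in> R \<Longrightarrow> r z \<in> local_functions" "\<And>z \<xi>. z \<in> R \<Longrightarrow> 0 \<le> r z \<xi>"
  shows "\<exists>C. \<forall>c u \<beta>. interaction_rate \<epsilon>0 c \<longrightarrow> u \<in> local_functions \<longrightarrow> (\<forall>\<eta>. 0 < u \<eta>) \<longrightarrow> 0 \<le> \<beta> \<longrightarrow>
    (LINT \<eta>|bernoulli_product \<rho>. (gas_generator c u \<eta> + \<beta> * walk_adjoint R r u \<eta>) * ln (u \<eta>)) \<le>
      C * \<beta>\<^sup>2 * (LINT \<eta>|bernoulli_product \<rho>. u \<eta>)"
proof -
  let ?\<nu> = "bernoulli_product \<rho>"
  have "exchange_controlled \<rho> (walk_adjoint R r (\<lambda>_. 1))"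
    by (intro exchange_controlled_walk_adjoint_1 r(1))
  then obtain F M where F: "finite F" "0 \<le> M"
    "\<forall>u\<in>local_functions. \<bar>LINT \<eta>|?\<nu>. walk_adjoint R r (\<lambda>_. 1) \<eta> * u \<eta>\<bar> \<le>
       M * (\<Sum>x\<in>F. LINT \<eta>|?\<nu>. \<bar>u (exchange x \<eta>) - u \<eta>\<bar>)"
    unfolding exchange_controlled_def by auto
  have "(LINT \<eta>|?\<nu>. (gas_generator c u \<eta> + \<beta> * walk_adjoint R r u \<eta>) * ln (u \<eta>)) \<le>
      (real (card F) * M\<^sup>2 / \<epsilon>0) * \<beta>\<^sup>2 * (LINT \<eta>|?\<nu>. u \<eta>)"
    if c: "interaction_rate \<epsilon>0 c" and u: "u \<in> local_functions" and pos: "\<And>\<eta>. 0 < u \<eta>" and \<beta>: "0 \<le> \<beta>"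
    for c u \<beta>
  proof -
    have cl: "c \<in> local_functions" using c by (simp add: interaction_rate_def)
    note loc = local_mult local_diff local_add local_comp[OF u, of sqrt] u local_exchange[OF u]
      local_exchange[OF local_comp[OF u, of sqrt]] local_const
    let ?S = "\<lambda>x \<eta>. (sqrt (u (exchange x \<eta>)) - sqrt (u \<eta>))\<^sup>2"
    have cu: "continuous_on UNIV u" "continuous_on UNIV (\<lambda>\<eta>. ln (u \<eta>))"
      by (intro local_continuous u local_comp[OF u, of ln])+
    have bond: "\<beta> * M * (LINT \<eta>|?\<nu>. \<bar>u (exchange x \<eta>) - u \<eta>\<bar>) - \<epsilon>0 * (LINT \<eta>|?\<nu>. ?S x \<eta>) \<le>
        M\<^sup>2 / \<epsilon>0 * \<beta>\<^sup>2 * (LINT \<eta>|?\<nu>. u \<eta>)" for x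
    proof -
      have i1: "integrable ?\<nu> (\<lambda>\<eta>. \<beta> * M * \<bar>u (exchange x \<eta>) - u \<eta>\<bar>)"
        by (intro integrable_local local_mult local_const local_comp[where h=abs] loc)
      have i2: "integrable ?\<nu> (\<lambda>\<eta>. \<epsilon>0 * ?S x \<eta>)"
        unfolding power2_eq_square by (intro integrable_local loc)
      have i3: "integrable ?\<nu> u" "integrable ?\<nu> (\<lambda>\<eta>. u (exchange x \<eta>))"
        by (intro integrable_local loc)+
      have "\<beta> * M * (LINT \<eta>|?\<nu>. \<bar>u (exchange x \<eta>) - u \<eta>\<bar>) - \<epsilon>0 * (LINT \<eta>|?\<nu>. ?S x \<eta>) =
          (LINT \<eta>|?\<nu>. \<beta> * M * \<bar>u (exchange x \<eta>) - u \<eta>\<bar> - \<epsilon>0 * ?S x \<eta>)"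
        using Bochner_Integration.integral_diff[OF i1 i2] by simp
      also have "\<dots> \<le> (LINT \<eta>|?\<nu>. (\<beta>\<^sup>2 * M\<^sup>2 / (2 * \<epsilon>0)) * (u (exchange x \<eta>) + u \<eta>))"
      proof (intro integral_mono Bochner_Integration.integrable_diff i1 i2 integrable_mult_right
          Bochner_Integration.integrable_add i3)
        fix \<eta>
        define a b where "a = sqrt (u (exchange x \<eta>))" and "b = sqrt (u \<eta>)"
        have ab: "0 \<le> a" "0 \<le> b" "u (exchange x \<eta>) = a\<^sup>2" "u \<eta> = b\<^sup>2"
          using pos by (auto simp: a_def b_def less_imp_le)
        have "\<bar>a\<^sup>2 - b\<^sup>2\<bar> = \<bar>a - b\<bar> * (a + b)"
          using ab by (simp add: power2_eq_square square_diff_square_factored abs_mult)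
        \<comment> \<open>Young's inequality for \<open>\<bar>a - b\<bar>\<close> and
          \<open>a + b\<close>, weighted so that the term in \<open>a - b\<close> is exactly the
          Dirichlet term supplied by the gas.\<close>
        moreover have "0 \<le> (\<epsilon>0 * \<bar>a - b\<bar> - \<beta> * M * (a + b) / 2)\<^sup>2" by simp
        then have "\<beta> * M * (\<bar>a - b\<bar> * (a + b)) \<le> \<epsilon>0 * (a - b)\<^sup>2 + (\<beta>\<^sup>2 * M\<^sup>2 / (4 * \<epsilon>0)) * (a + b)\<^sup>2"
          using \<open>0 < \<epsilon>0\<close> by (simp add: power2_diff power_mult_distrib field_simps power2_eq_square)
        moreover have "(\<beta>\<^sup>2 * M\<^sup>2 / (4 * \<epsilon>0)) * (a + b)\<^sup>2 \<le> (\<beta>\<^sup>2 * M\<^sup>2 / (4 * \<epsilon>0)) * (2 * (a\<^sup>2 + b\<^sup>2))"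
        proof (intro mult_left_mono)
          show "(a + b)\<^sup>2 \<le> 2 * (a\<^sup>2 + b\<^sup>2)"
            using zero_le_power2[of "a - b"] by (simp add: power2_sum power2_diff)
        qed (use \<open>0 < \<epsilon>0\<close> in auto)
        moreover have "(\<beta>\<^sup>2 * M\<^sup>2 / (4 * \<epsilon>0)) * (2 * (a\<^sup>2 + b\<^sup>2)) = (\<beta>\<^sup>2 * M\<^sup>2 / (2 * \<epsilon>0)) * (a\<^sup>2 + b\<^sup>2)"
          using \<open>0 < \<epsilon>0\<close> by (simp add: field_simps)
        ultimately have "\<beta> * M * \<bar>a\<^sup>2 - b\<^sup>2\<bar> - \<epsilon>0 * (a - b)\<^sup>2 \<le> (\<beta>\<^sup>2 * M\<^sup>2 / (2 * \<epsilon>0)) * (a\<^sup>2 + b\<^sup>2)"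
          by (smt (verit))
        then show "\<beta> * M * \<bar>u (exchange x \<eta>) - u \<eta>\<bar> - \<epsilon>0 * ?S x \<eta> \<le>
            (\<beta>\<^sup>2 * M\<^sup>2 / (2 * \<epsilon>0)) * (u (exchange x \<eta>) + u \<eta>)"
          unfolding a_def[symmetric] b_def[symmetric] ab(3,4) using ab(1,2) by simp
      qed
      also have "\<dots> = (\<beta>\<^sup>2 * M\<^sup>2 / (2 * \<epsilon>0)) * (2 * (LINT \<eta>|?\<nu>. u \<eta>))"
        using i3 by (simp add: bernoulli_exchange[OF cu(1)])
      also have "\<dots> = M\<^sup>2 / \<epsilon>0 * \<beta>\<^sup>2 * (LINT \<eta>|?\<nu>. u \<eta>)" by simp
      finally show ?thesis .
    qed
    have ig: "integrable ?\<nu> (\<lambda>\<eta>. gas_generator c u \<eta> * ln (u \<eta>))"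
      by (intro integrable_local local_mult local_gas_generator cl u local_comp[OF u, of ln])
    have iw: "integrable ?\<nu> (\<lambda>\<eta>. walk_adjoint R r u \<eta> * ln (u \<eta>))"
      by (intro integrable_bernoulli continuous_on_mult continuous_walk_adjoint r cu)
    have "(LINT \<eta>|?\<nu>. (gas_generator c u \<eta> + \<beta> * walk_adjoint R r u \<eta>) * ln (u \<eta>)) =
        (LINT \<eta>|?\<nu>. gas_generator c u \<eta> * ln (u \<eta>)) + \<beta> * (LINT \<eta>|?\<nu>. walk_adjoint R r u \<eta> * ln (u \<eta>))"
      using ig iw by (simp add: distrib_right mult.assoc)
    also have "\<dots> \<le> - \<epsilon>0 * (\<Sum>x\<in>F. LINT \<eta>|?\<nu>. ?S x \<eta>) + \<beta> * (M * (\<Sum>x\<in>F. LINT \<eta>|?\<nu>. \<bar>u (exchange x \<eta>) - u \<eta>\<bar>))"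
    proof (intro add_mono mult_left_mono \<beta>)
      show "(LINT \<eta>|?\<nu>. gas_generator c u \<eta> * ln (u \<eta>)) \<le> - \<epsilon>0 * (\<Sum>x\<in>F. LINT \<eta>|?\<nu>. ?S x \<eta>)"
        using gas_entropy_production[OF c \<open>0 < \<epsilon>0\<close> u pos F(1)] .
      show "(LINT \<eta>|?\<nu>. walk_adjoint R r u \<eta> * ln (u \<eta>)) \<le> M * (\<Sum>x\<in>F. LINT \<eta>|?\<nu>. \<bar>u (exchange x \<eta>) - u \<eta>\<bar>)"
        using walk_entropy_production[OF r u pos, where \<rho> = \<rho>] F(3) u by fastforce
    qed
    also have "\<dots> = (\<Sum>x\<in>F. \<beta> * M * (LINT \<eta>|?\<nu>. \<bar>u (exchange x \<eta>) - u \<eta>\<bar>) - \<epsilon>0 * (LINT \<eta>|?\<nu>. ?S x \<eta>))"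
      by (simp add: sum_subtractf sum_distrib_left sum_negf mult.assoc)
    also have "\<dots> \<le> (\<Sum>x\<in>F. M\<^sup>2 / \<epsilon>0 * \<beta>\<^sup>2 * (LINT \<eta>|?\<nu>. u \<eta>))"
      by (intro sum_mono bond)
    finally show ?thesis by (simp add: mult.assoc)
  qed
  then show ?thesis
    by (intro exI[of _ "real (card F) * M\<^sup>2 / \<epsilon>0"] allI impI) simp
qed

section \<open>Feller semigroups as contraction semigroups\<close>

lemma C0_bcontfun: "f \<in> C0 \<Longrightarrow> f \<in> bcontfun"
proof -
  assume f: "f \<in> C0"
  then have cont: "continuous_on UNIV f" by (simp add: C0_def)
  obtain K where K: "compact K" "\<And>x. x \<notin> K \<Longrightarrow> \<bar>f x\<bar> < 1"
    using f unfolding C0_def by (auto dest!: spec[of _ 1])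
  have "compact (f ` K)"
    using cont K(1) by (auto intro: compact_continuous_image continuous_on_subset)
  then obtain b where b: "\<forall>x\<in>K. \<bar>f x\<bar> \<le> b"
    by (auto dest!: compact_imp_bounded simp: bounded_iff)
  show ?thesis
  proof (rule bcontfun_normI[OF cont])
    fix x show "norm (f x) \<le> max b 1"
      using b K(2)[of x] by (cases "x \<in> K") (auto simp: le_max_iff_disj)
  qed
qed

lemma C0_comparison:
  assumes "f \<in> C0" "continuous_on UNIV g" "\<And>x. \<bar>g x\<bar> \<le> a * \<bar>f x\<bar>"
  shows "g \<in> C0"
proof -
  have "\<exists>K. compact K \<and> (\<forall>x. x \<notin> K \<longrightarrow> \<bar>g x\<bar> < e)" if "e > 0" for e
  proof -
    have "e / (\<bar>a\<bar> + 1) > 0" using that by auto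
    then obtain K where K: "compact K" "\<forall>x. x \<notin> K \<longrightarrow> \<bar>f x\<bar> < e / (\<bar>a\<bar> + 1)"
      using assms(1) unfolding C0_def by blast
    have "\<bar>g x\<bar> < e" if "x \<notin> K" for x
    proof -
      have "\<bar>g x\<bar> \<le> (\<bar>a\<bar> + 1) * \<bar>f x\<bar>"
        using assms(3)[of x] mult_right_mono[of a "\<bar>a\<bar> + 1" "\<bar>f x\<bar>"] abs_ge_self[of a] by simp
      also have "\<dots> < e"
        using K(2) that by (simp add: field_simps)
      finally show ?thesis .
    qed
    then show ?thesis using K(1) by blast
  qed
  then show ?thesis using assms(2) by (simp add: C0_def)
qed

lemma C0_scale: "f \<in> C0 \<Longrightarrow> (\<lambda>x. a * f x) \<in> C0"
  by (rule C0_comparison[of f _ "\<bar>a\<bar>"]) (auto simp: C0_def abs_mult intro!: continuous_intros)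

lemma C0_add:
  assumes "f \<in> C0" "g \<in> C0"
  shows "(\<lambda>x. f x + g x) \<in> C0"
proof -
  have "\<exists>K. compact K \<and> (\<forall>x. x \<notin> K \<longrightarrow> \<bar>f x + g x\<bar> < e)" if "e > 0" for e
  proof -
    have "e / 2 > 0" using that by simp
    obtain K where K: "compact K" "\<forall>x. x \<notin> K \<longrightarrow> \<bar>f x\<bar> < e / 2"
      using assms(1) \<open>e / 2 > 0\<close> unfolding C0_def by blast
    obtain L where L: "compact L" "\<forall>x. x \<notin> L \<longrightarrow> \<bar>g x\<bar> < e / 2"
      using assms(2) \<open>e / 2 > 0\<close> unfolding C0_def by blast
    have "\<bar>f x + g x\<bar> < e" if "x \<notin> K \<union> L" for x
      using K(2)[rule_format, of x] L(2)[rule_format, of x] that by auto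
    then show ?thesis using compact_Un[OF K(1) L(1)] by blast
  qed
  then show ?thesis using assms by (auto simp: C0_def intro!: continuous_intros)
qed

lemma apply_Bcontfun_C0: "f \<in> C0 \<Longrightarrow> apply_bcontfun (Bcontfun f) = f"
  by (rule Bcontfun_inverse[OF C0_bcontfun])

context
  fixes S :: "real \<Rightarrow> ('a::topological_space \<Rightarrow> real) \<Rightarrow> 'a \<Rightarrow> real"
  assumes S: "feller_semigroup S"
begin

lemma feller_C0: "0 \<le> t \<Longrightarrow> f \<in> C0 \<Longrightarrow> S t f \<in> C0"
  using S by (simp add: feller_semigroup_def)

lemma feller_linear:
  "0 \<le> t \<Longrightarrow> f \<in> C0 \<Longrightarrow> g \<in> C0 \<Longrightarrow> S t (\<lambda>x. a * f x + b * g x) = (\<lambda>x. a * S t f x + b * S t g x)"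
  using S by (simp add: feller_semigroup_def)

lemma feller_scale: "0 \<le> t \<Longrightarrow> f \<in> C0 \<Longrightarrow> S t (\<lambda>x. a * f x) = (\<lambda>x. a * S t f x)"
  using feller_linear[of t f f a 0] by simp

lemma feller_add: "0 \<le> t \<Longrightarrow> f \<in> C0 \<Longrightarrow> g \<in> C0 \<Longrightarrow> S t (\<lambda>x. f x + g x) = (\<lambda>x. S t f x + S t g x)"
  using feller_linear[of t f g 1 1] by simp

text \<open>The definition bounds only functions with values in [0, 1], so \<open>f\<close> is
  rescaled by \<open>b + e\<close>; the extra \<open>e\<close> keeps the scale positive when
  \<open>b = 0\<close>.\<close>

lemma feller_bounds:
  assumes "0 \<le> t" "f \<in> C0" "\<And>x. 0 \<le> f x" "\<And>x. f x \<le> b"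
  shows "0 \<le> S t f x" "S t f x \<le> b"
proof -
  have *: "0 \<le> S t f x \<and> S t f x \<le> b + e" if "e > 0" for e
  proof -
    have b0: "0 \<le> b" using assms(3,4) order.trans by blast
    define a where "a = inverse (b + e)"
    have a: "0 < a" "a * (b + e) = 1" using that b0 by (auto simp: a_def)
    have "0 \<le> a * f x \<and> a * f x \<le> 1" for x
    proof
      show "0 \<le> a * f x" using a(1) assms(3) by simp
      have "a * f x \<le> a * (b + e)"
        using a(1) assms(4)[of x] that by (intro mult_left_mono) auto
      then show "a * f x \<le> 1" using a(2) by simp
    qed
    then have "0 \<le> S t (\<lambda>x. a * f x) x \<and> S t (\<lambda>x. a * f x) x \<le> 1"
      using S assms(1) C0_scale[OF assms(2), of a] by (simp add: feller_semigroup_def)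
    then have "0 \<le> a * S t f x" "a * S t f x \<le> a * (b + e)"
      using a by (simp_all add: feller_scale[OF assms(1,2)])
    then show ?thesis using a(1) by (simp add: zero_le_mult_iff)
  qed
  show "0 \<le> S t f x" using *[of 1] by simp
  show "S t f x \<le> b" by (rule field_le_epsilon) (use * in blast)
qed

lemma feller_abs_bound:
  assumes "0 \<le> t" "f \<in> C0" "\<And>x. \<bar>f x\<bar> \<le> b"
  shows "\<bar>S t f x\<bar> \<le> b"
proof -
  define p q where "p = (\<lambda>x. max (f x) 0)" and "q = (\<lambda>x. max (- f x) 0)"
  have cont: "continuous_on UNIV f" using assms(2) by (simp add: C0_def)
  have pq: "p \<in> C0" "q \<in> C0"
    unfolding p_def q_def
    by (rule C0_comparison[OF assms(2), of _ 1]; auto intro!: continuous_intros cont)+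
  have "S t (\<lambda>x. p x + - 1 * q x) = (\<lambda>x. S t p x + - 1 * S t q x)"
    using feller_linear[OF assms(1) pq, of 1 "- 1"] by simp
  moreover have "(\<lambda>x. p x + - 1 * q x) = f"
    by (auto simp: p_def q_def max_def)
  ultimately have eq: "S t f x = S t p x - S t q x" by simp
  have b: "p x \<le> b" "q x \<le> b" for x
    using assms(3)[of x] by (auto simp: p_def q_def)
  have "0 \<le> S t p x" "S t p x \<le> b" "0 \<le> S t q x" "S t q x \<le> b"
    using feller_bounds[OF assms(1) pq(1) _ b(1)] feller_bounds[OF assms(1) pq(2) _ b(2)]
    by (auto simp: p_def q_def)
  then show ?thesis using eq by auto
qed

abbreviation feller_lift :: "real \<Rightarrow> ('a \<Rightarrow>\<^sub>C real) \<Rightarrow> 'a \<Rightarrow>\<^sub>C real" where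
  "feller_lift t \<phi> \<equiv> Bcontfun (S t (apply_bcontfun \<phi>))"

lemma apply_feller_lift: "0 \<le> t \<Longrightarrow> apply_bcontfun \<phi> \<in> C0 \<Longrightarrow> apply_bcontfun (feller_lift t \<phi>) = S t \<phi>"
  by (rule apply_Bcontfun_C0[OF feller_C0])

lemma contraction_semigroup_feller:
  "contraction_semigroup {\<phi>. apply_bcontfun \<phi> \<in> C0} feller_lift"
proof
  have zero: "(\<lambda>_. 0 :: real) \<in> (C0 :: ('a \<Rightarrow> real) set)"
    by (auto simp: C0_def intro!: exI[of _ "{}"])
  show "subspace {\<phi> :: 'a \<Rightarrow>\<^sub>C real. apply_bcontfun \<phi> \<in> C0}"
  proof (rule subspaceI)
    show "0 \<in> {\<phi> :: 'a \<Rightarrow>\<^sub>C real. apply_bcontfun \<phi> \<in> C0}" using zero by (simp add: zero_bcontfun.rep_eq[abs_def])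
  qed (auto simp: plus_bcontfun.rep_eq[abs_def] scaleR_bcontfun.rep_eq[abs_def] intro: C0_add C0_scale)
next
  fix t :: real and \<phi> :: "'a \<Rightarrow>\<^sub>C real" assume "0 \<le> t" "\<phi> \<in> {\<phi>. apply_bcontfun \<phi> \<in> C0}"
  then show "feller_lift t \<phi> \<in> {\<phi>. apply_bcontfun \<phi> \<in> C0}"
    by (simp add: apply_feller_lift feller_C0)
next
  fix t :: real and \<phi> \<psi> :: "'a \<Rightarrow>\<^sub>C real" assume *: "0 \<le> t" "\<phi> \<in> {\<phi>. apply_bcontfun \<phi> \<in> C0}" "\<psi> \<in> {\<phi>. apply_bcontfun \<phi> \<in> C0}"
  have "apply_bcontfun (feller_lift t (\<phi> + \<psi>)) x = apply_bcontfun (feller_lift t \<phi> + feller_lift t \<psi>) x" for x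
    using * by (simp add: apply_feller_lift apply_Bcontfun_C0 feller_C0 C0_add feller_add plus_bcontfun.rep_eq[abs_def])
  then show "feller_lift t (\<phi> + \<psi>) = feller_lift t \<phi> + feller_lift t \<psi>"
    by (rule bcontfun_eqI)
next
  fix t a :: real and \<phi> :: "'a \<Rightarrow>\<^sub>C real" assume *: "0 \<le> t" "\<phi> \<in> {\<phi>. apply_bcontfun \<phi> \<in> C0}"
  have "apply_bcontfun (feller_lift t (a *\<^sub>R \<phi>)) x = apply_bcontfun (a *\<^sub>R feller_lift t \<phi>) x" for x
    using * by (simp add: apply_feller_lift apply_Bcontfun_C0 feller_C0 C0_scale feller_scale scaleR_bcontfun.rep_eq[abs_def])
  then show "feller_lift t (a *\<^sub>R \<phi>) = a *\<^sub>R feller_lift t \<phi>"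
    by (rule bcontfun_eqI)
next
  fix t :: real and \<phi> :: "'a \<Rightarrow>\<^sub>C real" assume *: "0 \<le> t" "\<phi> \<in> {\<phi>. apply_bcontfun \<phi> \<in> C0}"
  show "norm (feller_lift t \<phi>) \<le> norm \<phi>"
  proof (rule norm_bound)
    fix x
    have "\<bar>\<phi> x\<bar> \<le> norm \<phi>" for x using norm_bounded[of \<phi> x] by simp
    then show "norm (apply_bcontfun (feller_lift t \<phi>) x) \<le> norm \<phi>"
      using * by (simp add: apply_feller_lift feller_abs_bound)
  qed
next
  fix \<phi> :: "'a \<Rightarrow>\<^sub>C real" assume "\<phi> \<in> {\<phi>. apply_bcontfun \<phi> \<in> C0}"
  then show "feller_lift 0 \<phi> = \<phi>"
    using S by (simp add: feller_semigroup_def apply_bcontfun_inverse)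
next
  fix s t :: real and \<phi> :: "'a \<Rightarrow>\<^sub>C real" assume "0 \<le> s" "0 \<le> t" "\<phi> \<in> {\<phi>. apply_bcontfun \<phi> \<in> C0}"
  then show "feller_lift (s + t) \<phi> = feller_lift s (feller_lift t \<phi>)"
    using S by (simp add: feller_semigroup_def apply_feller_lift)
next
  fix \<phi> :: "'a \<Rightarrow>\<^sub>C real" assume *: "\<phi> \<in> {\<phi>. apply_bcontfun \<phi> \<in> C0}"
  have "uniform_limit UNIV (\<lambda>t. S t \<phi>) \<phi> (at_right 0)"
    using S * by (simp add: feller_semigroup_def)
  moreover have "\<forall>\<^sub>F t in at_right 0. \<forall>x\<in>UNIV. S t \<phi> x = feller_lift t \<phi> x"
    using * by (auto simp: eventually_at_filter apply_feller_lift)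
  ultimately have "uniform_limit UNIV (\<lambda>t. feller_lift t \<phi>) \<phi> (at_right 0)"
    by (subst uniform_limit_cong) (auto elim: eventually_mono)
  then show "((\<lambda>t. feller_lift t \<phi>) \<longlongrightarrow> \<phi>) (at_right 0)"
    by (rule uniform_limit_tendsto_bcontfun)
qed

lemma feller_generator_iff:
  "(\<phi>, \<psi>) \<in> contraction_semigroup.generator {\<phi>. apply_bcontfun \<phi> \<in> C0} feller_lift \<longleftrightarrow>
   (apply_bcontfun \<phi>, apply_bcontfun \<psi>) \<in> generator_graph S"
proof -
  have "((\<lambda>t. (feller_lift t \<phi> - \<phi>) /\<^sub>R t) \<longlongrightarrow> \<psi>) (at_right 0) \<longleftrightarrow>
      uniform_limit UNIV (\<lambda>t x. (S t \<phi> x - \<phi> x) / t) \<psi> (at_right 0)"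
    if \<phi>: "apply_bcontfun \<phi> \<in> C0"
  proof -
    have ev: "\<forall>\<^sub>F t in at_right 0. \<forall>x\<in>UNIV. ((feller_lift t \<phi> - \<phi>) /\<^sub>R t) x = (S t \<phi> x - \<phi> x) / t"
      using \<phi> by (auto simp: eventually_at_filter apply_feller_lift divide_inverse mult.commute)
    have "((\<lambda>t. (feller_lift t \<phi> - \<phi>) /\<^sub>R t) \<longlongrightarrow> \<psi>) (at_right 0) \<longleftrightarrow>
        uniform_limit UNIV (\<lambda>t. (feller_lift t \<phi> - \<phi>) /\<^sub>R t) \<psi> (at_right 0)"
      by (rule iffI[OF tendsto_bcontfun_uniform_limit uniform_limit_tendsto_bcontfun])
    also have "\<dots> \<longleftrightarrow> uniform_limit UNIV (\<lambda>t x. (S t \<phi> x - \<phi> x) / t) \<psi> (at_right 0)"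
      by (rule uniform_limit_cong[OF ev]) simp
    finally show ?thesis .
  qed
  then show ?thesis
    unfolding contraction_semigroup.generator_def[OF contraction_semigroup_feller] generator_graph_def
    by auto
qed

end

section \<open>Forward and backward equations\<close>

text \<open>The closed gas generator as a graph in the Banach space of bounded continuous functions;
  for the Feller semigroup of the gas it is the strong generator, so membership expresses that a
  solution stays in the domain.\<close>

definition gas_closure :: "(config \<Rightarrow> real) \<Rightarrow> ((config \<Rightarrow>\<^sub>C real) \<times> (config \<Rightarrow>\<^sub>C real)) set" where
  "gas_closure c = {(u, v). (apply_bcontfun u, apply_bcontfun v) \<in>
     graph_closure local_functions (gas_generator c)}"

definition walk_op :: "int set \<Rightarrow> (int \<Rightarrow> config \<Rightarrow> real) \<Rightarrow> (config \<Rightarrow>\<^sub>C real) \<Rightarrow> config \<Rightarrow>\<^sub>C real" where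
  "walk_op R r u = Bcontfun (walk_generator R r u)"

definition walk_adjoint_op :: "int set \<Rightarrow> (int \<Rightarrow> config \<Rightarrow> real) \<Rightarrow> (config \<Rightarrow>\<^sub>C real) \<Rightarrow> config \<Rightarrow>\<^sub>C real" where
  "walk_adjoint_op R r u = Bcontfun (walk_adjoint R r u)"

definition pairing :: "real \<Rightarrow> (config \<Rightarrow>\<^sub>C real) \<Rightarrow> (config \<Rightarrow>\<^sub>C real) \<Rightarrow> real" where
  "pairing \<rho> u v = (LINT \<eta>|bernoulli_product \<rho>. u \<eta> * v \<eta>)"

lemma local_functions_bounded_family:
  assumes "\<And>z. z \<in> R \<Longrightarrow> r z \<in> local_functions"
  shows "\<exists>C. (\<forall>z\<in>R. \<forall>\<xi>. \<bar>r z \<xi>\<bar> \<le> C z) \<and> (\<forall>z. 0 \<le> C z)"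
proof -
  have "\<forall>z\<in>R. \<exists>M\<ge>0. \<forall>\<xi>. \<bar>r z \<xi>\<bar> \<le> M"
  proof
    fix z assume "z \<in> R"
    from local_bounded[OF assms[OF this]] show "\<exists>M\<ge>0. \<forall>\<xi>. \<bar>r z \<xi>\<bar> \<le> M"
      by metis
  qed
  from bchoice[OF this] obtain C where C: "\<forall>z\<in>R. 0 \<le> C z \<and> (\<forall>\<xi>. \<bar>r z \<xi>\<bar> \<le> C z)"
    by blast
  show ?thesis
    by (rule exI[of _ "\<lambda>z. \<bar>C z\<bar>"]) (use C in auto)
qed

context
  fixes R :: "int set" and r :: "int \<Rightarrow> config \<Rightarrow> real"
  assumes r: "\<And>z. z \<in> R \<Longrightarrow> r z \<in> local_functions"
begin

lemma apply_walk_op [simp]: "apply_bcontfun (walk_op R r u) = walk_generator R r u"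
  unfolding walk_op_def by (intro apply_Bcontfun_config continuous_walk_generator r) auto

lemma apply_walk_adjoint_op [simp]: "apply_bcontfun (walk_adjoint_op R r u) = walk_adjoint R r u"
  unfolding walk_adjoint_op_def by (intro apply_Bcontfun_config continuous_walk_adjoint r) auto

lemma bounded_linear_walk_op: "bounded_linear (walk_op R r)"
proof -
  obtain C where "\<forall>z\<in>R. \<forall>\<xi>. \<bar>r z \<xi>\<bar> \<le> C z" "\<forall>z. 0 \<le> C z"
    using local_functions_bounded_family[where R = R and r = r, OF r] by blast
  note C = this[rule_format]
  show ?thesis
  proof (rule bounded_linear_intro[where K = "\<Sum>z\<in>R. 2 * C z"])
    fix u v :: "config \<Rightarrow>\<^sub>C real" and a :: real
    show "walk_op R r (u + v) = walk_op R r u + walk_op R r v"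
      by (rule bcontfun_eqI) (simp add: walk_generator_def sum.distrib[symmetric] algebra_simps)
    show "walk_op R r (a *\<^sub>R u) = a *\<^sub>R walk_op R r u"
      by (rule bcontfun_eqI) (simp add: walk_generator_def sum_distrib_left algebra_simps)
    show "norm (walk_op R r u) \<le> norm u * (\<Sum>z\<in>R. 2 * C z)"
    proof (rule norm_bound)
      fix \<xi>
      have "\<bar>r z \<xi> * (u (shift z \<xi>) - u \<xi>)\<bar> \<le> norm u * (2 * C z)" if z: "z \<in> R" for z
      proof -
        have "\<bar>u (shift z \<xi>) - u \<xi>\<bar> \<le> 2 * norm u"
          using norm_bounded[of u \<xi>] norm_bounded[of u "shift z \<xi>"] by simp
        then have "\<bar>r z \<xi>\<bar> * \<bar>u (shift z \<xi>) - u \<xi>\<bar> \<le> C z * (2 * norm u)"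
          using C z by (intro mult_mono) auto
        then show ?thesis by (simp add: abs_mult mult.commute mult.left_commute)
      qed
      then have le: "(\<Sum>z\<in>R. \<bar>r z \<xi> * (u (shift z \<xi>) - u \<xi>)\<bar>) \<le> (\<Sum>z\<in>R. norm u * (2 * C z))"
        by (rule sum_mono)
      then show "norm (apply_bcontfun (walk_op R r u) \<xi>) \<le> norm u * (\<Sum>z\<in>R. 2 * C z)"
        using order.trans[OF sum_abs le] by (simp add: walk_generator_def sum_distrib_left)
    qed
  qed
qed

lemma bounded_linear_walk_adjoint_op: "bounded_linear (walk_adjoint_op R r)"
proof -
  obtain C where "\<forall>z\<in>R. \<forall>\<xi>. \<bar>r z \<xi>\<bar> \<le> C z" "\<forall>z. 0 \<le> C z"
    using local_functions_bounded_family[where R = R and r = r, OF r] by blast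
  note C = this[rule_format]
  show ?thesis
  proof (rule bounded_linear_intro[where K = "\<Sum>z\<in>R. 2 * C z"])
    fix u v :: "config \<Rightarrow>\<^sub>C real" and a :: real
    show "walk_adjoint_op R r (u + v) = walk_adjoint_op R r u + walk_adjoint_op R r v"
      by (rule bcontfun_eqI) (simp add: walk_adjoint_def sum.distrib[symmetric] algebra_simps)
    show "walk_adjoint_op R r (a *\<^sub>R u) = a *\<^sub>R walk_adjoint_op R r u"
      by (rule bcontfun_eqI) (simp add: walk_adjoint_def sum_distrib_left algebra_simps)
    show "norm (walk_adjoint_op R r u) \<le> norm u * (\<Sum>z\<in>R. 2 * C z)"
    proof (rule norm_bound)
      fix \<xi>
      have "\<bar>r z (shift (- z) \<xi>) * u (shift (- z) \<xi>) - r z \<xi> * u \<xi>\<bar> \<le> norm u * (2 * C z)" if z: "z \<in> R" for z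
      proof -
        have *: "\<bar>r z \<zeta> * u \<zeta>\<bar> \<le> C z * norm u" for \<zeta>
          unfolding abs_mult using C z norm_bounded[of u \<zeta>] by (intro mult_mono) auto
        show ?thesis using *[of \<xi>] *[of "shift (- z) \<xi>"] by (simp add: algebra_simps)
      qed
      then have le: "(\<Sum>z\<in>R. \<bar>r z (shift (- z) \<xi>) * u (shift (- z) \<xi>) - r z \<xi> * u \<xi>\<bar>) \<le> (\<Sum>z\<in>R. norm u * (2 * C z))"
        by (rule sum_mono)
      then show "norm (apply_bcontfun (walk_adjoint_op R r u) \<xi>) \<le> norm u * (\<Sum>z\<in>R. 2 * C z)"
        using order.trans[OF sum_abs le] by (simp add: walk_adjoint_def sum_distrib_left)
    qed
  qed
qed

lemma pairing_walk_adjoint: "pairing \<rho> (walk_adjoint_op R r u) v = pairing \<rho> u (walk_op R r v)"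
  unfolding pairing_def by (simp add: walk_adjoint_duality[OF r])

end

lemma bounded_bilinear_pairing: "bounded_bilinear (pairing \<rho>)"
proof -
  interpret prob_space "bernoulli_product \<rho>" by (rule prob_space_bernoulli_product)
  have int: "integrable (bernoulli_product \<rho>) (\<lambda>\<eta>. u \<eta> * v \<eta>)" for u v :: "config \<Rightarrow>\<^sub>C real"
    by (intro integrable_bernoulli continuous_on_mult) auto
  show ?thesis
  proof
    fix u u' v v' :: "config \<Rightarrow>\<^sub>C real" and a :: real
    show "pairing \<rho> (u + u') v = pairing \<rho> u v + pairing \<rho> u' v"
      unfolding pairing_def by (simp add: distrib_right int)
    show "pairing \<rho> u (v + v') = pairing \<rho> u v + pairing \<rho> u v'"
      unfolding pairing_def by (simp add: distrib_left int)
    show "pairing \<rho> (a *\<^sub>R u) v = a *\<^sub>R pairing \<rho> u v"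
      unfolding pairing_def by (simp add: mult.assoc)
    show "pairing \<rho> u (a *\<^sub>R v) = a *\<^sub>R pairing \<rho> u v"
      unfolding pairing_def by (simp add: mult.left_commute)
    have "norm (pairing \<rho> u v) \<le> norm u * norm v * 1" for u v
    proof -
      have "\<bar>pairing \<rho> u v\<bar> \<le> (LINT \<eta>|bernoulli_product \<rho>. \<bar>u \<eta> * v \<eta>\<bar>)"
        unfolding pairing_def by (rule integral_abs_bound)
      also have "\<dots> \<le> (LINT \<eta>|bernoulli_product \<rho>. norm u * norm v)"
      proof (intro integral_mono int integrable_abs)
        fix \<eta> show "\<bar>u \<eta> * v \<eta>\<bar> \<le> norm u * norm v"
          unfolding abs_mult using norm_bounded[of u \<eta>] norm_bounded[of v \<eta>] by (intro mult_mono) auto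
      qed simp
      finally show ?thesis using prob_space by simp
    qed
    then show "\<exists>K. \<forall>a b. norm (pairing \<rho> a b) \<le> norm a * norm b * K" by blast
  qed
qed

lemma gas_closureD:
  assumes "(u, v) \<in> gas_closure c" and c: "c \<in> local_functions"
  obtains w where "\<And>k. w k \<in> local_functions"
    "(\<lambda>k. Bcontfun (w k)) \<longlonglongrightarrow> u" "(\<lambda>k. Bcontfun (gas_generator c (w k))) \<longlonglongrightarrow> v"
proof -
  obtain w where w: "\<forall>k. w k \<in> local_functions" "uniform_limit UNIV w u sequentially"
    "uniform_limit UNIV (\<lambda>k. gas_generator c (w k)) v sequentially"
    using assms by (auto simp: gas_closure_def graph_closure_def)
  show ?thesis
  proof (rule that[of w])
    show "(\<lambda>k. Bcontfun (w k)) \<longlonglongrightarrow> u"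
      using w by (intro uniform_limit_tendsto_bcontfun) (simp add: local_continuous)
    show "(\<lambda>k. Bcontfun (gas_generator c (w k))) \<longlonglongrightarrow> v"
      using w by (intro uniform_limit_tendsto_bcontfun) (simp add: local_continuous local_gas_generator c)
  qed (use w in simp)
qed

lemma gas_closureI:
  assumes "u \<in> local_functions" and c: "c \<in> local_functions"
  shows "(Bcontfun u, Bcontfun (gas_generator c u)) \<in> gas_closure c"
  unfolding gas_closure_def graph_closure_def using assms
  by (auto intro!: exI[of _ "\<lambda>_. u"] uniform_limit_const simp: local_continuous local_gas_generator)

lemma gas_closure_scale:
  assumes "(u, v) \<in> gas_closure c" and c: "c \<in> local_functions"
  shows "(a *\<^sub>R u, a *\<^sub>R v) \<in> gas_closure c"
proof -
  obtain w where w: "\<And>k. w k \<in> local_functions"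
    "(\<lambda>k. Bcontfun (w k)) \<longlonglongrightarrow> u" "(\<lambda>k. Bcontfun (gas_generator c (w k))) \<longlonglongrightarrow> v"
    using gas_closureD[OF assms] by blast
  have gen: "gas_generator c (\<lambda>\<eta>. a * w k \<eta>) = (\<lambda>\<eta>. a * gas_generator c (w k) \<eta>)" for k
    unfolding gas_generator_def by (simp add: infsum_cmult_right'[symmetric] algebra_simps)
  have "uniform_limit UNIV (\<lambda>k. a *\<^sub>R Bcontfun (w k)) (a *\<^sub>R u) sequentially"
    by (intro tendsto_bcontfun_uniform_limit tendsto_intros w)
  moreover have "uniform_limit UNIV (\<lambda>k. a *\<^sub>R Bcontfun (gas_generator c (w k))) (a *\<^sub>R v) sequentially"
    by (intro tendsto_bcontfun_uniform_limit tendsto_intros w)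
  ultimately show ?thesis
    unfolding gas_closure_def graph_closure_def using w(1)
    by (auto intro!: exI[of _ "\<lambda>k \<eta>. a * w k \<eta>"] local_mult
        simp: gen scaleR_bcontfun.rep_eq[abs_def] local_continuous local_gas_generator c)
qed

text \<open>Symmetry on local functions survives limits in the graph, because the pairing is
  continuous in both arguments.\<close>

lemma pairing_gas_closure:
  assumes c: "interaction_rate \<epsilon>0 c" and uv: "(u, v) \<in> gas_closure c" and pq: "(p, q) \<in> gas_closure c"
  shows "pairing \<rho> v p = pairing \<rho> u q"
proof -
  have cl: "c \<in> local_functions" using c by (simp add: interaction_rate_def)
  obtain w where w: "\<And>k. w k \<in> local_functions"
    "(\<lambda>k. Bcontfun (w k)) \<longlonglongrightarrow> u" "(\<lambda>k. Bcontfun (gas_generator c (w k))) \<longlonglongrightarrow> v"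
    using gas_closureD[OF uv cl] by blast
  obtain y where y: "\<And>k. y k \<in> local_functions"
    "(\<lambda>k. Bcontfun (y k)) \<longlonglongrightarrow> p" "(\<lambda>k. Bcontfun (gas_generator c (y k))) \<longlonglongrightarrow> q"
    using gas_closureD[OF pq cl] by blast
  have "(\<lambda>k. pairing \<rho> (Bcontfun (gas_generator c (w k))) (Bcontfun (y k))) \<longlonglongrightarrow> pairing \<rho> v p"
    by (intro bounded_bilinear.tendsto[OF bounded_bilinear_pairing] w y)
  moreover have "(\<lambda>k. pairing \<rho> (Bcontfun (w k)) (Bcontfun (gas_generator c (y k)))) \<longlonglongrightarrow> pairing \<rho> u q"
    by (intro bounded_bilinear.tendsto[OF bounded_bilinear_pairing] w y)
  moreover have "pairing \<rho> (Bcontfun (gas_generator c (w k))) (Bcontfun (y k)) =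
      pairing \<rho> (Bcontfun (w k)) (Bcontfun (gas_generator c (y k)))" for k
    using gas_symmetric[OF c w(1) y(1), of \<rho> k k]
    by (simp add: pairing_def local_continuous local_gas_generator cl w y)
  ultimately show ?thesis using LIMSEQ_unique by simp
qed

text \<open>\<open>P\<close> switches the positivity statement on or off. When it is on, the
  derivative of the curve is nonnegative at time 0 and stays so, since the semigroup and
  \<open>B\<close> preserve positivity; hence the curve never falls below its start
  \<open>u\<close>.\<close>

lemma gas_perturbed_curve:
  assumes S: "feller_semigroup S" and gr: "generator_graph S = graph_closure local_functions (gas_generator c)"
    and c: "c \<in> local_functions" and u: "u \<in> local_functions" and B: "bounded_linear B"
    and w_pos: "\<And>\<xi>. P \<Longrightarrow> 0 \<le> gas_generator c u \<xi> + apply_bcontfun (B (Bcontfun u)) \<xi>"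
    and B_pos: "\<And>v \<xi>. P \<Longrightarrow> (\<And>\<xi>. 0 \<le> apply_bcontfun v \<xi>) \<Longrightarrow> 0 \<le> apply_bcontfun (B v) \<xi>"
  obtains f g where "f 0 = Bcontfun u"
    "\<And>t. 0 \<le> t \<Longrightarrow> (f has_vector_derivative g t) (at t within {0..})"
    "\<And>t. 0 \<le> t \<Longrightarrow> (f t, g t - B (f t)) \<in> gas_closure c"
    "\<And>t \<xi>. P \<Longrightarrow> 0 \<le> t \<Longrightarrow> u \<xi> \<le> f t \<xi>"
proof -
  have C0: "{\<phi> :: config \<Rightarrow>\<^sub>C real. apply_bcontfun \<phi> \<in> C0} = UNIV"
    by (auto simp: C0_config)
  define T where "T = feller_lift S"
  interpret banach_contraction_semigroup T
    unfolding banach_contraction_semigroup_def T_def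
    using contraction_semigroup_feller[OF S] unfolding C0 .
  have gen: "generator = gas_closure c"
    using feller_generator_iff[OF S] unfolding C0 T_def[symmetric] gas_closure_def gr by auto
  have apply_T: "apply_bcontfun (T t \<phi>) = S t \<phi>" if "0 \<le> t" for t \<phi>
    unfolding T_def using apply_feller_lift[OF S that, of \<phi>] C0 by auto
  have T_pos: "0 \<le> apply_bcontfun (T t \<phi>) \<xi>" if "0 \<le> t" "\<And>\<xi>. 0 \<le> apply_bcontfun \<phi> \<xi>" for t \<phi> \<xi>
  proof -
    have "apply_bcontfun \<phi> x \<le> norm \<phi>" for x
      using norm_bounded[of \<phi> x] by simp
    then show ?thesis
      unfolding apply_T[OF that(1)] using that
      by (intro feller_bounds(1)[OF S, where b = "norm \<phi>"]) (auto simp: C0_config)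
  qed
  \<comment> \<open>Positivity of a function as positivity of all its point evaluations.\<close>
  define \<Lambda> where "\<Lambda> = (if P then range (\<lambda>\<xi> (v :: config \<Rightarrow>\<^sub>C real). apply_bcontfun v \<xi>) else {})"
  have \<Lambda>: "(\<forall>l\<in>\<Lambda>. 0 \<le> l v) \<longleftrightarrow> (P \<longrightarrow> (\<forall>\<xi>. 0 \<le> apply_bcontfun v \<xi>))" for v
    by (auto simp: \<Lambda>_def)
  have ev: "bounded_linear (\<lambda>v :: config \<Rightarrow>\<^sub>C real. apply_bcontfun v \<xi>)" for \<xi>
  proof (rule bounded_linear_intro[where K = 1])
    fix v :: "config \<Rightarrow>\<^sub>C real"
    show "norm (apply_bcontfun v \<xi>) \<le> norm v * 1"
      using norm_bounded[of v \<xi>] by simp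
  qed auto
  define v0 where "v0 = Bcontfun (gas_generator c u)"
  have uv: "(Bcontfun u, v0) \<in> generator"
    unfolding gen v0_def by (rule gas_closureI[OF u c])
  obtain g where g: "continuous_on {0..} g" "\<And>t l. 0 \<le> t \<Longrightarrow> l \<in> \<Lambda> \<Longrightarrow> 0 \<le> l (g t)"
    "\<And>t. 0 \<le> t \<Longrightarrow> g t = T t (v0 + B (Bcontfun u)) + integral {0..t} (\<lambda>s. T (t - s) (B (g s)))"
  proof (rule mild_solution[OF B, of \<Lambda> "v0 + B (Bcontfun u)"])
    show "bounded_linear l" if "l \<in> \<Lambda>" for l
      using that ev by (auto simp: \<Lambda>_def split: if_splits)
    show "\<forall>l\<in>\<Lambda>. 0 \<le> l (T t x)" if "0 \<le> t" "\<forall>l\<in>\<Lambda>. 0 \<le> l x" for t x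
      using that T_pos unfolding \<Lambda> by blast
    show "\<forall>l\<in>\<Lambda>. 0 \<le> l (B x)" if "\<forall>l\<in>\<Lambda>. 0 \<le> l x" for x
      using that B_pos unfolding \<Lambda> by blast
    show "\<forall>l\<in>\<Lambda>. 0 \<le> l (v0 + B (Bcontfun u))"
      unfolding \<Lambda> using w_pos by (simp add: v0_def local_continuous local_gas_generator c u)
  qed blast
  define f where "f t = Bcontfun u + integral {0..t} g" for t
  have f: "(f has_vector_derivative g t) (at t within {0..})" "(f t, g t - B (f t)) \<in> gas_closure c"
    if "0 \<le> t" for t
    using perturbed_curve[OF B uv g(1) g(3) that] unfolding f_def[symmetric] gen by auto
  have "u \<xi> \<le> f t \<xi>" if P "0 \<le> t" for t \<xi>
  proof -
    have int: "g integrable_on {0..t}"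
      by (intro integrable_continuous_real continuous_on_subset[OF g(1)]) auto
    have "0 \<le> integral {0..t} (\<lambda>s. g s \<xi>)"
      using integrable_linear[OF int ev[of \<xi>]] g(2)[of _ "\<lambda>v. apply_bcontfun v \<xi>"] that
      by (intro integral_nonneg) (auto simp: o_def \<Lambda>_def)
    then show ?thesis
      using integral_linear[OF int ev[of \<xi>]] by (simp add: f_def o_def local_continuous u)
  qed
  with f that[of f g] show ?thesis by (simp add: f_def)
qed

text \<open>The observable \<open>u\<close> evolved by the environment generator in rescaled time.
  No sign information is wanted, so the positivity switch is off.\<close>

lemma backward_curve:
  assumes S: "feller_semigroup S" and gr: "generator_graph S = graph_closure local_functions (gas_generator c)"
    and c: "c \<in> local_functions" and u: "u \<in> local_functions"
    and r: "\<And>z. z \<in> R \<Longrightarrow> r z \<in> local_functions"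
  obtains f g where "f 0 = Bcontfun u"
    "\<And>t. 0 \<le> t \<Longrightarrow> (f has_vector_derivative g t) (at t within {0..})"
    "\<And>t. 0 \<le> t \<Longrightarrow> (f t, g t - \<beta> *\<^sub>R walk_op R r (f t)) \<in> gas_closure c"
proof (rule gas_perturbed_curve[OF S gr c u, of "\<lambda>v. \<beta> *\<^sub>R walk_op R r v" False])
  show "bounded_linear (\<lambda>v. \<beta> *\<^sub>R walk_op R r v)"
    by (rule bounded_linear_const_scaleR[OF bounded_linear_walk_op[OF r]])
qed (use that in auto)

lemma gas_generator_const [simp]: "gas_generator c (\<lambda>_. a) = (\<lambda>_. 0)"
  by (simp add: gas_generator_def fun_eq_iff)

text \<open>The adjoint does not preserve positivity, but adding a constant \<open>K\<close> that
  dominates its loss term makes it do so. The shifted equation started from 1 then stays above 1,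
  and undoing the shift by \<open>exp (- K * t)\<close> leaves this factor as the lower bound
  \<open>\<delta> t\<close>.\<close>

lemma forward_curve:
  assumes S: "feller_semigroup S" and gr: "generator_graph S = graph_closure local_functions (gas_generator c)"
    and c: "c \<in> local_functions"
    and r: "\<And>z. z \<in> R \<Longrightarrow> r z \<in> local_functions" "\<And>z \<xi>. z \<in> R \<Longrightarrow> 0 \<le> r z \<xi>" and \<beta>: "0 \<le> \<beta>"
  obtains f g \<delta> where "f 0 = Bcontfun (\<lambda>_. 1)"
    "\<And>t. 0 \<le> t \<Longrightarrow> (f has_vector_derivative g t) (at t within {0..})"
    "\<And>t. 0 \<le> t \<Longrightarrow> (f t, g t - \<beta> *\<^sub>R walk_adjoint_op R r (f t)) \<in> gas_closure c"
    "\<And>t. 0 < \<delta> t" "\<And>t \<xi>. 0 \<le> t \<Longrightarrow> \<delta> t \<le> f t \<xi>"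
proof -
  obtain C where "\<forall>z\<in>R. \<forall>\<xi>. \<bar>r z \<xi>\<bar> \<le> C z" "\<forall>z. 0 \<le> C z"
    using local_functions_bounded_family[where R = R and r = r, OF r(1)] by blast
  note C = this[rule_format]
  define K where "K = \<beta> * (\<Sum>z\<in>R. C z)"
  define B where "B v = \<beta> *\<^sub>R walk_adjoint_op R r v + K *\<^sub>R v" for v
  have blB: "bounded_linear B"
    unfolding B_def
    by (intro bounded_linear_add bounded_linear_const_scaleR bounded_linear_walk_adjoint_op r(1)
        bounded_linear_ident)
  have B_pos: "0 \<le> apply_bcontfun (B v) \<xi>" if v: "\<And>\<xi>. 0 \<le> apply_bcontfun v \<xi>" for v \<xi>
  proof -
    have "(\<Sum>z\<in>R. - (C z * v \<xi>)) \<le> walk_adjoint R r v \<xi>"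
      unfolding walk_adjoint_def
    proof (rule sum_mono)
      fix z assume z: "z \<in> R"
      have "r z \<xi> * v \<xi> \<le> C z * v \<xi>"
        using C(1)[OF z, of \<xi>] v by (intro mult_right_mono) auto
      moreover have "0 \<le> r z (shift (- z) \<xi>) * v (shift (- z) \<xi>)"
        using r(2)[OF z] v by simp
      ultimately show "- (C z * v \<xi>) \<le> r z (shift (- z) \<xi>) * v (shift (- z) \<xi>) - r z \<xi> * v \<xi>" by simp
    qed
    from mult_left_mono[OF this \<beta>] show ?thesis
      by (simp add: B_def K_def r(1) sum_negf sum_distrib_right mult.assoc)
  qed
  obtain h g where h: "h 0 = Bcontfun (\<lambda>_. 1)"
    "\<And>t. 0 \<le> t \<Longrightarrow> (h has_vector_derivative g t) (at t within {0..})"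
    "\<And>t. 0 \<le> t \<Longrightarrow> (h t, g t - B (h t)) \<in> gas_closure c"
    "\<And>t \<xi>. 0 \<le> t \<Longrightarrow> 1 \<le> h t \<xi>"
  proof (rule gas_perturbed_curve[OF S gr c local_const[of 1] blB, of True])
    show "0 \<le> gas_generator c (\<lambda>_. 1) \<xi> + apply_bcontfun (B (Bcontfun (\<lambda>_. 1))) \<xi>" for \<xi>
      by (simp add: B_pos)
  qed (use B_pos in auto)
  define f where "f t = exp (- K * t) *\<^sub>R h t" for t
  define f' where "f' t = exp (- K * t) *\<^sub>R g t - (K * exp (- K * t)) *\<^sub>R h t" for t
  show ?thesis
  proof (rule that[of f f' "\<lambda>t. exp (- K * t)"])
    show "f 0 = Bcontfun (\<lambda>_. 1)" by (simp add: f_def h)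
    fix t :: real assume t: "0 \<le> t"
    have "((\<lambda>t. exp (- K * t)) has_real_derivative - K * exp (- K * t)) (at t within {0..})"
      by (auto intro!: derivative_eq_intros)
    from has_vector_derivative_scaleR[OF this h(2)[OF t]]
    show "(f has_vector_derivative f' t) (at t within {0..})"
      by (simp add: f_def[abs_def] f'_def)
    have "f' t - \<beta> *\<^sub>R walk_adjoint_op R r (f t) = exp (- K * t) *\<^sub>R (g t - B (h t))"
      by (simp add: f'_def f_def B_def bounded_linear.linear[OF bounded_linear_walk_adjoint_op[OF r(1)]]
          linear_scale algebra_simps)
    then show "(f t, f' t - \<beta> *\<^sub>R walk_adjoint_op R r (f t)) \<in> gas_closure c"
      using gas_closure_scale[OF h(3)[OF t] c] by (simp add: f_def)
    show "exp (- K * t) \<le> f t \<xi>" for \<xi>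
      using h(4)[OF t, of \<xi>] by (simp add: f_def)
  qed auto
qed

text \<open>The pairing of \<open>f s\<close> with \<open>g (t - s)\<close> has derivative 0 in
  \<open>s\<close>, because the gas part is symmetric and the walk parts are adjoint to each other;
  the claim compares the end points.\<close>

lemma forward_backward_pairing:
  assumes c: "interaction_rate \<epsilon>0 c" and r: "\<And>z. z \<in> R \<Longrightarrow> r z \<in> local_functions"
    and f: "\<And>t. 0 \<le> t \<Longrightarrow> (f has_vector_derivative f' t) (at t within {0..})"
      "\<And>t. 0 \<le> t \<Longrightarrow> (f t, f' t - \<beta> *\<^sub>R walk_adjoint_op R r (f t)) \<in> gas_closure c"
    and g: "\<And>t. 0 \<le> t \<Longrightarrow> (g has_vector_derivative g' t) (at t within {0..})"
      "\<And>t. 0 \<le> t \<Longrightarrow> (g t, g' t - \<beta> *\<^sub>R walk_op R r (g t)) \<in> gas_closure c"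
    and t: "0 \<le> t"
  shows "pairing \<rho> (f t) (g 0) = pairing \<rho> (f 0) (g t)"
proof -
  interpret pairing: bounded_bilinear "pairing \<rho>" by (rule bounded_bilinear_pairing)
  have zero: "pairing \<rho> (f' s) (g a) = pairing \<rho> (f s) (g' a)" if "0 \<le> s" "0 \<le> a" for s a
  proof -
    have "pairing \<rho> (f' s - \<beta> *\<^sub>R walk_adjoint_op R r (f s)) (g a) =
        pairing \<rho> (f s) (g' a - \<beta> *\<^sub>R walk_op R r (g a))"
      by (rule pairing_gas_closure[OF c f(2)[OF that(1)] g(2)[OF that(2)]])
    then show ?thesis
      by (simp add: pairing.diff_left pairing.diff_right pairing.scaleR_left pairing.scaleR_right
          pairing_walk_adjoint[OF r])
  qed
  have "((\<lambda>s. pairing \<rho> (f s) (g (t - s))) has_vector_derivative 0) (at s within {0..t})"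
    if s: "s \<in> {0..t}" for s
  proof -
    have "(g has_vector_derivative g' (t - s)) (at (t - s) within (\<lambda>s. t - s) ` {0..t})"
      using s by (intro has_vector_derivative_within_subset[OF g(1)]) auto
    moreover have "((\<lambda>s. t - s) has_vector_derivative - 1) (at s within {0..t})"
      by (auto intro!: derivative_eq_intros)
    ultimately have "((\<lambda>s. g (t - s)) has_vector_derivative - g' (t - s)) (at s within {0..t})"
      by (auto dest: vector_diff_chain_within simp: o_def)
    moreover have "(f has_vector_derivative f' s) (at s within {0..t})"
      using s by (intro has_vector_derivative_within_subset[OF f(1)]) auto
    ultimately have "((\<lambda>s. pairing \<rho> (f s) (g (t - s))) has_vector_derivative
        pairing \<rho> (f s) (- g' (t - s)) + pairing \<rho> (f' s) (g (t - s))) (at s within {0..t})"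
      by (intro pairing.has_vector_derivative)
    then show ?thesis using zero[of s "t - s"] s by (simp add: pairing.minus_right)
  qed
  then obtain k where "\<And>s. s \<in> {0..t} \<Longrightarrow> pairing \<rho> (f s) (g (t - s)) = k"
    using has_vector_derivative_zero_constant[of "{0..t}" "\<lambda>s. pairing \<rho> (f s) (g (t - s))"] by auto
  from this[of 0] this[of t] t show ?thesis by simp
qed

section \<open>The law of the environment process\<close>

text \<open>A product rule. The three error terms come from linearising \<open>G\<close>, from the
  continuity of \<open>T\<close> on \<open>G'\<close>, and from differentiating the orbit of the
  fixed vector \<open>G s\<close>.\<close>

lemma (in contraction_semigroup) curve_has_vector_derivative:
  assumes G: "(G has_vector_derivative G') (at s within {0..t})" "\<And>s. s \<in> {0..t} \<Longrightarrow> G s \<in> V" "G' \<in> V"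
    and gen: "(G s, A) \<in> generator" and s: "s \<in> {0..t}"
  shows "((\<lambda>s. T s (G s)) has_vector_derivative T s (A + G')) (at s within {0..t})"
proof -
  have A: "A \<in> V" using gen by (simp add: generator_def)
  define q1 where "q1 y = norm (G y - G s - (y - s) *\<^sub>R G') / norm (y - s)" for y
  define q2 where "q2 y = norm (T y G' - T s G')" for y
  define q3 where "q3 y = norm (T y (G s) - T s (G s) - (y - s) *\<^sub>R T s A) / norm (y - s)" for y
  have q1: "(q1 \<longlongrightarrow> 0) (at s within {0..t})"
    using G(1) unfolding q1_def by (simp add: has_vector_derivative_def has_derivative_iff_norm)
  have "continuous_on {0..t} (\<lambda>y. T y G')"
    by (intro continuous_on_T continuous_intros) (use G in auto)
  then have q2: "(q2 \<longlongrightarrow> 0) (at s within {0..t})"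
    unfolding q2_def using s by (intro tendsto_norm_zero LIM_zero) (auto simp: continuous_on_def)
  have "((\<lambda>y. T y (G s)) has_vector_derivative T s A) (at s within {0..t})"
    by (rule has_vector_derivative_within_subset[OF generator_has_vector_derivative[OF gen]]) (use s in auto)
  then have q3: "(q3 \<longlongrightarrow> 0) (at s within {0..t})"
    unfolding q3_def by (simp add: has_vector_derivative_def has_derivative_iff_norm)
  have "norm (T y (G y) - T s (G s) - (y - s) *\<^sub>R T s (A + G')) / norm (y - s) \<le> q1 y + q2 y + q3 y"
    if y: "y \<in> {0..t}" "y \<noteq> s" for y
  proof -
    have sc: "(y - s) *\<^sub>R G' \<in> V" using G(3) by (rule subspace_scale[OF sub])
    have 1: "T y (G y - G s - (y - s) *\<^sub>R G') = T y (G y) - T y (G s) - (y - s) *\<^sub>R T y G'"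
      using y s G sc by (simp add: diff scale diff_V)
    have "T y (G y) - T s (G s) - (y - s) *\<^sub>R T s (A + G') =
        T y (G y - G s - (y - s) *\<^sub>R G') + (y - s) *\<^sub>R (T y G' - T s G') +
        (T y (G s) - T s (G s) - (y - s) *\<^sub>R T s A)"
      unfolding 1 using s A G(3) by (simp add: add algebra_simps)
    also have "norm \<dots> \<le> norm (T y (G y - G s - (y - s) *\<^sub>R G')) + norm ((y - s) *\<^sub>R (T y G' - T s G')) +
        norm (T y (G s) - T s (G s) - (y - s) *\<^sub>R T s A)"
      by (intro norm_triangle_mono norm_triangle_ineq order_refl)
    also have "norm (T y (G y - G s - (y - s) *\<^sub>R G')) \<le> norm (G y - G s - (y - s) *\<^sub>R G')"
      using y s G sc by (intro contr diff_V) auto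
    finally have "norm (T y (G y) - T s (G s) - (y - s) *\<^sub>R T s (A + G')) \<le>
        norm (G y - G s - (y - s) *\<^sub>R G') + norm (y - s) * norm (T y G' - T s G') +
        norm (T y (G s) - T s (G s) - (y - s) *\<^sub>R T s A)"
      by simp
    from divide_right_mono[OF this, of "norm (y - s)"] y show ?thesis
      by (simp add: q1_def q2_def q3_def add_divide_distrib)
  qed
  then have ev: "\<forall>\<^sub>F y in at s within {0..t}.
      norm (norm (T y (G y) - T s (G s) - (y - s) *\<^sub>R T s (A + G')) / norm (y - s)) \<le> q1 y + q2 y + q3 y"
    by (auto simp: eventually_at_filter)
  have "((\<lambda>y. q1 y + q2 y + q3 y) \<longlongrightarrow> 0 + 0 + 0) (at s within {0..t})"
    by (intro tendsto_add q1 q2 q3)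
  then have "((\<lambda>y. q1 y + q2 y + q3 y) \<longlongrightarrow> 0) (at s within {0..t})" by simp
  from Lim_null_comparison[OF ev this]
  show ?thesis
    unfolding has_vector_derivative_def has_derivative_iff_norm
    by (auto intro: bounded_linear_scaleR_left)
qed

text \<open>Integrating the Markov property at time 0 removes the conditioning.\<close>

lemma markov_process_expectation:
  assumes "markov_process_generated_by M X D A"
  obtains S where "feller_semigroup S" "generator_graph S = graph_closure D A"
    "\<And>t f. 0 \<le> t \<Longrightarrow> f \<in> C0 \<Longrightarrow> (LINT \<omega>|M. f (X t \<omega>)) = (LINT \<omega>|M. S t f (X 0 \<omega>))"
proof -
  have M: "prob_space M" and X: "\<And>t. 0 \<le> t \<Longrightarrow> X t \<in> borel_measurable M"
    using assms by (auto simp: markov_process_generated_by_def)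
  obtain S where S: "feller_semigroup S" "generator_graph S = graph_closure D A"
    and cond: "\<And>s t f. 0 \<le> s \<Longrightarrow> 0 \<le> t \<Longrightarrow> f \<in> C0 \<Longrightarrow> AE \<omega> in M.
           real_cond_exp M (past M X s) (\<lambda>\<omega>. f (X (s + t) \<omega>)) \<omega> = S t f (X s \<omega>)"
    using assms unfolding markov_process_generated_by_def by blast
  interpret prob_space M by fact
  have "(LINT \<omega>|M. f (X t \<omega>)) = (LINT \<omega>|M. S t f (X 0 \<omega>))" if t: "0 \<le> t" and f: "f \<in> C0" for t f
  proof -
    have sub: "{X u -` B \<inter> space M | u B. 0 \<le> u \<and> u \<le> 0 \<and> B \<in> sets borel} \<subseteq> sets M"
      using X by (auto intro: measurable_sets)
    have "subalgebra M (past M X 0)"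
    proof -
      have pow: "{X u -` B \<inter> space M | u B. 0 \<le> u \<and> u \<le> 0 \<and> B \<in> sets borel} \<subseteq> Pow (space M)"
        by auto
      show ?thesis
        unfolding subalgebra_def past_def sets_measure_of[OF pow] space_measure_of[OF pow]
        using sets.sigma_sets_subset[OF sub] by simp
    qed
    then interpret finite_measure_subalgebra M "past M X 0"
      by unfold_locales
    have fb: "f \<in> borel_measurable borel" using f by (intro borel_measurable_continuous_onI) (simp add: C0_def)
    obtain b where b: "\<And>x. norm (f x) \<le> b"
      using C0_bcontfun[OF f] by (auto simp: bcontfun_def bounded_iff)
    have int: "integrable M (\<lambda>\<omega>. f (X (0 + t) \<omega>))"
      using measurable_compose[OF X[OF t] fb] b by (intro integrable_const_bound[of _ b]) auto
    have Sb: "S t f \<in> borel_measurable borel"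
      using feller_C0[OF S(1) t f] by (intro borel_measurable_continuous_onI) (simp add: C0_def)
    have "(LINT \<omega>|M. f (X t \<omega>)) = (LINT \<omega>|M. real_cond_exp M (past M X 0) (\<lambda>\<omega>. f (X (0 + t) \<omega>)) \<omega>)"
      using real_cond_exp_int(2)[OF int] by simp
    also have "\<dots> = (LINT \<omega>|M. S t f (X 0 \<omega>))"
    proof (rule integral_cong_AE)
      show "AE \<omega> in M. real_cond_exp M (past M X 0) (\<lambda>\<omega>. f (X (0 + t) \<omega>)) \<omega> = S t f (X 0 \<omega>)"
        by (rule cond[OF order_refl t f])
      show "(\<lambda>\<omega>. S t f (X 0 \<omega>)) \<in> borel_measurable M"
        by (rule measurable_compose[OF X[OF order_refl] Sb])
    qed (rule borel_measurable_cond_exp2)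
    finally show ?thesis .
  qed
  with S that show ?thesis by blast
qed

section \<open>Cut-offs in the position of the walk\<close>

lemma continuous_on_prod_int:
  fixes f :: "'a::topological_space \<times> int \<Rightarrow> 'b::topological_space"
  assumes "\<And>x. continuous_on UNIV (\<lambda>\<eta>. f (\<eta>, x))"
  shows "continuous_on UNIV f"
  unfolding continuous_on_open_vimage[OF open_UNIV]
proof (intro allI impI)
  fix B :: "'b set" assume "open B"
  have "f -` B = (\<Union>x. ((\<lambda>\<eta>. f (\<eta>, x)) -` B) \<times> {x})" by auto
  also have "open \<dots>"
    using assms \<open>open B\<close>
    by (intro open_UN ballI open_Times) (auto simp: continuous_on_open_vimage discrete_topology_class.open_discrete)
  finally show "open (f -` B \<inter> UNIV)" by simp
qed

text \<open>Piecewise linear rather than an indicator: the slope 1 / (N + 1) makes the increment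
  over a jump of bounded length uniformly small.\<close>

definition tent :: "nat \<Rightarrow> int \<Rightarrow> real" where
  "tent N x = max 0 (1 - \<bar>real_of_int x\<bar> / real (Suc N))"

lemma abs_tent_le_1: "\<bar>tent N x\<bar> \<le> 1"
  by (auto simp: tent_def)

lemma tent_diff: "\<bar>tent N (x + z) - tent N x\<bar> \<le> \<bar>real_of_int z\<bar> / real (Suc N)"
proof -
  have max_lip: "\<bar>max 0 (1 - a) - max 0 (1 - b)\<bar> \<le> \<bar>a - b\<bar>" for a b :: real
    by (auto simp: max_def abs_if)
  have "\<bar>tent N (x + z) - tent N x\<bar> \<le>
      \<bar>\<bar>real_of_int (x + z)\<bar> / real (Suc N) - \<bar>real_of_int x\<bar> / real (Suc N)\<bar>"
    unfolding tent_def by (rule max_lip)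
  also have "\<dots> = \<bar>\<bar>real_of_int (x + z)\<bar> - \<bar>real_of_int x\<bar>\<bar> / real (Suc N)"
    by (simp add: diff_divide_distrib[symmetric] del: of_nat_Suc of_int_add)
  also have "\<dots> \<le> \<bar>real_of_int z\<bar> / real (Suc N)"
    by (intro divide_right_mono) auto
  finally show ?thesis .
qed

lemma tent_support: "tent N x \<noteq> 0 \<Longrightarrow> x \<in> {- int N..int N}"
proof -
  assume "tent N x \<noteq> 0"
  then have "\<bar>real_of_int x\<bar> / real (Suc N) < 1"
    unfolding tent_def max_def by (auto split: if_splits simp del: of_nat_Suc)
  then have "\<bar>real_of_int x\<bar> < real (Suc N)"
    by (simp add: divide_less_eq del: of_nat_Suc)
  then have "\<bar>x\<bar> < int (Suc N)" by linarith
  then show ?thesis by auto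
qed

lemma tent_tendsto: "(\<lambda>N. tent N x) \<longlonglongrightarrow> 1"
proof -
  have "(\<lambda>N. \<bar>real_of_int x\<bar> / real (Suc N)) \<longlonglongrightarrow> 0"
    by (rule LIMSEQ_Suc[OF lim_const_over_n])
  then have "(\<lambda>N. max 0 (1 - \<bar>real_of_int x\<bar> / real (Suc N))) \<longlonglongrightarrow> max 0 (1 - 0)"
    by (intro tendsto_max tendsto_const tendsto_diff)
  then show ?thesis by (simp add: tent_def)
qed

lemma C0_config_int:
  fixes f :: "config \<times> int \<Rightarrow> real"
  assumes "\<And>x. continuous_on UNIV (\<lambda>\<eta>. f (\<eta>, x))" "finite I" "\<And>\<eta> x. x \<notin> I \<Longrightarrow> f (\<eta>, x) = 0"
  shows "f \<in> C0"
proof -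
  have "compact ((UNIV :: config set) \<times> I)"
    using assms(2) by (intro compact_Times compact_UNIV_config finite_imp_compact)
  moreover have "\<bar>f p\<bar> < e" if "p \<notin> UNIV \<times> I" "0 < e" for p e
    using assms(3)[of "snd p" "fst p"] that by (cases p) auto
  ultimately have "\<forall>e>0. \<exists>K. compact K \<and> (\<forall>p. p \<notin> K \<longrightarrow> \<bar>f p\<bar> < e)" by blast
  then show ?thesis using continuous_on_prod_int[OF assms(1)] by (simp add: C0_def)
qed

definition cut :: "nat \<Rightarrow> (config \<Rightarrow> real) \<Rightarrow> config \<times> int \<Rightarrow> real" where
  "cut N u p = u (shift (snd p) (fst p)) * tent N (snd p)"

text \<open>The part of the walk generator that acts on the tent factor; in the discrete Leibniz
  rule the other factor is then taken at the position after the jump.\<close>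

definition cut_error :: "int set \<Rightarrow> (int \<Rightarrow> config \<Rightarrow> real) \<Rightarrow> nat \<Rightarrow> (config \<Rightarrow> real) \<Rightarrow> config \<times> int \<Rightarrow> real" where
  "cut_error R r N u p = (\<Sum>z\<in>R. r z (shift (snd p) (fst p)) * u (shift (snd p + z) (fst p)) *
     (tent N (snd p + z) - tent N (snd p)))"

lemma cut_C0:
  assumes "continuous_on UNIV u"
  shows "cut N u \<in> C0"
proof (rule C0_config_int[of _ "{- int N..int N}"])
  show "continuous_on UNIV (\<lambda>\<eta>. cut N u (\<eta>, x))" for x
    unfolding cut_def fst_conv snd_conv
    by (intro continuous_on_mult continuous_on_const continuous_on_shift assms)
  show "cut N u (\<eta>, x) = 0" if "x \<notin> {- int N..int N}" for \<eta> x
    using that tent_support[of N x] by (auto simp: cut_def)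
qed simp

lemma cut_error_C0:
  assumes r: "\<And>z. z \<in> R \<Longrightarrow> r z \<in> local_functions" and R: "finite R" and u: "continuous_on UNIV u"
  shows "cut_error R r N u \<in> C0"
proof (rule C0_config_int[of _ "{- int N..int N} \<union> (\<Union>z\<in>R. (\<lambda>x. x - z) ` {- int N..int N})"])
  show "continuous_on UNIV (\<lambda>\<eta>. cut_error R r N u (\<eta>, x))" for x
    unfolding cut_error_def fst_conv snd_conv
    by (intro continuous_on_sum continuous_on_mult continuous_on_const continuous_on_shift u local_continuous r)
  show "cut_error R r N u (\<eta>, x) = 0"
    if x: "x \<notin> {- int N..int N} \<union> (\<Union>z\<in>R. (\<lambda>x. x - z) ` {- int N..int N})" for \<eta> x
  proof -
    have "tent N x = 0" using x tent_support by blast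
    moreover have "tent N (x + z) = 0" if "z \<in> R" for z
    proof (rule ccontr)
      assume "tent N (x + z) \<noteq> 0"
      then have "x + z \<in> {- int N..int N}" by (rule tent_support)
      then have "x \<in> (\<lambda>x. x - z) ` {- int N..int N}" by (intro image_eqI[of _ _ "x + z"]) auto
      then show False using x that by blast
    qed
    ultimately show ?thesis by (simp add: cut_error_def)
  qed
qed (use R in auto)

text \<open>Translation covariance of the gas: relabel the bonds by
  \<open>y = x + a\<close>.\<close>

lemma gas_generator_shift:
  "gas_generator c (\<lambda>\<zeta>. u (shift x \<zeta>)) \<eta> = gas_generator c u (shift x \<eta>)"
proof -
  have "gas_generator c u (shift x \<eta>) =
      (\<Sum>\<^sub>\<infinity>a. c (shift (x + a) \<eta>) * (u (shift x (exchange (x + a) \<eta>)) - u (shift x \<eta>)))"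
    unfolding gas_generator_def by (simp add: exchange_shift add.commute)
  also have "\<dots> = (\<Sum>\<^sub>\<infinity>y. c (shift y \<eta>) * (u (shift x (exchange y \<eta>)) - u (shift x \<eta>)))"
    by (rule infsum_reindex_bij_betw[of "\<lambda>a. x + a" UNIV UNIV]) (rule bij_betwI[of _ _ _ "\<lambda>y. y - x"], auto)
  finally show ?thesis by (simp add: gas_generator_def)
qed

text \<open>At a fixed position the tent factor is a constant for the gas, so the gas part commutes
  with cutting. For the walk part the discrete Leibniz rule leaves \<open>cut_error\<close> as the
  remainder.\<close>

lemma joint_generator_cut:
  assumes "u \<in> local_functions"
  shows "joint_generator c R r n (cut N u) p =
    (real n)\<^sup>2 * cut N (gas_generator c u) p + real n * cut N (walk_generator R r u) p + real n * cut_error R r N u p"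
proof -
  obtain \<eta> x where p: "p = (\<eta>, x)" by (cases p)
  have "gas_generator c (\<lambda>\<zeta>. u (shift x \<zeta>) * tent N x) \<eta> = gas_generator c (\<lambda>\<zeta>. u (shift x \<zeta>)) \<eta> * tent N x"
  proof -
    have "gas_generator c (\<lambda>\<zeta>. u (shift x \<zeta>) * tent N x) \<eta> =
        (\<Sum>\<^sub>\<infinity>y. (c (shift y \<eta>) * (u (shift x (exchange y \<eta>)) - u (shift x \<eta>))) * tent N x)"
      unfolding gas_generator_def by (simp only: left_diff_distrib[symmetric] mult.assoc)
    also have "\<dots> = gas_generator c (\<lambda>\<zeta>. u (shift x \<zeta>)) \<eta> * tent N x"
      unfolding gas_generator_def by (rule infsum_cmult_left')
    finally show ?thesis .
  qed
  then have gas: "gas_generator c (\<lambda>\<zeta>. cut N u (\<zeta>, x)) \<eta> = cut N (gas_generator c u) p"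
    by (simp add: cut_def p gas_generator_shift)
  have walk: "(\<Sum>z\<in>R. r z (shift x \<eta>) * (cut N u (\<eta>, x + z) - cut N u (\<eta>, x))) =
      cut N (walk_generator R r u) p + cut_error R r N u p"
    unfolding cut_def cut_error_def walk_generator_def p fst_conv snd_conv sum_distrib_right
      sum.distrib[symmetric]
    by (intro sum.cong refl) (simp add: algebra_simps)
  show ?thesis
    using gas walk by (simp add: joint_generator_def p distrib_left)
qed

lemma cut_local:
  assumes "u \<in> local_functions"
  shows "cut N u \<in> joint_local_functions"
proof -
  have "finite {x. \<exists>\<eta>. cut N u (\<eta>, x) \<noteq> 0}"
    by (rule finite_subset[of _ "{- int N..int N}"]) (auto simp: cut_def dest: tent_support)
  then show ?thesis
    unfolding joint_local_functions_def
    using local_mult[OF local_shift[OF assms] local_const] by (simp add: cut_def)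
qed

definition cut_op :: "nat \<Rightarrow> (config \<Rightarrow>\<^sub>C real) \<Rightarrow> (config \<times> int) \<Rightarrow>\<^sub>C real" where
  "cut_op N u = Bcontfun (cut N u)"

definition cut_error_op ::
  "int set \<Rightarrow> (int \<Rightarrow> config \<Rightarrow> real) \<Rightarrow> nat \<Rightarrow> (config \<Rightarrow>\<^sub>C real) \<Rightarrow> (config \<times> int) \<Rightarrow>\<^sub>C real" where
  "cut_error_op R r N u = Bcontfun (cut_error R r N u)"

lemma apply_cut_op [simp]: "apply_bcontfun (cut_op N u) = cut N u"
  unfolding cut_op_def by (rule apply_Bcontfun_C0[OF cut_C0]) simp

lemma norm_cut_op: "norm (cut_op N u) \<le> norm u"
proof (rule norm_bound)
  fix p
  have "\<bar>u (shift (snd p) (fst p))\<bar> * \<bar>tent N (snd p)\<bar> \<le> norm u * 1"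
    using norm_bounded[of u "shift (snd p) (fst p)"] abs_tent_le_1 by (intro mult_mono) auto
  then show "norm (apply_bcontfun (cut_op N u) p) \<le> norm u"
    by (simp add: cut_def abs_mult)
qed

lemma bounded_linear_cut_op: "bounded_linear (cut_op N)"
proof (rule bounded_linear_intro[where K = 1])
  fix u v :: "config \<Rightarrow>\<^sub>C real" and a :: real
  show "cut_op N (u + v) = cut_op N u + cut_op N v"
    by (rule bcontfun_eqI) (simp add: cut_def distrib_right)
  show "cut_op N (a *\<^sub>R u) = a *\<^sub>R cut_op N u"
    by (rule bcontfun_eqI) (simp add: cut_def)
  show "norm (cut_op N u) \<le> norm u * 1"
    using norm_cut_op[of N u] by simp
qed

context
  fixes R :: "int set" and r :: "int \<Rightarrow> config \<Rightarrow> real"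
  assumes R: "finite R" and r: "\<And>z. z \<in> R \<Longrightarrow> r z \<in> local_functions"
begin

lemma apply_cut_error_op [simp]: "apply_bcontfun (cut_error_op R r N u) = cut_error R r N u"
  unfolding cut_error_op_def by (rule apply_Bcontfun_C0[OF cut_error_C0[OF r R]]) simp_all

lemma bounded_linear_cut_error_op: "bounded_linear (cut_error_op R r N)"
  and norm_cut_error_op: "\<exists>b\<ge>0. \<forall>N u. norm (cut_error_op R r N u) \<le> norm u * (b / real (Suc N))"
proof -
  obtain C where "\<forall>z\<in>R. \<forall>\<xi>. \<bar>r z \<xi>\<bar> \<le> C z" "\<forall>z. 0 \<le> C z"
    using local_functions_bounded_family[where R = R and r = r, OF r] by blast
  note C = this[rule_format]
  define b where "b = (\<Sum>z\<in>R. C z * \<bar>real_of_int z\<bar>)"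
  have b: "0 \<le> b" unfolding b_def using C by (intro sum_nonneg) auto
  have bound: "norm (cut_error_op R r N u) \<le> norm u * (b / real (Suc N))" for N and u :: "config \<Rightarrow>\<^sub>C real"
  proof (rule norm_bound)
    fix p :: "config \<times> int"
    have "\<bar>r z (shift (snd p) (fst p)) * u (shift (snd p + z) (fst p)) * (tent N (snd p + z) - tent N (snd p))\<bar>
        \<le> norm u * (C z * \<bar>real_of_int z\<bar>) / real (Suc N)" if z: "z \<in> R" for z
    proof -
      have "\<bar>r z (shift (snd p) (fst p))\<bar> * \<bar>u (shift (snd p + z) (fst p))\<bar> * \<bar>tent N (snd p + z) - tent N (snd p)\<bar>
          \<le> C z * norm u * (\<bar>real_of_int z\<bar> / real (Suc N))"
        using C z norm_bounded[of u "shift (snd p + z) (fst p)"]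
        by (intro mult_mono tent_diff) auto
      then show ?thesis by (simp add: abs_mult ac_simps)
    qed
    then have le: "(\<Sum>z\<in>R. \<bar>r z (shift (snd p) (fst p)) * u (shift (snd p + z) (fst p)) * (tent N (snd p + z) - tent N (snd p))\<bar>)
        \<le> (\<Sum>z\<in>R. norm u * (C z * \<bar>real_of_int z\<bar>) / real (Suc N))"
      by (rule sum_mono)
    show "norm (apply_bcontfun (cut_error_op R r N u) p) \<le> norm u * (b / real (Suc N))"
      using order.trans[OF sum_abs le]
      by (simp add: cut_error_def b_def sum_distrib_left sum_divide_distrib)
  qed
  then show "\<exists>b\<ge>0. \<forall>N u. norm (cut_error_op R r N u) \<le> norm u * (b / real (Suc N))"
    using b by blast
  show "bounded_linear (cut_error_op R r N)"
  proof (rule bounded_linear_intro)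
    fix u v :: "config \<Rightarrow>\<^sub>C real" and a :: real
    show "cut_error_op R r N (u + v) = cut_error_op R r N u + cut_error_op R r N v"
      by (rule bcontfun_eqI) (simp add: cut_error_def sum.distrib[symmetric] algebra_simps)
    show "cut_error_op R r N (a *\<^sub>R u) = a *\<^sub>R cut_error_op R r N u"
      by (rule bcontfun_eqI) (simp add: cut_error_def sum_distrib_left algebra_simps)
    show "norm (cut_error_op R r N u) \<le> norm u * (b / real (Suc N))" by (rule bound)
  qed
qed

text \<open>Cutting, the walk operator and the error operator are bounded, so local approximations
  in the graph of the gas become approximations in the graph of the pair.\<close>

lemma cut_closure:
  assumes uv: "(u, v) \<in> gas_closure c" and c: "c \<in> local_functions"
  shows "(apply_bcontfun (cut_op N u), apply_bcontfun ((real n)\<^sup>2 *\<^sub>R cut_op N v +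
      real n *\<^sub>R cut_op N (walk_op R r u) + real n *\<^sub>R cut_error_op R r N u))
    \<in> graph_closure joint_local_functions (joint_generator c R r n)"
proof -
  obtain w where w: "\<And>k. w k \<in> local_functions"
    "(\<lambda>k. Bcontfun (w k)) \<longlonglongrightarrow> u" "(\<lambda>k. Bcontfun (gas_generator c (w k))) \<longlonglongrightarrow> v"
    using gas_closureD[OF uv c] by blast
  note blt = bounded_linear.tendsto[OF bounded_linear_cut_op]
    bounded_linear.tendsto[OF bounded_linear_walk_op[OF r]]
    bounded_linear.tendsto[OF bounded_linear_cut_error_op]
  have 1: "uniform_limit UNIV (\<lambda>k. apply_bcontfun (cut_op N (Bcontfun (w k)))) (cut_op N u) sequentially"
    by (intro tendsto_bcontfun_uniform_limit blt w)
  have 2: "uniform_limit UNIV (\<lambda>k. apply_bcontfun ((real n)\<^sup>2 *\<^sub>R cut_op N (Bcontfun (gas_generator c (w k))) +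
      real n *\<^sub>R cut_op N (walk_op R r (Bcontfun (w k))) + real n *\<^sub>R cut_error_op R r N (Bcontfun (w k))))
      ((real n)\<^sup>2 *\<^sub>R cut_op N v +
      real n *\<^sub>R cut_op N (walk_op R r u) + real n *\<^sub>R cut_error_op R r N u) sequentially"
    by (intro tendsto_bcontfun_uniform_limit tendsto_add tendsto_scaleR tendsto_const blt w)
  have wc: "apply_bcontfun (Bcontfun (w k)) = w k" for k
    by (simp add: local_continuous w(1))
  have gc: "apply_bcontfun (Bcontfun (gas_generator c (w k))) = gas_generator c (w k)" for k
    by (simp add: local_continuous local_gas_generator c w(1))
  have 3: "apply_bcontfun ((real n)\<^sup>2 *\<^sub>R cut_op N (Bcontfun (gas_generator c (w k))) +
      real n *\<^sub>R cut_op N (walk_op R r (Bcontfun (w k))) + real n *\<^sub>R cut_error_op R r N (Bcontfun (w k))) =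
      joint_generator c R r n (cut N (w k))" for k
    by (rule ext) (simp add: joint_generator_cut[OF w(1)] wc gc r)
  show ?thesis
    unfolding graph_closure_def mem_Collect_eq prod.case
    by (rule exI[of _ "\<lambda>k. cut N (w k)"]) (use 1 2 cut_local[OF w(1)] in \<open>simp only: 3 apply_cut_op wc simp_thms\<close>)
qed

end

lemma tendsto_expectation_cut:
  fixes u :: "config \<Rightarrow>\<^sub>C real"
  assumes "prob_space M" and X: "X \<in> borel_measurable M"
  shows "(\<lambda>N. LINT \<omega>|M. cut N u (X \<omega>)) \<longlonglongrightarrow> (LINT \<omega>|M. u (shift (snd (X \<omega>)) (fst (X \<omega>))))"
proof -
  interpret prob_space M by fact
  have c: "continuous_on UNIV (\<lambda>p. u (shift (snd p) (fst p)))"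
    by (rule continuous_on_prod_int) (simp add: continuous_on_shift)
  show ?thesis
  proof (rule integral_dominated_convergence[where w = "\<lambda>_. norm u"])
    show "(\<lambda>\<omega>. u (shift (snd (X \<omega>)) (fst (X \<omega>)))) \<in> borel_measurable M"
      by (rule measurable_compose[OF X borel_measurable_continuous_onI[OF c]])
    show "(\<lambda>\<omega>. cut N u (X \<omega>)) \<in> borel_measurable M" for N
      using cut_C0[of u N]
      by (intro measurable_compose[OF X borel_measurable_continuous_onI]) (simp add: C0_def)
    have "(\<lambda>N. u (shift (snd p) (fst p)) * tent N (snd p)) \<longlonglongrightarrow> u (shift (snd p) (fst p)) * 1" for p
      by (intro tendsto_mult tendsto_const tent_tendsto)
    then show "AE \<omega> in M. (\<lambda>N. cut N u (X \<omega>)) \<longlonglongrightarrow> u (shift (snd (X \<omega>)) (fst (X \<omega>)))"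
      by (simp add: cut_def)
    show "AE \<omega> in M. norm (cut N u (X \<omega>)) \<le> norm u" for N
    proof (rule AE_I2)
      fix \<omega>
      have "norm (apply_bcontfun (cut_op N u) (X \<omega>)) \<le> norm (cut_op N u)" by (rule norm_bounded)
      also have "\<dots> \<le> norm u" by (rule norm_cut_op)
      finally show "norm (cut N u (X \<omega>)) \<le> norm u" by simp
    qed
  qed auto
qed

text \<open>Along the process, the backward solution evaluated at the environment has constant expectation.
  Functions of the environment alone do not vanish at infinity in the position of the walk, so they
  are multiplied by a tent function of width \<open>N\<close>; the error this makes in the generator is of
  order \<open>1 / N\<close>.\<close>

lemma environment_expectation:
  fixes M :: "'w measure"
  assumes c: "c \<in> local_functions" and gas: "lattice_gas \<rho> c M \<eta>" and walk: "walk_on_gas c R r n M \<eta> x"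
    and R: "finite R" and r: "\<And>z. z \<in> R \<Longrightarrow> r z \<in> local_functions" and t: "0 \<le> t"
    and f: "\<And>t. 0 \<le> t \<Longrightarrow> (f has_vector_derivative g t) (at t within {0..})"
      "\<And>t. 0 \<le> t \<Longrightarrow> (f t, g t - (1 / real n) *\<^sub>R walk_op R r (f t)) \<in> gas_closure c"
  shows "(LINT \<omega>|M. f 0 (environment n \<eta> x t \<omega>)) = (LINT \<xi>|bernoulli_product \<rho>. f ((real n)\<^sup>2 * t) \<xi>)"
proof -
  define X where "X t \<omega> = (accelerated n \<eta> t \<omega>, x t \<omega>)" for t \<omega>
  define m where "m = (real n)\<^sup>2"
  \<comment> \<open>At \<open>n = 0\<close> both sides vanish by the convention for division, so no
    case distinction is needed.\<close>
  have mn: "m * (1 / real n) = real n" by (simp add: m_def power2_eq_square)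
  have mark: "markov_process_generated_by M X joint_local_functions (joint_generator c R r n)"
    using walk unfolding walk_on_gas_def X_def by simp
  have M: "prob_space M" and X_meas: "\<And>t. 0 \<le> t \<Longrightarrow> X t \<in> borel_measurable M"
    using mark by (auto simp: markov_process_generated_by_def)
  interpret prob_space M by fact
  obtain S where S: "feller_semigroup S"
    "generator_graph S = graph_closure joint_local_functions (joint_generator c R r n)"
    and ES: "\<And>t f. 0 \<le> t \<Longrightarrow> f \<in> C0 \<Longrightarrow> (LINT \<omega>|M. f (X t \<omega>)) = (LINT \<omega>|M. S t f (X 0 \<omega>))"
    using markov_process_expectation[OF mark] by blast
  define V where "V = {\<phi> :: (config \<times> int) \<Rightarrow>\<^sub>C real. apply_bcontfun \<phi> \<in> C0}"
  define T where "T = feller_lift S"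
  interpret contraction_semigroup V T
    unfolding V_def T_def by (rule contraction_semigroup_feller[OF S(1)])
  have gen_iff: "(\<phi>, \<psi>) \<in> generator \<longleftrightarrow> (apply_bcontfun \<phi>, apply_bcontfun \<psi>) \<in>
      graph_closure joint_local_functions (joint_generator c R r n)" for \<phi> \<psi>
    using feller_generator_iff[OF S(1)] unfolding S(2) V_def T_def .
  \<comment> \<open>Expectation under the initial law; on \<open>T t \<Phi>\<close> with
    \<open>\<Phi>\<close> in \<open>V\<close> it gives the expectation of \<open>\<Phi>\<close> at
    time \<open>t\<close>.\<close>
  define l where "l \<Phi> = (LINT \<omega>|M. apply_bcontfun \<Phi> (X 0 \<omega>))" for \<Phi> :: "(config \<times> int) \<Rightarrow>\<^sub>C real"
  have int: "integrable M (\<lambda>\<omega>. apply_bcontfun \<Phi> (X 0 \<omega>))" for \<Phi> :: "(config \<times> int) \<Rightarrow>\<^sub>C real"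
    using norm_bounded[of \<Phi>]
    by (intro integrable_const_bound[of _ "norm \<Phi>"]
        measurable_compose[OF X_meas[OF order_refl] borel_measurable_continuous_onI]) auto
  have l_bound: "\<bar>l \<Phi>\<bar> \<le> norm \<Phi>" for \<Phi>
  proof -
    have "\<bar>l \<Phi>\<bar> \<le> (LINT \<omega>|M. \<bar>apply_bcontfun \<Phi> (X 0 \<omega>)\<bar>)"
      unfolding l_def by (rule integral_abs_bound)
    also have "\<dots> \<le> (LINT \<omega>|M. norm \<Phi>)"
      using norm_bounded[of \<Phi>] by (intro integral_mono integrable_abs int) auto
    finally show ?thesis by (simp add: prob_space)
  qed
  have bl: "bounded_linear l"
    by (rule bounded_linear_intro[where K = 1]) (use l_bound in \<open>auto simp: l_def int\<close>)
  have cut_V: "cut_op N u \<in> V" for N u by (simp add: V_def cut_C0)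

  have "continuous_on {0..} f"
    unfolding continuous_on_eq_continuous_within
    using has_vector_derivative_continuous[OF f(1)] by simp
  then have "continuous_on {0..m * t} f"
    by (rule continuous_on_subset) auto
  then have "bounded (f ` {0..m * t})"
    by (intro compact_imp_bounded compact_continuous_image) auto
  then obtain B where "\<forall>s\<in>{0..m * t}. norm (f s) \<le> B"
    by (auto simp: bounded_iff)
  note B = this[rule_format]
  obtain b where "0 \<le> b" "\<forall>N u. norm (cut_error_op R r N u) \<le> norm u * (b / real (Suc N))"
    using norm_cut_error_op[where R = R and r = r, OF R r] by blast
  note b = this(1) this(2)[rule_format]
  have diff: "\<bar>(LINT \<omega>|M. cut N (f 0) (X t \<omega>)) - (LINT \<omega>|M. cut N (f (m * t)) (X 0 \<omega>))\<bar>
      \<le> real n * (B * b) * t / real (Suc N)" for N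
  proof -
    \<comment> \<open>\<open>l (T s (G s))\<close> interpolates between the two expectations to be
      compared. In its derivative the generator of the pair and the motion of \<open>f\<close>
      cancel up to the tent error.\<close>
    define G where "G s = cut_op N (f (m * (t - s)))" for s
    have der: "((\<lambda>s. l (T s (G s))) has_real_derivative
        l (T s (real n *\<^sub>R cut_error_op R r N (f (m * (t - s)))))) (at s within {0..t})" if s: "s \<in> {0..t}" for s
    proof -
      have ms: "0 \<le> m * (t - s)" using s by (simp add: m_def)
      have "(f has_vector_derivative g (m * (t - s))) (at (m * (t - s)) within (\<lambda>s. m * (t - s)) ` {0..t})"
        by (rule has_vector_derivative_within_subset[OF f(1)[OF ms]]) (auto simp: m_def)
      moreover have "((\<lambda>s. m * (t - s)) has_vector_derivative - m) (at s within {0..t})"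
        by (auto intro!: derivative_eq_intros simp: has_real_derivative_iff_has_vector_derivative[symmetric])
      ultimately have "((\<lambda>s. f (m * (t - s))) has_vector_derivative - m *\<^sub>R g (m * (t - s))) (at s within {0..t})"
        by (auto dest: vector_diff_chain_within simp: o_def)
      from bounded_linear.has_vector_derivative[OF bounded_linear_cut_op this]
      have dG: "(G has_vector_derivative cut_op N (- m *\<^sub>R g (m * (t - s)))) (at s within {0..t})"
        by (simp add: G_def[abs_def])
      define A where "A = m *\<^sub>R cut_op N (g (m * (t - s)) - (1 / real n) *\<^sub>R walk_op R r (f (m * (t - s)))) +
         real n *\<^sub>R cut_op N (walk_op R r (f (m * (t - s)))) + real n *\<^sub>R cut_error_op R r N (f (m * (t - s)))"
      have gen: "(G s, A) \<in> generator"
        unfolding gen_iff G_def A_def m_def by (rule cut_closure[OF R r f(2)[OF ms[unfolded m_def]] c])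
      have "A + cut_op N (- m *\<^sub>R g (m * (t - s))) = real n *\<^sub>R cut_error_op R r N (f (m * (t - s)))"
        using mn by (simp add: A_def bounded_linear.linear[OF bounded_linear_cut_op] linear_diff linear_scale
            linear_neg scaleR_right_diff_distrib)
      with curve_has_vector_derivative[OF dG _ _ gen s]
      have "((\<lambda>s. T s (G s)) has_vector_derivative T s (real n *\<^sub>R cut_error_op R r N (f (m * (t - s)))))
          (at s within {0..t})"
        by (simp add: G_def cut_V)
      from bounded_linear.has_vector_derivative[OF bl this]
      show ?thesis by (simp add: has_real_derivative_iff_has_vector_derivative)
    qed
    have bound: "norm (l (T s (real n *\<^sub>R cut_error_op R r N (f (m * (t - s)))))) \<le> real n * (B * b) / real (Suc N)"
      if s: "s \<in> {0..t}" for s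
    proof -
      have E: "real n *\<^sub>R cut_error_op R r N u \<in> V" for u
        by (intro subspace_scale[OF sub]) (simp add: V_def R r cut_error_C0)
      have "norm (l (T s (real n *\<^sub>R cut_error_op R r N (f (m * (t - s)))))) \<le>
          norm (real n *\<^sub>R cut_error_op R r N (f (m * (t - s))))"
        using l_bound contr[OF _ E] s by (auto intro: order.trans)
      also have "\<dots> \<le> real n * (norm (f (m * (t - s))) * (b / real (Suc N)))"
        unfolding norm_scaleR abs_of_nat by (intro mult_left_mono b(2)) simp
      also have "\<dots> \<le> real n * (B * (b / real (Suc N)))"
        using s b(1) by (intro mult_left_mono mult_right_mono B) (auto simp: m_def intro: mult_left_mono)
      finally show ?thesis by (simp del: of_nat_Suc)
    qed
    have "norm (l (T t (G t)) - l (T 0 (G 0))) \<le> real n * (B * b) / real (Suc N) * norm (t - 0)"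
      by (rule field_differentiable_bound[OF convex_closed_interval der bound]) (use t in auto)
    moreover have "l (T 0 (G 0)) = (LINT \<omega>|M. cut N (f (m * t)) (X 0 \<omega>))"
      by (simp add: T_0 G_def cut_V l_def)
    moreover have "l (T t (G t)) = (LINT \<omega>|M. cut N (f 0) (X t \<omega>))"
      using ES[OF t cut_C0[of "f 0" N]] apply_feller_lift[OF S(1) t, of "cut_op N (f 0)"]
      by (simp add: l_def G_def T_def cut_C0)
    ultimately show ?thesis using t by (simp del: of_nat_Suc)
  qed
  have "(\<lambda>N. \<bar>(LINT \<omega>|M. cut N (f 0) (X t \<omega>)) - (LINT \<omega>|M. cut N (f (m * t)) (X 0 \<omega>))\<bar>) \<longlonglongrightarrow>
      \<bar>(LINT \<omega>|M. f 0 (shift (snd (X t \<omega>)) (fst (X t \<omega>)))) -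
       (LINT \<omega>|M. f (m * t) (shift (snd (X 0 \<omega>)) (fst (X 0 \<omega>))))\<bar>"
    by (intro tendsto_rabs tendsto_diff tendsto_expectation_cut M X_meas t order_refl)
  moreover have "(\<lambda>N. real n * (B * b) * t / real (Suc N)) \<longlonglongrightarrow> 0"
    by (rule LIMSEQ_Suc[OF lim_const_over_n])
  ultimately have "\<bar>(LINT \<omega>|M. f 0 (shift (snd (X t \<omega>)) (fst (X t \<omega>)))) -
       (LINT \<omega>|M. f (m * t) (shift (snd (X 0 \<omega>)) (fst (X 0 \<omega>))))\<bar> \<le> 0"
    by (rule LIMSEQ_le) (use diff in blast)
  then have "(LINT \<omega>|M. f 0 (environment n \<eta> x t \<omega>)) = (LINT \<omega>|M. f (m * t) (shift (snd (X 0 \<omega>)) (fst (X 0 \<omega>))))"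
    by (simp add: X_def environment_def)
  also have "\<dots> = (LINT \<omega>|M. f (m * t) (\<eta> 0 \<omega>))"
  proof (rule integral_cong_AE)
    have "AE \<omega> in M. x 0 \<omega> = 0" using walk by (simp add: walk_on_gas_def)
    then show "AE \<omega> in M. f (m * t) (shift (snd (X 0 \<omega>)) (fst (X 0 \<omega>))) = f (m * t) (\<eta> 0 \<omega>)"
      by eventually_elim (simp add: X_def accelerated_def)
    have "continuous_on UNIV (\<lambda>p. f (m * t) (shift (snd p) (fst p)))"
      by (rule continuous_on_prod_int) (simp add: continuous_on_shift)
    from measurable_compose[OF X_meas[OF order_refl] borel_measurable_continuous_onI[OF this]]
    show "(\<lambda>\<omega>. f (m * t) (shift (snd (X 0 \<omega>)) (fst (X 0 \<omega>)))) \<in> borel_measurable M" .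
    have "\<eta> 0 \<in> borel_measurable M"
      using gas by (simp add: lattice_gas_def markov_process_generated_by_def)
    then show "(\<lambda>\<omega>. f (m * t) (\<eta> 0 \<omega>)) \<in> borel_measurable M"
      by (rule measurable_compose[OF _ borel_measurable_continuous_onI]) simp
  qed
  also have "\<dots> = (LINT \<xi>|distr M borel (\<eta> 0). f (m * t) \<xi>)"
    using gas by (intro integral_distr[symmetric] borel_measurable_continuous_onI)
      (auto simp: lattice_gas_def markov_process_generated_by_def)
  also have "distr M borel (\<eta> 0) = bernoulli_product \<rho>"
    using gas by (simp add: lattice_gas_def)
  finally show ?thesis by (simp add: m_def)
qed

text \<open>Indicators of finite-dimensional cylinders are local, and these cylinders determine a
  finite measure on the product space.\<close>

lemma measure_eq_density_if_local:
  fixes F :: "config \<Rightarrow> real"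
  assumes P: "prob_space P" "sets P = sets borel" and F: "continuous_on UNIV F" "\<And>\<xi>. 0 \<le> F \<xi>"
    and eq: "\<And>u. u \<in> local_functions \<Longrightarrow> (LINT \<xi>|P. u \<xi>) = (LINT \<xi>|bernoulli_product \<rho>. F \<xi> * u \<xi>)"
  shows "P = density (bernoulli_product \<rho>) (\<lambda>\<xi>. ennreal (F \<xi>))"
proof (rule measure_eqI_PiM_infinite[where I = UNIV and M = "\<lambda>_ :: int. measure_pmf (bernoulli_pmf \<rho>)"])
  interpret P: prob_space P by fact
  show "sets P = sets (\<Pi>\<^sub>M _\<in>(UNIV :: int set). measure_pmf (bernoulli_pmf \<rho>))"
    using P(2) sets_bernoulli_product[of \<rho>] by (simp add: bernoulli_product_def)
  show "sets (density (bernoulli_product \<rho>) (\<lambda>\<xi>. ennreal (F \<xi>))) =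
      sets (\<Pi>\<^sub>M _\<in>(UNIV :: int set). measure_pmf (bernoulli_pmf \<rho>))"
    by (simp add: bernoulli_product_def)
  show "finite_measure P" by unfold_locales
  fix A :: "int \<Rightarrow> bool set" and J :: "int set" assume J: "finite J"
  define C where "C = prod_emb UNIV (\<lambda>_. measure_pmf (bernoulli_pmf \<rho>)) J (Pi\<^sub>E J A)"
  have C: "C = {\<eta>. \<forall>j\<in>J. \<eta> j \<in> A j}"
    by (auto simp: C_def prod_emb_def PiE_def Pi_def extensional_def)
  let ?u = "indicator C :: config \<Rightarrow> real"
  have u: "?u \<in> local_functions"
    by (rule local_functionsI[OF J]) (simp add: C indicator_def)
  have "C = ?u -` {1} \<inter> UNIV" by (auto simp: indicator_def)
  also have "\<dots> \<in> sets borel"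
    using measurable_sets[OF borel_measurable_continuous_onI[OF local_continuous[OF u]], of "{1}"] by simp
  finally have Cb: "C \<in> sets borel" .
  have int: "integrable (bernoulli_product \<rho>) (\<lambda>\<xi>. F \<xi> * ?u \<xi>)"
    by (intro integrable_bernoulli continuous_on_mult F local_continuous u)
  have "space P = UNIV" using sets_eq_imp_space_eq[OF P(2)] by simp
  then have "emeasure P C = ennreal (LINT \<xi>|P. ?u \<xi>)"
    using Cb P(2) by (simp add: P.emeasure_eq_measure)
  also have "\<dots> = ennreal (LINT \<xi>|bernoulli_product \<rho>. F \<xi> * ?u \<xi>)"
    by (simp only: eq[OF u])
  also have "\<dots> = (\<integral>\<^sup>+ \<xi>. ennreal (F \<xi> * ?u \<xi>) \<partial>bernoulli_product \<rho>)"
    by (rule nn_integral_eq_integral[OF int, symmetric]) (simp add: F)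
  also have "\<dots> = (\<integral>\<^sup>+ \<xi>. ennreal (F \<xi>) * indicator C \<xi> \<partial>bernoulli_product \<rho>)"
    by (intro nn_integral_cong) (auto simp: indicator_def)
  also have "\<dots> = emeasure (density (bernoulli_product \<rho>) (\<lambda>\<xi>. ennreal (F \<xi>))) C"
    using Cb borel_measurable_continuous_onI[OF F(1)]
    by (intro emeasure_density[symmetric]) (auto simp: sets_bernoulli_product)
  finally show "emeasure P (prod_emb UNIV (\<lambda>_. measure_pmf (bernoulli_pmf \<rho>)) J (Pi\<^sub>E J A)) =
      emeasure (density (bernoulli_product \<rho>) (\<lambda>\<xi>. ennreal (F \<xi>)))
        (prod_emb UNIV (\<lambda>_. measure_pmf (bernoulli_pmf \<rho>)) J (Pi\<^sub>E J A))"
    unfolding C_def .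
qed

lemma measurable_environment:
  assumes "walk_on_gas c R r n M \<eta> x" "0 \<le> t"
  shows "environment n \<eta> x t \<in> borel_measurable M"
proof -
  have X: "(\<lambda>\<omega>. (accelerated n \<eta> t \<omega>, x t \<omega>)) \<in> borel_measurable M"
    using assms by (simp add: walk_on_gas_def markov_process_generated_by_def)
  have "continuous_on UNIV (\<lambda>p :: config \<times> int. shift (snd p) (fst p))"
    by (rule continuous_on_prod_int)
       (auto simp: shift_def intro!: continuous_on_coordinatewise_then_product)
  from measurable_compose[OF X borel_measurable_continuous_onI[OF this]]
  show ?thesis by (simp add: environment_def[abs_def])
qed

section \<open>Relative entropy of positive continuous densities\<close>

lemma continuous_on_ln_config:
  fixes F :: "config \<Rightarrow> real"
  assumes "continuous_on UNIV F" "\<And>\<xi>. 0 < F \<xi>"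
  shows "continuous_on UNIV (\<lambda>\<xi>. ln (F \<xi>))"
  using assms by (intro continuous_on_ln) (auto simp: less_imp_neq[symmetric])

text \<open>On the compact configuration space \<open>F * ln F\<close> is continuous, hence
  integrable. Uniqueness of the Radon-Nikodym derivative identifies the density in the definition of
  entropy with \<open>F\<close> almost everywhere.\<close>

lemma entropy_density_bernoulli:
  fixes F :: "config \<Rightarrow> real" and \<rho> :: real
  assumes F: "continuous_on UNIV F" "\<And>\<xi>. 0 < F \<xi>"
  defines "P \<equiv> density (bernoulli_product \<rho>) (\<lambda>\<xi>. ennreal (F \<xi>))"
  assumes P: "prob_space P"
  shows "finite_relative_entropy P (bernoulli_product \<rho>)"
    and "relative_entropy P (bernoulli_product \<rho>) = (LINT \<xi>|bernoulli_product \<rho>. F \<xi> * ln (F \<xi>))"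
proof -
  let ?\<nu> = "bernoulli_product \<rho>"
  interpret \<nu>: prob_space ?\<nu> by (rule prob_space_bernoulli_product)
  interpret P: prob_space P by fact
  have Fm: "F \<in> borel_measurable ?\<nu>" using borel_measurable_continuous_onI[OF F(1)] by simp
  have lm: "(\<lambda>\<xi>. ln (F \<xi>)) \<in> borel_measurable ?\<nu>"
    using borel_measurable_continuous_onI[OF continuous_on_ln_config[OF F]] by simp
  have ac: "absolutely_continuous ?\<nu> P"
    unfolding P_def by (intro absolutely_continuousI_density) (use Fm in simp)
  have "relative_entropy P ?\<nu> = (LINT \<xi>|?\<nu>. F \<xi> * log (exp 1) (F \<xi>))"
    unfolding relative_entropy_def P_def
    by (rule \<nu>.KL_density) (use Fm F in \<open>auto simp: less_imp_le\<close>)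
  then show "relative_entropy P ?\<nu> = (LINT \<xi>|?\<nu>. F \<xi> * ln (F \<xi>))" by (simp add: log_def)
  have "AE \<xi> in ?\<nu>. ennreal (F \<xi>) = RN_deriv ?\<nu> P \<xi>"
    by (rule \<nu>.RN_deriv_unique) (use Fm P_def in auto)
  then have "AE \<xi> in ?\<nu>. ln (F \<xi>) = entropy_density (exp 1) ?\<nu> P \<xi>"
  proof eventually_elim
    case (elim \<xi>)
    have "enn2real (RN_deriv ?\<nu> P \<xi>) = F \<xi>"
      using F(2)[of \<xi>] by (simp add: elim[symmetric])
    then show ?case by (simp add: entropy_density_def log_def)
  qed
  then have AE: "AE \<xi> in P. ln (F \<xi>) = entropy_density (exp 1) ?\<nu> P \<xi>"
    unfolding P_def by (subst AE_density) (use Fm in auto)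
  have "integrable P (\<lambda>\<xi>. ln (F \<xi>))"
    unfolding P_def
  proof (subst integrable_density)
    show "integrable ?\<nu> (\<lambda>\<xi>. F \<xi> *\<^sub>R ln (F \<xi>))"
      using integrable_bernoulli[OF continuous_on_mult[OF F(1) continuous_on_ln_config[OF F]]] by simp
  qed (use Fm lm F in \<open>auto simp: less_imp_le\<close>)
  moreover have "entropy_density (exp 1) ?\<nu> P \<in> borel_measurable P"
  proof -
    have "entropy_density (exp 1) ?\<nu> P \<in> borel_measurable ?\<nu>"
      unfolding entropy_density_def comp_def by measurable
    then show ?thesis
      by (subst measurable_cong_sets[where M' = ?\<nu> and N' = borel]) (simp_all add: P_def)
  qed
  moreover have "(\<lambda>\<xi>. ln (F \<xi>)) \<in> borel_measurable P"
    using lm by (simp add: P_def)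
  ultimately have "integrable P (entropy_density (exp 1) ?\<nu> P)"
    using AE integrable_cong_AE by blast
  then show "finite_relative_entropy P ?\<nu>"
    using ac by (simp add: finite_relative_entropy_def P_def)
qed

text \<open>The first-order remainder of \<open>x * ln x\<close> at \<open>a\<close>: nonnegative by
  convexity and at most quadratic. Both bounds are \<open>ln y \<le> y - 1\<close>, at
  \<open>a / b\<close> and at \<open>b / a\<close>; they take the place of differentiation under the
  integral.\<close>

lemma entropy_expansion:
  fixes a b :: real
  assumes "0 < a" "0 < b"
  shows "0 \<le> b * ln b - a * ln a - (ln a + 1) * (b - a)"
    and "b * ln b - a * ln a - (ln a + 1) * (b - a) \<le> (b - a)\<^sup>2 / a"
proof -
  have *: "b * ln b - a * ln a - (ln a + 1) * (b - a) = b * ln (b / a) - (b - a)"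
    using assms by (simp add: ln_div algebra_simps)
  have "b * ln (a / b) \<le> b * (a / b - 1)"
    using assms by (intro mult_left_mono ln_le_minus_one) auto
  then show "0 \<le> b * ln b - a * ln a - (ln a + 1) * (b - a)"
    unfolding * using assms by (simp add: ln_div algebra_simps)
  have "b * ln (b / a) \<le> b * (b / a - 1)"
    using assms by (intro mult_left_mono ln_le_minus_one) auto
  then show "b * ln b - a * ln a - (ln a + 1) * (b - a) \<le> (b - a)\<^sup>2 / a"
    unfolding * using assms by (simp add: power2_eq_square field_simps)
qed

text \<open>After subtracting the linear term, the increment of the entropy lies between 0 and
  \<open>(norm (f y - f t))\<^sup>2 / \<delta> t\<close>, because the density is bounded below at
  time \<open>t\<close>. This is of smaller order than \<open>y - t\<close>.\<close>

lemma entropy_has_derivative: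
  fixes f :: "real \<Rightarrow> config \<Rightarrow>\<^sub>C real"
  assumes f: "(f has_vector_derivative f') (at t within {0..})" and t: "0 \<le> t"
    and \<delta>: "\<And>t. 0 < \<delta> t" "\<And>t \<xi>. 0 \<le> t \<Longrightarrow> \<delta> t \<le> f t \<xi>"
  shows "((\<lambda>t. LINT \<xi>|bernoulli_product \<rho>. f t \<xi> * ln (f t \<xi>)) has_real_derivative
    pairing \<rho> f' (Bcontfun (\<lambda>\<xi>. ln (f t \<xi>))) + pairing \<rho> f' (Bcontfun (\<lambda>_. 1))) (at t within {0..})"
proof -
  let ?\<nu> = "bernoulli_product \<rho>"
  interpret \<nu>: prob_space ?\<nu> by (rule prob_space_bernoulli_product)
  interpret pairing: bounded_bilinear "pairing \<rho>" by (rule bounded_bilinear_pairing)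
  have pos: "0 < f t \<xi>" if "0 \<le> t" for t \<xi>
    using \<delta>(1)[of t] \<delta>(2)[OF that, of \<xi>] by simp
  have cln: "continuous_on UNIV (\<lambda>\<xi>. ln (f t \<xi>))" if "0 \<le> t" for t
    by (rule continuous_on_ln_config) (use pos[OF that] in auto)
  define L where "L = Bcontfun (\<lambda>\<xi>. ln (f t \<xi>)) + Bcontfun (\<lambda>_. 1)"
  have L: "apply_bcontfun L \<xi> = ln (f t \<xi>) + 1" for \<xi>
    by (simp add: L_def cln[OF t])
  define h where "h y = (LINT \<xi>|?\<nu>. f y \<xi> * ln (f y \<xi>))" for y
  define rem where "rem y = h y - h t - pairing \<rho> (f y - f t) L" for y
  have inth: "integrable ?\<nu> (\<lambda>\<xi>. f y \<xi> * ln (f y \<xi>))" if "0 \<le> y" for y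
    by (intro integrable_bernoulli continuous_on_mult cln that) auto
  have intp: "integrable ?\<nu> (\<lambda>\<xi>. (f y - f t) \<xi> * L \<xi>)" for y
    by (intro integrable_bernoulli continuous_on_mult continuous_on_apply_bcontfun)
  have rem_eq: "rem y = (LINT \<xi>|?\<nu>. f y \<xi> * ln (f y \<xi>) - f t \<xi> * ln (f t \<xi>) - (f y - f t) \<xi> * L \<xi>)"
    if "0 \<le> y" for y
    unfolding rem_def h_def pairing_def using inth[OF that] inth[OF t] intp[of y] by simp
  have rem0: "0 \<le> rem y" and rem1: "rem y \<le> (norm (f y - f t))\<^sup>2 / \<delta> t" if y: "0 \<le> y" for y
  proof -
    show "0 \<le> rem y"
      unfolding rem_eq[OF y]
    proof (intro Bochner_Integration.integral_nonneg)
      fix \<xi>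
      show "0 \<le> f y \<xi> * ln (f y \<xi>) - f t \<xi> * ln (f t \<xi>) - (f y - f t) \<xi> * L \<xi>"
        using entropy_expansion(1)[OF pos[OF t] pos[OF y], of \<xi> \<xi>] by (simp add: L mult.commute)
    qed
    have "rem y \<le> (LINT \<xi>|?\<nu>. (norm (f y - f t))\<^sup>2 / \<delta> t)"
      unfolding rem_eq[OF y]
    proof (intro integral_mono Bochner_Integration.integrable_diff inth y t intp)
      fix \<xi>
      have "f y \<xi> * ln (f y \<xi>) - f t \<xi> * ln (f t \<xi>) - (f y - f t) \<xi> * L \<xi> \<le> (f y \<xi> - f t \<xi>)\<^sup>2 / f t \<xi>"
        using entropy_expansion(2)[OF pos[OF t] pos[OF y], of \<xi> \<xi>] by (simp add: L mult.commute)
      also have "\<dots> \<le> (norm (f y - f t))\<^sup>2 / \<delta> t"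
      proof (rule frac_le)
        show "(f y \<xi> - f t \<xi>)\<^sup>2 \<le> (norm (f y - f t))\<^sup>2"
          using norm_bounded[of "f y - f t" \<xi>] by (simp add: abs_le_square_iff[symmetric])
      qed (use \<delta> t in auto)
      finally show "f y \<xi> * ln (f y \<xi>) - f t \<xi> * ln (f t \<xi>) - (f y - f t) \<xi> * L \<xi> \<le> (norm (f y - f t))\<^sup>2 / \<delta> t" .
    qed simp
    then show "rem y \<le> (norm (f y - f t))\<^sup>2 / \<delta> t" using \<nu>.prob_space by simp
  qed
  have "(rem has_vector_derivative 0) (at t within {0..})"
  proof -
    define e where "e y = norm (f y - f t - (y - t) *\<^sub>R f') / norm (y - t)" for y
    have e: "(e \<longlongrightarrow> 0) (at t within {0..})"
      using f unfolding e_def by (simp add: has_vector_derivative_def has_derivative_iff_norm)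
    have "(f \<longlongrightarrow> f t) (at t within {0..})"
      using has_vector_derivative_continuous[OF f] by (simp add: continuous_within)
    then have "((\<lambda>y. norm (f y - f t)) \<longlongrightarrow> 0) (at t within {0..})"
      by (intro tendsto_norm_zero LIM_zero)
    then have lim: "((\<lambda>y. (e y + norm f') * norm (f y - f t) / \<delta> t) \<longlongrightarrow> (0 + norm f') * 0 / \<delta> t) (at t within {0..})"
      using \<delta>(1)[of t] by (intro tendsto_intros e) auto
    have "norm (norm (rem y - rem t - (y - t) *\<^sub>R 0) / norm (y - t)) \<le> (e y + norm f') * norm (f y - f t) / \<delta> t"
      if y: "0 \<le> y" "y \<noteq> t" for y
    proof -
      have "rem t = 0" by (simp add: rem_def pairing.zero_left)
      then have "norm (norm (rem y - rem t - (y - t) *\<^sub>R 0) / norm (y - t)) = rem y / \<bar>y - t\<bar>"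
        using rem0[OF y(1)] by simp
      also have "\<dots> \<le> (norm (f y - f t))\<^sup>2 / \<delta> t / \<bar>y - t\<bar>"
        using rem1[OF y(1)] by (intro divide_right_mono) auto
      also have "\<dots> = (norm (f y - f t) / \<bar>y - t\<bar>) * norm (f y - f t) / \<delta> t"
        by (simp add: power2_eq_square)
      also have "\<dots> \<le> (e y + norm f') * norm (f y - f t) / \<delta> t"
      proof (intro divide_right_mono mult_right_mono)
        have "norm (f y - f t) \<le> norm (f y - f t - (y - t) *\<^sub>R f') + \<bar>y - t\<bar> * norm f'"
          using norm_triangle_ineq[of "f y - f t - (y - t) *\<^sub>R f'" "(y - t) *\<^sub>R f'"] by simp
        from divide_right_mono[OF this, of "\<bar>y - t\<bar>"] y
        show "norm (f y - f t) / \<bar>y - t\<bar> \<le> e y + norm f'"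
          by (simp add: e_def add_divide_distrib)
      qed (use \<delta>(1)[of t] in auto)
      finally show ?thesis .
    qed
    then have "\<forall>\<^sub>F y in at t within {0..}. norm (norm (rem y - rem t - (y - t) *\<^sub>R 0) / norm (y - t)) \<le>
        (e y + norm f') * norm (f y - f t) / \<delta> t"
      by (auto simp: eventually_at_filter)
    from Lim_null_comparison[OF this] lim
    show ?thesis
      unfolding has_vector_derivative_def has_derivative_iff_norm by auto
  qed
  moreover have "((\<lambda>y. pairing \<rho> (f y - f t) L) has_vector_derivative pairing \<rho> f' L) (at t within {0..})"
    using bounded_linear.has_vector_derivative[OF pairing.bounded_linear_left[of L]
        has_vector_derivative_diff[OF f has_vector_derivative_const[of "f t"]]] by simp
  ultimately have "((\<lambda>y. rem y + pairing \<rho> (f y - f t) L) has_vector_derivative 0 + pairing \<rho> f' L) (at t within {0..})"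
    by (rule has_vector_derivative_add)
  then have "((\<lambda>y. h y - h t) has_vector_derivative pairing \<rho> f' L) (at t within {0..})"
    by (simp add: rem_def)
  from has_vector_derivative_add[OF this has_vector_derivative_const[of "h t"]]
  have "(h has_vector_derivative pairing \<rho> f' L) (at t within {0..})" by simp
  then show ?thesis
    by (simp add: has_real_derivative_iff_has_vector_derivative h_def[abs_def] L_def pairing.add_right)
qed

text \<open>Local approximants in the graph are eventually at least \<open>\<delta> / 2\<close>,
  where \<open>ln\<close> is Lipschitz, so their logarithms converge uniformly as well and both
  sides of the inequality pass to the limit.\<close>

lemma closure_entropy_production:
  fixes u v :: "config \<Rightarrow>\<^sub>C real"
  assumes c: "c \<in> local_functions" and r: "\<And>z. z \<in> R \<Longrightarrow> r z \<in> local_functions"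
    and uv: "(u, v - \<beta> *\<^sub>R walk_adjoint_op R r u) \<in> gas_closure c"
    and \<delta>: "0 < \<delta>" "\<And>\<xi>. \<delta> \<le> u \<xi>"
    and loc: "\<And>w. w \<in> local_functions \<Longrightarrow> (\<And>\<eta>. 0 < w \<eta>) \<Longrightarrow>
      (LINT \<eta>|bernoulli_product \<rho>. (gas_generator c w \<eta> + \<beta> * walk_adjoint R r w \<eta>) * ln (w \<eta>)) \<le>
        D * (LINT \<eta>|bernoulli_product \<rho>. w \<eta>)"
  shows "pairing \<rho> v (Bcontfun (\<lambda>\<xi>. ln (u \<xi>))) \<le> D * pairing \<rho> u (Bcontfun (\<lambda>_. 1))"
proof -
  interpret pairing: bounded_bilinear "pairing \<rho>" by (rule bounded_bilinear_pairing)
  obtain w where w: "\<And>k. w k \<in> local_functions" "(\<lambda>k. Bcontfun (w k)) \<longlonglongrightarrow> u"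
    "(\<lambda>k. Bcontfun (gas_generator c (w k))) \<longlonglongrightarrow> v - \<beta> *\<^sub>R walk_adjoint_op R r u"
    using gas_closureD[OF uv c] by blast
  note wc [simp] = local_continuous[OF w(1)]
  have "(\<lambda>k. norm (Bcontfun (w k) - u)) \<longlonglongrightarrow> 0"
    using w(2) by (intro tendsto_norm_zero LIM_zero)
  from order_tendstoD(2)[OF this, of "\<delta> / 2"] \<delta>(1)
  have "\<forall>\<^sub>F k in sequentially. norm (Bcontfun (w k) - u) < \<delta> / 2" by simp
  then have close: "\<forall>\<^sub>F k in sequentially. \<forall>\<xi>. \<delta> / 2 \<le> w k \<xi>"
  proof eventually_elim
    case (elim k)
    show ?case
    proof
      fix \<xi> show "\<delta> / 2 \<le> w k \<xi>"
        using norm_bounded[of "Bcontfun (w k) - u" \<xi>] elim \<delta>(2)[of \<xi>] by simp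
    qed
  qed
  have lnu: "continuous_on UNIV (\<lambda>\<xi>. ln (u \<xi>))"
    by (rule continuous_on_ln_config) (use \<delta> in \<open>auto intro: less_le_trans\<close>)
  have lnw: "continuous_on UNIV (\<lambda>\<xi>. ln (w k \<xi>))" for k
    by (rule local_continuous[OF local_comp[OF w(1)]])
  have ln_lip: "\<bar>ln a - ln b\<bar> \<le> \<bar>a - b\<bar> * (2 / \<delta>)" if ab: "\<delta> / 2 \<le> a" "\<delta> / 2 \<le> b" for a b
  proof -
    have *: "ln a - ln b \<le> \<bar>a - b\<bar> * (2 / \<delta>)" if "\<delta> / 2 \<le> a" "\<delta> / 2 \<le> b" for a b
    proof -
      have pos: "0 < a" "0 < b" using that \<delta>(1) by auto
      have "ln a - ln b = ln (a / b)" using pos by (simp add: ln_div)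
      also have "\<dots> \<le> a / b - 1" using pos by (intro ln_le_minus_one) auto
      also have "\<dots> = (a - b) / b" using pos by (simp add: diff_divide_distrib)
      also have "\<dots> \<le> \<bar>a - b\<bar> / (\<delta> / 2)"
        using that \<delta>(1) by (intro frac_le) auto
      finally show ?thesis by (simp add: mult.commute)
    qed
    show ?thesis using *[OF ab] *[OF ab(2,1)] by (simp add: abs_le_iff abs_minus_commute)
  qed
  have "(\<lambda>k. Bcontfun (\<lambda>\<xi>. ln (w k \<xi>))) \<longlonglongrightarrow> Bcontfun (\<lambda>\<xi>. ln (u \<xi>))"
  proof -
    have "\<forall>\<^sub>F k in sequentially. norm (Bcontfun (\<lambda>\<xi>. ln (w k \<xi>)) - Bcontfun (\<lambda>\<xi>. ln (u \<xi>))) \<le>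
        norm (Bcontfun (w k) - u) * (2 / \<delta>)"
      using close
    proof eventually_elim
      case (elim k)
      show ?case
      proof (rule norm_bound)
        fix \<xi>
        have "\<bar>ln (w k \<xi>) - ln (u \<xi>)\<bar> \<le> \<bar>w k \<xi> - u \<xi>\<bar> * (2 / \<delta>)"
          using elim \<delta>(2)[of \<xi>] \<delta>(1) by (intro ln_lip) auto
        also have "\<dots> \<le> norm (Bcontfun (w k) - u) * (2 / \<delta>)"
          using norm_bounded[of "Bcontfun (w k) - u" \<xi>] \<delta>(1) by (intro mult_right_mono) auto
        finally show "norm (apply_bcontfun (Bcontfun (\<lambda>\<xi>. ln (w k \<xi>)) - Bcontfun (\<lambda>\<xi>. ln (u \<xi>))) \<xi>) \<le>
            norm (Bcontfun (w k) - u) * (2 / \<delta>)"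
          by (simp add: lnu lnw)
      qed
    qed
    moreover have "(\<lambda>k. norm (Bcontfun (w k) - u) * (2 / \<delta>)) \<longlonglongrightarrow> 0"
      using \<open>(\<lambda>k. norm (Bcontfun (w k) - u)) \<longlonglongrightarrow> 0\<close> by (rule tendsto_mult_left_zero)
    ultimately have "(\<lambda>k. Bcontfun (\<lambda>\<xi>. ln (w k \<xi>)) - Bcontfun (\<lambda>\<xi>. ln (u \<xi>))) \<longlonglongrightarrow> 0"
      by (rule Lim_null_comparison)
    then show ?thesis by (rule LIM_zero_cancel)
  qed
  moreover have "(\<lambda>k. Bcontfun (gas_generator c (w k)) + \<beta> *\<^sub>R walk_adjoint_op R r (Bcontfun (w k))) \<longlonglongrightarrow>
      (v - \<beta> *\<^sub>R walk_adjoint_op R r u) + \<beta> *\<^sub>R walk_adjoint_op R r u"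
    by (intro tendsto_add tendsto_scaleR tendsto_const w
        bounded_linear.tendsto[OF bounded_linear_walk_adjoint_op[OF r]])
  ultimately have "(\<lambda>k. pairing \<rho> (Bcontfun (gas_generator c (w k)) + \<beta> *\<^sub>R walk_adjoint_op R r (Bcontfun (w k)))
      (Bcontfun (\<lambda>\<xi>. ln (w k \<xi>)))) \<longlonglongrightarrow> pairing \<rho> v (Bcontfun (\<lambda>\<xi>. ln (u \<xi>)))"
    by (intro pairing.tendsto) simp_all
  moreover have "(\<lambda>k. D * pairing \<rho> (Bcontfun (w k)) (Bcontfun (\<lambda>_. 1))) \<longlonglongrightarrow> D * pairing \<rho> u (Bcontfun (\<lambda>_. 1))"
    by (intro tendsto_mult tendsto_const pairing.tendsto w)
  moreover have "\<forall>\<^sub>F k in sequentially.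
      pairing \<rho> (Bcontfun (gas_generator c (w k)) + \<beta> *\<^sub>R walk_adjoint_op R r (Bcontfun (w k)))
        (Bcontfun (\<lambda>\<xi>. ln (w k \<xi>))) \<le> D * pairing \<rho> (Bcontfun (w k)) (Bcontfun (\<lambda>_. 1))"
    using close
  proof eventually_elim
    case (elim k)
    have "0 < w k \<eta>" for \<eta> using elim \<delta>(1) by (auto intro: less_le_trans[of 0 "\<delta> / 2"])
    from loc[OF w(1) this] show ?case
      by (simp add: pairing_def lnw r local_continuous[OF local_gas_generator[OF c w(1)]])
  qed
  ultimately show ?thesis
    using tendsto_le[OF sequentially_bot] by blast
qed

theorem theorem3p1:
  fixes \<rho> \<epsilon>0 :: real and R :: "int set" and r :: "int \<Rightarrow> config \<Rightarrow> real"
  assumes "0 < \<rho>" "\<rho> < 1" and "0 < \<epsilon>0"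
    and "finite R" "R \<subseteq> UNIV - {0}"
    and "\<And>z. z \<in> R \<Longrightarrow> r z \<in> local_functions"
    and "\<And>z \<xi>. z \<in> R \<Longrightarrow> 0 \<le> r z \<xi>"
  shows "\<exists>C. \<forall>c (n :: nat) (M :: 'w measure) \<eta> x H.
    interaction_rate \<epsilon>0 c \<longrightarrow>
    lattice_gas \<rho> c M \<eta> \<longrightarrow>
    walk_on_gas c R r n M \<eta> x \<longrightarrow>
    H = (\<lambda>t. relative_entropy (distr M borel (environment n \<eta> x t)) (bernoulli_product \<rho>)) \<longrightarrow>
    (\<forall>t\<ge>0.
      finite_relative_entropy (distr M borel (environment n \<eta> x t)) (bernoulli_product \<rho>) \<and>
      (\<exists>H'. (H has_real_derivative H') (at t within {0..}) \<and> H' \<le> C) \<and>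
      H t \<le> C * t)"
proof -
  let ?\<nu> = "bernoulli_product \<rho>"
  note r = assms(6,7)
  interpret \<nu>: prob_space ?\<nu> by (rule prob_space_bernoulli_product)
  interpret pairing: bounded_bilinear "pairing \<rho>" by (rule bounded_bilinear_pairing)
  obtain C where C: "\<forall>c u \<beta>. interaction_rate \<epsilon>0 c \<longrightarrow> u \<in> local_functions \<longrightarrow> (\<forall>\<eta>. 0 < u \<eta>) \<longrightarrow> 0 \<le> \<beta> \<longrightarrow>
    (LINT \<eta>|?\<nu>. (gas_generator c u \<eta> + \<beta> * walk_adjoint R r u \<eta>) * ln (u \<eta>)) \<le>
      C * \<beta>\<^sup>2 * (LINT \<eta>|?\<nu>. u \<eta>)"
    using local_entropy_production[where R = R and r = r and \<rho> = \<rho>, OF assms(3) r] by blast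
  define one where "one = Bcontfun (\<lambda>_ :: config. 1 :: real)"
  have one [simp]: "apply_bcontfun one = (\<lambda>_. 1)" by (simp add: one_def)
  have walk_one: "walk_op R r one = 0"
    by (rule bcontfun_eqI) (simp add: r walk_generator_def)
  show ?thesis
  \<comment> \<open>The maximum with 0 covers \<open>n = 0\<close>, where the entropy production is
    0.\<close>
  proof (intro exI[of _ "max C 0"] allI impI)
    fix c and n :: nat and M :: "'w measure" and \<eta> x H and t :: real
    assume c: "interaction_rate \<epsilon>0 c" and gas: "lattice_gas \<rho> c M \<eta>" and walk: "walk_on_gas c R r n M \<eta> x"
      and H: "H = (\<lambda>t. relative_entropy (distr M borel (environment n \<eta> x t)) ?\<nu>)" and t: "0 \<le> t"
    have cl: "c \<in> local_functions" using c by (simp add: interaction_rate_def)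
    define m \<beta> where "m = (real n)\<^sup>2" and "\<beta> = 1 / real n"
    have m: "0 \<le> m" and \<beta>: "0 \<le> \<beta>" by (simp_all add: m_def \<beta>_def)
    obtain S where S: "feller_semigroup S" "generator_graph S = graph_closure local_functions (gas_generator c)"
      using gas unfolding lattice_gas_def markov_process_generated_by_def by blast
    interpret M: prob_space M
      using gas by (simp add: lattice_gas_def markov_process_generated_by_def)
    obtain f g \<delta> where f0: "f 0 = Bcontfun (\<lambda>_. 1)"
      and df: "\<And>t. 0 \<le> t \<Longrightarrow> (f has_vector_derivative g t) (at t within {0..})"
      and clf: "\<And>t. 0 \<le> t \<Longrightarrow> (f t, g t - \<beta> *\<^sub>R walk_adjoint_op R r (f t)) \<in> gas_closure c"
      and \<delta>: "\<And>t. 0 < \<delta> t" "\<And>t \<xi>. 0 \<le> t \<Longrightarrow> \<delta> t \<le> f t \<xi>"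
    proof (rule forward_curve[where R = R and r = r, OF S cl r \<beta>], goal_cases)
      case (3 f g \<delta>)
      from 3(1)[OF 3(2-6)] show ?case .
    qed
    have pos: "0 < f t \<xi>" if "0 \<le> t" for t \<xi>
      using \<delta>(1)[of t] \<delta>(2)[OF that, of \<xi>] by simp
    have one_cl: "(one, 0) \<in> gas_closure c"
    proof -
      have "(Bcontfun (\<lambda>_. 1), Bcontfun (gas_generator c (\<lambda>_. 1))) \<in> gas_closure c"
        by (rule gas_closureI[OF local_const cl])
      moreover have "Bcontfun (gas_generator c (\<lambda>_. 1)) = 0"
        by (rule bcontfun_eqI) simp
      ultimately show ?thesis by (simp add: one_def)
    qed
    \<comment> \<open>The constant 1 is a stationary solution of the backward equation, so duality
      with it preserves the total mass.\<close>
    have mass: "pairing \<rho> (f s) one = 1" if "0 \<le> s" for s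
    proof -
      have "pairing \<rho> (f s) one = pairing \<rho> (f 0) one"
        by (rule forward_backward_pairing[OF c r(1) df clf, where g = "\<lambda>_. one" and g' = "\<lambda>_. 0"])
           (use that one_cl walk_one in simp_all)
      then show ?thesis using \<nu>.prob_space by (simp add: f0 pairing_def)
    qed
    \<comment> \<open>Removes the summand 1 from \<open>ln f + 1\<close> in the derivative of the
      entropy.\<close>
    have mass': "pairing \<rho> (g s) one = 0" if "0 \<le> s" for s
    proof -
      have "pairing \<rho> (g s - \<beta> *\<^sub>R walk_adjoint_op R r (f s)) one = pairing \<rho> (f s) 0"
        by (rule pairing_gas_closure[OF c clf[OF that] one_cl])
      then show ?thesis
        by (simp add: pairing.diff_left pairing.scaleR_left pairing_walk_adjoint[OF r(1)] walk_one
            pairing.zero_right)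
    qed

    \<comment> \<open>Evolving a local \<open>u\<close> backward and pairing it with the initial
      density 1 is the same as pairing \<open>u\<close> with the forward density. Both solutions run
      in the time of the gas, hence the argument \<open>m * t\<close>.\<close>
    have law: "distr M borel (environment n \<eta> x t) = density ?\<nu> (\<lambda>\<xi>. ennreal (f (m * t) \<xi>))" if t: "0 \<le> t" for t
    proof (rule measure_eq_density_if_local)
      have env: "environment n \<eta> x t \<in> borel_measurable M" by (rule measurable_environment[OF walk t])
      then show "prob_space (distr M borel (environment n \<eta> x t))" by (rule M.prob_space_distr)
      fix u assume u: "u \<in> local_functions"
      obtain b b' where b: "b 0 = Bcontfun u"
        "\<And>t. 0 \<le> t \<Longrightarrow> (b has_vector_derivative b' t) (at t within {0..})"
        "\<And>t. 0 \<le> t \<Longrightarrow> (b t, b' t - \<beta> *\<^sub>R walk_op R r (b t)) \<in> gas_closure c"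
      proof (rule backward_curve[where R = R and r = r and \<beta> = \<beta>, OF S cl u r(1)], goal_cases)
        case (2 b b')
        from 2(1)[OF 2(2-4)] show ?case .
      qed
      have "(LINT \<xi>|distr M borel (environment n \<eta> x t). u \<xi>) = (LINT \<omega>|M. b 0 (environment n \<eta> x t \<omega>))"
        using u env by (simp add: integral_distr borel_measurable_continuous_onI local_continuous b(1))
      also have "\<dots> = (LINT \<xi>|?\<nu>. b (m * t) \<xi>)"
        unfolding m_def
        by (rule environment_expectation[OF cl gas walk assms(4) r(1) t b(2) b(3)[unfolded \<beta>_def]])
      also have "\<dots> = pairing \<rho> (f 0) (b (m * t))" by (simp add: f0 pairing_def)
      also have "\<dots> = pairing \<rho> (f (m * t)) (b 0)"
        by (rule forward_backward_pairing[OF c r(1) df clf b(2,3), symmetric]) (use m t in auto)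
      also have "\<dots> = (LINT \<xi>|?\<nu>. f (m * t) \<xi> * u \<xi>)"
        by (simp add: pairing_def b(1) local_continuous u)
      finally show "(LINT \<xi>|distr M borel (environment n \<eta> x t). u \<xi>) = (LINT \<xi>|?\<nu>. f (m * t) \<xi> * u \<xi>)" .
    qed (use pos m t in \<open>auto intro: less_imp_le\<close>)

    define h where "h s = (LINT \<xi>|?\<nu>. f s \<xi> * ln (f s \<xi>))" for s
    have ent: "finite_relative_entropy (distr M borel (environment n \<eta> x t)) ?\<nu>" "H t = h (m * t)" if t: "0 \<le> t" for t
    proof -
      have "prob_space (density ?\<nu> (\<lambda>\<xi>. ennreal (f (m * t) \<xi>)))"
        unfolding law[OF t, symmetric] by (rule M.prob_space_distr[OF measurable_environment[OF walk t]])
      note * = entropy_density_bernoulli[OF _ _ this]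
      show "finite_relative_entropy (distr M borel (environment n \<eta> x t)) ?\<nu>"
        unfolding law[OF t] by (rule *(1)) (use pos m t in auto)
      show "H t = h (m * t)"
        unfolding H law[OF t] h_def by (rule *(2)) (use pos m t in auto)
    qed
    define D where "D s = pairing \<rho> (g s) (Bcontfun (\<lambda>\<xi>. ln (f s \<xi>)))" for s
    have dh: "(h has_real_derivative D s) (at s within {0..})" if "0 \<le> s" for s
      using entropy_has_derivative[OF df[OF that] that \<delta>, of \<rho>] mass'[OF that]
      unfolding h_def[abs_def] D_def one_def by simp
    have D_le: "D s \<le> C * \<beta>\<^sup>2" if "0 \<le> s" for s
    proof -
      have "D s \<le> C * \<beta>\<^sup>2 * pairing \<rho> (f s) (Bcontfun (\<lambda>_. 1))"
        unfolding D_def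
        by (rule closure_entropy_production[OF cl r(1) clf[OF that] \<delta>(1) \<delta>(2)[OF that]])
           (use C c \<beta> in blast)+
      then show ?thesis using mass[OF that] by (simp add: one_def)
    qed
    have dH: "(H has_real_derivative m * D (m * s)) (at s within {0..})" and mD: "m * D (m * s) \<le> max C 0"
      if s: "0 \<le> s" for s
    proof -
      have "(h has_vector_derivative D (m * s)) (at (m * s) within (\<lambda>s. m * s) ` {0..})"
        using dh[of "m * s"] m s
        by (auto simp: has_real_derivative_iff_has_vector_derivative intro: has_vector_derivative_within_subset)
      moreover have "((\<lambda>s. m * s) has_vector_derivative m) (at s within {0..})"
        by (auto intro!: derivative_eq_intros simp: has_real_derivative_iff_has_vector_derivative[symmetric])
      ultimately have "((\<lambda>s. h (m * s)) has_vector_derivative m *\<^sub>R D (m * s)) (at s within {0..})"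
        by (auto dest: vector_diff_chain_within simp: o_def)
      then have "((\<lambda>s. h (m * s)) has_real_derivative m * D (m * s)) (at s within {0..})"
        by (simp add: has_real_derivative_iff_has_vector_derivative)
      then show "(H has_real_derivative m * D (m * s)) (at s within {0..})"
        by (rule has_field_derivative_transform_within[where d = 1]) (use s ent(2) in auto)
      \<comment> \<open>Undoing the time change: \<open>m * \<beta>\<^sup>2\<close> is 1 for
        positive \<open>n\<close> and 0 for \<open>n = 0\<close>.\<close>
      have "m * D (m * s) \<le> m * (C * \<beta>\<^sup>2)"
        using m s by (intro mult_left_mono D_le) auto
      also have "\<dots> \<le> max C 0"
        by (cases "n = 0") (simp_all add: m_def \<beta>_def power_one_over)
      finally show "m * D (m * s) \<le> max C 0" .
    qed
    have "H t \<le> max C 0 * t"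
    proof -
      have "\<exists>s\<in>{0..t}. H t - H 0 = (m * D (m * s)) * (t - 0)"
      proof (rule mvt_very_simple[OF t])
        fix s assume "0 \<le> s" "s \<le> t"
        then have "(H has_real_derivative m * D (m * s)) (at s within {0..t})"
          using has_field_derivative_subset[OF dH, of s "{0..t}"] by auto
        then show "(H has_derivative (\<lambda>y. m * D (m * s) * y)) (at s within {0..t})"
          by (simp add: has_field_derivative_def)
      qed
      then obtain s where s: "s \<in> {0..t}" "H t - H 0 = (m * D (m * s)) * t" by auto
      have "H 0 = 0" using ent(2)[of 0] by (simp add: h_def f0)
      then show ?thesis using s mD[of s] t by (auto intro: mult_right_mono)
    qed
    with ent(1)[OF t] dH[OF t] mD[OF t]
    show "finite_relative_entropy (distr M borel (environment n \<eta> x t)) ?\<nu> \<and>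
      (\<exists>H'. (H has_real_derivative H') (at t within {0..}) \<and> H' \<le> max C 0) \<and>
      H t \<le> max C 0 * t"
      by blast
  qed
qed

end
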